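(* Let $k$ be a positive integer, let $\Lambda$ be a left and right noetherian ring which is quasi $k$-Gorenstein, let $d$ be an integer with $0\leq d\leq k-1$, and let $M$ be a $d$th syzygy module in $\mathrm{mod}\,\Lambda$. Then there exist a projective module $P$ in $\mathrm{mod}\,\Lambda$, a $d$th syzygy $B$ of $\mathrm{Ext}_{\Lambda}^{d+1}(D(M),\Lambda)$ which is a submodule of $M\oplus P$, and a resulting exact sequence in $\mathrm{mod}\,\Lambda$ $$0\to B\to M\oplus P\to C\to 0$$ with the following properties: (1) $C$ is a $(d+1)$st syzygy module. (2) $\mathrm{r.pd}_{\Lambda}(B^* )\leq d-1$. (3) The sequence $0\to B\to M\oplus P\to C\to 0$ is dual exact, that is, the induced sequence $0\to C^*\to M^*\oplus P^*\to B^*\to 0$ is exact.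
   Context: $\mathrm{mod}\,\Lambda$ (resp. $\mathrm{mod}\,\Lambda^{op}$) is the category of finitely generated left (resp. right) $\Lambda$-modules. $(-)^*=\mathrm{Hom}_\Lambda(-,\Lambda)$, interchanging left and right modules; likewise $\mathrm{Ext}^i_\Lambda(-,\Lambda)$ interchanges $\mathrm{mod}\,\Lambda$ and $\mathrm{mod}\,\Lambda^{op}$. For a finitely generated (left or right) module $X$ and an integer $i\ge 0$, $\mathrm{grade}\,X\geq i$ means $\mathrm{Ext}_\Lambda^j(X,\Lambda)=0$ for all $0\leq j<i$. $\Lambda$ is quasi $k$-Gorenstein if $\mathrm{grade}\,\mathrm{Ext}^i_\Lambda(N,\Lambda)\geq i$ for every $N\in \mathrm{mod}\,\Lambda^{op}$ and every $1\leq i\leq k$. $\mathrm{r.pd}_\Lambda$ denotes right projective dimension; a bound $\mathrm{r.pd}_\Lambda(X)\le -1$ means $X=0$. A module $M$ is a $d$th syzygy module if there is an exact sequence $0\to M\to P_{d-1}\to\cdots\to P_0$ of finitely generated modules with all $P_i$ projective (every finitely generated module is a $0$th syzygy module). For a finitely generated module $X$, a $d$th syzygy of $X$ is a module $B$ fitting in an exact sequence $0\to B\to P_{d-1}\to\cdots\to P_0\to X\to 0$ with all $P_i$ finitely generated projective (the $0$th syzygy of $X$ is $X$). For $M\in\mathrm{mod}\,\Lambda$, choose a presentation $P_1\to P_0\to M\to 0$ with $P_0,P_1$ finitely generated projective and set $D(M)=\mathrm{Coker}(P_0^*\to P_1^* )\in\mathrm{mod}\,\Lambda^{op}$. Up to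 isomorphism, the modules $\mathrm{Ext}^i_\Lambda(D(M),\Lambda)$, $i\geq 1$, do not depend on the choice of presentation. *)

theory Defs
  imports "HOL-Algebra.Module" "HOL-Algebra.AbelCoset"
begin

section \<open>Left and right modules over a noncommutative ring\<close>

text \<open>
  HOL-Algebra's locale \<^locale>\<open>module\<close> demands a commutative ring of scalars, so modules over an
  arbitrary ring are introduced here, on the library's record type for modules. As there, the
  fields \<^const>\<open>mult\<close> and \<^const>\<open>one\<close> of a module record are never used.

  Right modules over \<open>R\<close> are left modules over the opposite ring.
\<close>

locale left_module = R?: ring R + M?: abelian_group M
  for R :: "'a ring" (structure) and M :: "('a, 'm) module" (structure) +
  assumes smult_closed:
      "\<lbrakk>a \<in> carrier R; x \<in> carrier M\<rbrakk> \<Longrightarrow> a \<odot>\<^bsub>M\<^esub> x \<in> carrier M"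
    and smult_l_distr:
      "\<lbrakk>a \<in> carrier R; b \<in> carrier R; x \<in> carrier M\<rbrakk> \<Longrightarrow>
        (a \<oplus>\<^bsub>R\<^esub> b) \<odot>\<^bsub>M\<^esub> x = a \<odot>\<^bsub>M\<^esub> x \<oplus>\<^bsub>M\<^esub> b \<odot>\<^bsub>M\<^esub> x"
    and smult_r_distr:
      "\<lbrakk>a \<in> carrier R; x \<in> carrier M; y \<in> carrier M\<rbrakk> \<Longrightarrow>
        a \<odot>\<^bsub>M\<^esub> (x \<oplus>\<^bsub>M\<^esub> y) = a \<odot>\<^bsub>M\<^esub> x \<oplus>\<^bsub>M\<^esub> a \<odot>\<^bsub>M\<^esub> y"
    and smult_assoc:
      "\<lbrakk>a \<in> carrier R; b \<in> carrier R; x \<in> carrier M\<rbrakk> \<Longrightarrow>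
        (a \<otimes>\<^bsub>R\<^esub> b) \<odot>\<^bsub>M\<^esub> x = a \<odot>\<^bsub>M\<^esub> (b \<odot>\<^bsub>M\<^esub> x)"
    and smult_one:
      "x \<in> carrier M \<Longrightarrow> \<one>\<^bsub>R\<^esub> \<odot>\<^bsub>M\<^esub> x = x"

definition op_ring :: "'a ring \<Rightarrow> 'a ring" where
  "op_ring R = R\<lparr>mult := \<lambda>x y. y \<otimes>\<^bsub>R\<^esub> x\<rparr>"

definition regular_module :: "'a ring \<Rightarrow> ('a, 'a) module" where
  "regular_module R =
     \<lparr>carrier = carrier R, mult = mult R, one = one R, zero = zero R, add = add R, smult = mult R\<rparr>"

definition fg_module :: "'a ring \<Rightarrow> ('a, 'm) module \<Rightarrow> bool" where
  "fg_module R M \<longleftrightarrow> left_module R M \<and>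
     (\<exists>A. finite A \<and> A \<subseteq> carrier M \<and> (\<forall>N. submodule N R M \<and> A \<subseteq> N \<longrightarrow> N = carrier M))"

definition left_noetherian :: "'a ring \<Rightarrow> bool" where
  "left_noetherian R \<longleftrightarrow> ring R \<and>
     (\<forall>I. submodule I R (regular_module R) \<longrightarrow> fg_module R ((regular_module R)\<lparr>carrier := I\<rparr>))"

definition right_noetherian :: "'a ring \<Rightarrow> bool" where
  "right_noetherian R \<longleftrightarrow> left_noetherian (op_ring R)"

definition lmod_hom :: "'a ring \<Rightarrow> ('a, 'm) module \<Rightarrow> ('a, 'n) module \<Rightarrow> ('m \<Rightarrow> 'n) set" where
  "lmod_hom R M N = {h \<in> carrier M \<rightarrow> carrier N.
     (\<forall>x\<in>carrier M. \<forall>y\<in>carrier M. h (x \<oplus>\<^bsub>M\<^esub> y) = h x \<oplus>\<^bsub>N\<^esub> h y) \<and>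
     (\<forall>a\<in>carrier R. \<forall>x\<in>carrier M. h (a \<odot>\<^bsub>M\<^esub> x) = a \<odot>\<^bsub>N\<^esub> h x)}"

definition lmod_iso :: "'a ring \<Rightarrow> ('a, 'm) module \<Rightarrow> ('a, 'n) module \<Rightarrow> bool" where
  "lmod_iso R M N \<longleftrightarrow> (\<exists>h\<in>lmod_hom R M N. bij_betw h (carrier M) (carrier N))"

definition zero_module :: "('a, 'm) module \<Rightarrow> bool" where
  "zero_module M \<longleftrightarrow> carrier M = {\<zero>\<^bsub>M\<^esub>}"

definition direct_sum :: "('a, 'm) module \<Rightarrow> ('a, 'n) module \<Rightarrow> ('a, 'm \<times> 'n) module" where
  "direct_sum M N =
     \<lparr>carrier = carrier M \<times> carrier N, mult = undefined, one = undefined,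
      zero = (\<zero>\<^bsub>M\<^esub>, \<zero>\<^bsub>N\<^esub>),
      add = \<lambda>x y. (fst x \<oplus>\<^bsub>M\<^esub> fst y, snd x \<oplus>\<^bsub>N\<^esub> snd y),
      smult = \<lambda>a x. (a \<odot>\<^bsub>M\<^esub> fst x, a \<odot>\<^bsub>N\<^esub> snd x)\<rparr>"

definition quotient_module :: "('a, 'm) module \<Rightarrow> 'm set \<Rightarrow> ('a, 'm set) module" where
  "quotient_module M N =
     \<lparr>carrier = a_rcosets\<^bsub>M\<^esub> N, mult = undefined, one = undefined, zero = N,
      add = \<lambda>A B. A <+>\<^bsub>M\<^esub> B,
      smult = \<lambda>a A. \<Union>x\<in>A. N +>\<^bsub>M\<^esub> (a \<odot>\<^bsub>M\<^esub> x)\<rparr>"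

definition short_exact ::
  "'a ring \<Rightarrow> ('a, 'l) module \<Rightarrow> ('a, 'm) module \<Rightarrow> ('a, 'n) module \<Rightarrow> ('l \<Rightarrow> 'm) \<Rightarrow> ('m \<Rightarrow> 'n) \<Rightarrow> bool"
  where
  "short_exact R L M N f g \<longleftrightarrow>
     left_module R L \<and> left_module R M \<and> left_module R N \<and>
     f \<in> lmod_hom R L M \<and> g \<in> lmod_hom R M N \<and>
     inj_on f (carrier L) \<and> f ` carrier L = a_kernel M N g \<and> g ` carrier M = carrier N"


section \<open>Duals\<close>

text \<open>
  The dual \<open>Hom\<^sub>R(M, R)\<close> of a left \<open>R\<close>-module is a right \<open>R\<close>-module, that is, a left module over
  \<^term>\<open>op_ring R\<close>, by \<open>(f a)(x) = f(x) a\<close>. Homomorphisms in it are made extensional so that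
  equality of elements is equality on \<^term>\<open>carrier M\<close>. Since \<open>op_ring (op_ring R) = R\<close>,
  \<open>dual_module (op_ring R)\<close> sends right \<open>R\<close>-modules to left \<open>R\<close>-modules.
\<close>

definition dual_module :: "'a ring \<Rightarrow> ('a, 'm) module \<Rightarrow> ('a, 'm \<Rightarrow> 'a) module" where
  "dual_module R M =
     \<lparr>carrier = lmod_hom R M (regular_module R) \<inter> extensional (carrier M),
      mult = undefined, one = undefined,
      zero = \<lambda>x\<in>carrier M. \<zero>\<^bsub>R\<^esub>,
      add = \<lambda>f g. \<lambda>x\<in>carrier M. f x \<oplus>\<^bsub>R\<^esub> g x,
      smult = \<lambda>a f. \<lambda>x\<in>carrier M. f x \<otimes>\<^bsub>R\<^esub> a\<rparr>"

definition dual_map :: "('a, 'm) module \<Rightarrow> ('m \<Rightarrow> 'n) \<Rightarrow> ('n \<Rightarrow> 'a) \<Rightarrow> ('m \<Rightarrow> 'a)" where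
  "dual_map M f = (\<lambda>\<phi>. \<lambda>x\<in>carrier M. \<phi> (f x))"


section \<open>Projective modules, syzygies and projective dimension\<close>

text \<open>
  Every finitely generated \<open>R\<close>-module is a quotient of some \<open>R\<^sup>n\<close>, hence isomorphic to a module
  whose elements are sets of sequences in \<open>R\<close>. Quantification over all finitely generated modules
  is therefore rendered by quantification over modules with elements in the following type.
\<close>

type_synonym 'a univ = "(nat \<Rightarrow> 'a) set"

text \<open>
  Projectivity is the lifting property along epimorphisms. For finitely generated \<open>P\<close> it is enough
  to test it on modules in the universe, since it is only needed for some \<open>R\<^sup>n \<rightarrow> P\<close>.
\<close>

definition fg_projective :: "'a ring \<Rightarrow> ('a, 'm) module \<Rightarrow> bool" where
  "fg_projective R P \<longleftrightarrow> fg_module R P \<and>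
     (\<forall>(X :: ('a, 'a univ) module) (Y :: ('a, 'a univ) module) g h.
        left_module R X \<and> left_module R Y \<and>
        g \<in> lmod_hom R X Y \<and> g ` carrier X = carrier Y \<and> h \<in> lmod_hom R P Y \<longrightarrow>
        (\<exists>l\<in>lmod_hom R P X. \<forall>x\<in>carrier P. g (l x) = h x))"

text \<open>
  In the next two definitions the end terms of the exact sequences are only required to be
  isomorphic to the given modules, so that all terms can live in the same type.
  A \<open>d\<close>th syzygy module has an exact sequence
  \<open>0 \<rightarrow> Q\<^sub>d \<rightarrow> Q\<^sub>d\<^sub>-\<^sub>1 \<rightarrow> \<dots> \<rightarrow> Q\<^sub>0\<close> with \<open>Q\<^sub>d \<cong> M\<close> and the other terms projective.
\<close>

definition syzygy_module :: "'a ring \<Rightarrow> nat \<Rightarrow> ('a, 'm) module \<Rightarrow> bool" where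
  "syzygy_module R d M \<longleftrightarrow> fg_module R M \<and>
     (\<exists>(Q :: nat \<Rightarrow> ('a, 'a univ) module) f.
        left_module R (Q d) \<and> lmod_iso R (Q d) M \<and>
        (\<forall>i<d. fg_projective R (Q i)) \<and>
        (\<forall>i<d. f i \<in> lmod_hom R (Q (Suc i)) (Q i)) \<and>
        (0 < d \<longrightarrow> inj_on (f (d - 1)) (carrier (Q d))) \<and>
        (\<forall>i. Suc i < d \<longrightarrow>
           f (Suc i) ` carrier (Q (Suc (Suc i))) = a_kernel (Q (Suc i)) (Q i) (f i)))"

text \<open>
  \<open>B\<close> is a \<open>d\<close>th syzygy of \<open>X\<close> if there is an exact sequence
  \<open>0 \<rightarrow> Q\<^sub>d\<^sub>+\<^sub>1 \<rightarrow> Q\<^sub>d \<rightarrow> \<dots> \<rightarrow> Q\<^sub>1 \<rightarrow> Q\<^sub>0 \<rightarrow> 0\<close> with \<open>Q\<^sub>d\<^sub>+\<^sub>1 \<cong> B\<close>, \<open>Q\<^sub>0 \<cong> X\<close> and the terms in between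
  projective. For \<open>d = 0\<close> this says \<open>B \<cong> X\<close>.
\<close>

definition syzygy_of :: "'a ring \<Rightarrow> nat \<Rightarrow> ('a, 'm) module \<Rightarrow> ('a, 'n) module \<Rightarrow> bool" where
  "syzygy_of R d X B \<longleftrightarrow> fg_module R X \<and> fg_module R B \<and>
     (\<exists>(Q :: nat \<Rightarrow> ('a, 'a univ) module) f.
        left_module R (Q 0) \<and> lmod_iso R (Q 0) X \<and>
        left_module R (Q (Suc d)) \<and> lmod_iso R (Q (Suc d)) B \<and>
        (\<forall>i. 1 \<le> i \<and> i \<le> d \<longrightarrow> fg_projective R (Q i)) \<and>
        (\<forall>i\<le>d. f i \<in> lmod_hom R (Q (Suc i)) (Q i)) \<and>
        f 0 ` carrier (Q 1) = carrier (Q 0) \<and>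
        inj_on (f d) (carrier (Q (Suc d))) \<and>
        (\<forall>i<d. f (Suc i) ` carrier (Q (Suc (Suc i))) = a_kernel (Q (Suc i)) (Q i) (f i)))"

definition projective_resolution ::
  "'a ring \<Rightarrow> ('a, 'm) module \<Rightarrow> (nat \<Rightarrow> ('a, 'a univ) module) \<Rightarrow> (nat \<Rightarrow> 'a univ \<Rightarrow> 'a univ) \<Rightarrow>
     ('a univ \<Rightarrow> 'm) \<Rightarrow> bool" where
  "projective_resolution R X P f e \<longleftrightarrow> left_module R X \<and>
     (\<forall>i. fg_projective R (P i)) \<and>
     (\<forall>i. f i \<in> lmod_hom R (P (Suc i)) (P i)) \<and>
     e \<in> lmod_hom R (P 0) X \<and>
     e ` carrier (P 0) = carrier X \<and>
     f 0 ` carrier (P 1) = a_kernel (P 0) X e \<and>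
     (\<forall>i. f (Suc i) ` carrier (P (Suc (Suc i))) = a_kernel (P (Suc i)) (P i) (f i))"

text \<open>The bound is an integer: \<open>proj_dim_le R X (-1)\<close> says that \<open>X\<close> is zero.\<close>

definition proj_dim_le :: "'a ring \<Rightarrow> ('a, 'm) module \<Rightarrow> int \<Rightarrow> bool" where
  "proj_dim_le R X n \<longleftrightarrow>
     (\<exists>P f e. projective_resolution R X P f e \<and> (\<forall>i. int i > n \<longrightarrow> zero_module (P i)))"


section \<open>Ext, grade and the transpose\<close>

text \<open>
  \<open>Ext R n X\<close> is the \<open>n\<close>th cohomology of \<open>Hom\<^sub>R(P, R)\<close> for a projective resolution \<open>P\<close> of the
  finitely generated module \<open>X\<close>; the resolution is picked by Hilbert choice, and up to isomorphism
  the result does not depend on it. It is a module over \<^term>\<open>op_ring R\<close>.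
\<close>

definition chosen_resolution ::
  "'a ring \<Rightarrow> ('a, 'm) module \<Rightarrow> (nat \<Rightarrow> ('a, 'a univ) module) \<times> (nat \<Rightarrow> 'a univ \<Rightarrow> 'a univ)" where
  "chosen_resolution R X = (SOME (P, f). \<exists>e. projective_resolution R X P f e)"

definition dual_cocycles ::
  "'a ring \<Rightarrow> (nat \<Rightarrow> ('a, 'm) module) \<Rightarrow> (nat \<Rightarrow> 'm \<Rightarrow> 'm) \<Rightarrow> nat \<Rightarrow> ('m \<Rightarrow> 'a) set" where
  "dual_cocycles R P f n =
     a_kernel (dual_module R (P n)) (dual_module R (P (Suc n))) (dual_map (P (Suc n)) (f n))"

definition dual_coboundaries ::
  "'a ring \<Rightarrow> (nat \<Rightarrow> ('a, 'm) module) \<Rightarrow> (nat \<Rightarrow> 'm \<Rightarrow> 'm) \<Rightarrow> nat \<Rightarrow> ('m \<Rightarrow> 'a) set" where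
  "dual_coboundaries R P f n =
     (case n of 0 \<Rightarrow> {\<zero>\<^bsub>dual_module R (P 0)\<^esub>}
      | Suc m \<Rightarrow> dual_map (P (Suc m)) (f m) ` carrier (dual_module R (P m)))"

definition Ext :: "'a ring \<Rightarrow> nat \<Rightarrow> ('a, 'm) module \<Rightarrow> ('a, ('a univ \<Rightarrow> 'a) set) module" where
  "Ext R n X =
     (case chosen_resolution R X of (P, f) \<Rightarrow>
        quotient_module ((dual_module R (P n))\<lparr>carrier := dual_cocycles R P f n\<rparr>)
          (dual_coboundaries R P f n))"

definition grade_ge :: "'a ring \<Rightarrow> ('a, 'm) module \<Rightarrow> nat \<Rightarrow> bool" where
  "grade_ge R X i \<longleftrightarrow> (\<forall>j<i. zero_module (Ext R j X))"

definition quasi_gorenstein :: "nat \<Rightarrow> 'a ring \<Rightarrow> bool" where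
  "quasi_gorenstein k R \<longleftrightarrow>
     (\<forall>N :: ('a, 'a univ) module. fg_module (op_ring R) N \<longrightarrow>
        (\<forall>i. 1 \<le> i \<and> i \<le> k \<longrightarrow> grade_ge R (Ext (op_ring R) i N) i))"

definition projective_presentation ::
  "'a ring \<Rightarrow> ('a, 'p) module \<Rightarrow> ('a, 'q) module \<Rightarrow> ('a, 'm) module \<Rightarrow> ('p \<Rightarrow> 'q) \<Rightarrow> ('q \<Rightarrow> 'm) \<Rightarrow> bool"
  where
  "projective_presentation R P1 P0 M g e \<longleftrightarrow>
     fg_projective R P1 \<and> fg_projective R P0 \<and> left_module R M \<and>
     g \<in> lmod_hom R P1 P0 \<and> e \<in> lmod_hom R P0 M \<and>
     g ` carrier P1 = a_kernel P0 M e \<and> e ` carrier P0 = carrier M"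

text \<open>The right module \<open>D(M) = Coker(P\<^sub>0\<^sup>* \<rightarrow> P\<^sub>1\<^sup>*)\<close> of a presentation \<open>g : P\<^sub>1 \<rightarrow> P\<^sub>0\<close> of \<open>M\<close>.\<close>

definition transpose_module ::
  "'a ring \<Rightarrow> ('a, 'p) module \<Rightarrow> ('a, 'q) module \<Rightarrow> ('p \<Rightarrow> 'q) \<Rightarrow> ('a, ('p \<Rightarrow> 'a) set) module" where
  "transpose_module R P1 P0 g =
     quotient_module (dual_module R P1) (dual_map P1 g ` carrier (dual_module R P0))"

end

theory Submission
  imports Defs
begin

text \<open>
  Let \<open>F\<close> be a projective resolution of \<open>D(M)\<close> starting with \<open>P\<^sub>0\<^sup>* \<rightarrow> P\<^sub>1\<^sup>*\<close>, and put \<open>E\<^sub>j = F\<^sub>j\<^sub>+\<^sub>1\<^sup>*\<close>.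
  In the complex \<open>P\<^sub>1 \<rightarrow> P\<^sub>0 = E\<^sub>0 \<rightarrow> E\<^sub>1 \<rightarrow> \<dots>\<close> let \<open>W\<^sub>j = Coker(E\<^sub>j\<^sub>-\<^sub>1 \<rightarrow> E\<^sub>j)\<close>, so that \<open>W\<^sub>0 = M\<close>, and let
  \<open>X\<^sub>j = Ker(W\<^sub>j \<rightarrow> E\<^sub>j\<^sub>+\<^sub>1)\<close>. Then \<open>X\<^sub>j\<close> is \<open>Ext\<^sup>j\<^sup>+\<^sup>1(D(M), \<Lambda>)\<close>, which has grade at least \<open>j + 1\<close>
  for \<open>j \<le> d\<close>.

  The modules \<open>X\<^sub>j\<close> with \<open>j < d\<close> vanish, by induction on \<open>j\<close>: since \<open>M\<close> is a \<open>d\<close>th syzygy, dimension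
  shifting gives \<open>Ext\<^sup>j(X\<^sub>j, M) = 0\<close>, and shifting back along \<open>0 \<rightarrow> W\<^sub>i \<rightarrow> E\<^sub>i\<^sub>+\<^sub>1 \<rightarrow> W\<^sub>i\<^sub>+\<^sub>1 \<rightarrow> 0\<close> for
  \<open>i < j\<close> gives \<open>Hom(X\<^sub>j, W\<^sub>j) = 0\<close>, although \<open>X\<^sub>j \<subseteq> W\<^sub>j\<close>. Hence
  \<open>0 \<rightarrow> M \<rightarrow> E\<^sub>1 \<rightarrow> \<dots> \<rightarrow> E\<^sub>d \<rightarrow> W\<^sub>d \<rightarrow> 0\<close> is exact and \<open>W\<^sub>d / X\<^sub>d\<close> embeds into \<open>E\<^sub>d\<^sub>+\<^sub>1\<close>.

  Now take a resolution \<open>G\<close> of \<open>X\<^sub>d\<close> and descend from \<open>0 \<rightarrow> X\<^sub>d \<rightarrow> W\<^sub>d \<rightarrow> W\<^sub>d / X\<^sub>d \<rightarrow> 0\<close> to \<open>M\<close>. A sequence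
  \<open>0 \<rightarrow> B \<rightarrow> N' \<oplus> Q \<rightarrow> C \<rightarrow> 0\<close>, a cover \<open>G\<^sub>i \<rightarrow> B\<close> with kernel \<open>B'\<close> and an extension
  \<open>0 \<rightarrow> N \<rightarrow> E \<rightarrow> N' \<rightarrow> 0\<close> yield \<open>0 \<rightarrow> B' \<rightarrow> N \<oplus> G\<^sub>i \<rightarrow> C' \<rightarrow> 0\<close> with \<open>C' = Ker(E \<oplus> Q \<rightarrow> C)\<close>, so each
  step raises the syzygy degree of both ends by one. The grade of \<open>X\<^sub>d\<close> makes \<open>Hom(G, \<Lambda>)\<close> exact up to
  degree \<open>d\<close>, which gives the projective dimension of \<open>B\<^sup>*\<close> and the dual exactness.
\<close>

section \<open>Modules and homomorphisms\<close>

text \<open>The grade hypothesis speaks only of homomorphisms into the ring, while the vanishing of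
  the \<open>X j\<close> needs coefficients in \<open>M\<close> and in the cokernels
  \<open>W i\<close>. Finite dual bases carry it to projective coefficients, and short exact
  sequences carry it on from there. Shifting along the syzygy sequence of \<open>M\<close> costs
  \<open>j\<close> steps and must end in a module that still embeds into a projective; this forces
  \<open>j < d\<close>, so \<open>X d\<close> is what survives and has to be split off. The kernels
  in the descent are tied to one fixed resolution of \<open>X d\<close>, because the vanishing of
  \<open>Ext\<close> is known for that resolution and is used at every step. Element types shape the
  rest: sequences of modules, and the test objects for projectivity and for the Gorenstein
  condition, live in \<open>'a univ\<close>, while \<open>M\<close> and its presentation have
  arbitrary types. Only at the end is the approximation brought back to \<open>M\<close>, with
  \<open>B\<close> as an actual subset of the direct sum.\<close>

context left_module
begin

lemma smult_l_null: "x \<in> carrier M \<Longrightarrow> \<zero>\<^bsub>R\<^esub> \<odot>\<^bsub>M\<^esub> x = \<zero>\<^bsub>M\<^esub>"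
  by (metis R.l_zero R.zero_closed M.add.l_cancel_one smult_closed smult_l_distr)

lemma smult_r_null: "a \<in> carrier R \<Longrightarrow> a \<odot>\<^bsub>M\<^esub> \<zero>\<^bsub>M\<^esub> = \<zero>\<^bsub>M\<^esub>"
  by (metis M.l_zero M.zero_closed M.add.l_cancel_one smult_closed smult_r_distr)

lemma smult_minus_one: "x \<in> carrier M \<Longrightarrow> (\<ominus>\<^bsub>R\<^esub> \<one>\<^bsub>R\<^esub>) \<odot>\<^bsub>M\<^esub> x = \<ominus>\<^bsub>M\<^esub> x"
  using smult_l_distr[of "\<ominus>\<^bsub>R\<^esub> \<one>\<^bsub>R\<^esub>" "\<one>\<^bsub>R\<^esub>" x] smult_closed[of "\<ominus>\<^bsub>R\<^esub> \<one>\<^bsub>R\<^esub>" x]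
  by (metis M.minus_equality R.add.inv_closed R.l_neg R.one_closed smult_l_null smult_one)

lemma finsum_smult_ldistr:
  "finite A \<Longrightarrow> a \<in> carrier R \<Longrightarrow> f \<in> A \<rightarrow> carrier M \<Longrightarrow>
     a \<odot>\<^bsub>M\<^esub> (\<Oplus>\<^bsub>M\<^esub>i\<in>A. f i) = (\<Oplus>\<^bsub>M\<^esub>i\<in>A. a \<odot>\<^bsub>M\<^esub> f i)"
proof (induct set: finite)
  case (insert x F)
  then show ?case
    by (simp add: Pi_def smult_r_distr smult_closed)
qed (simp add: smult_r_null)

text \<open>Closure under negatives comes for free, since \<open>- x\<close> is the scalar
  \<open>- 1\<close> applied to \<open>x\<close>.\<close>

lemma submoduleI:
  assumes "H \<subseteq> carrier M" "\<zero>\<^bsub>M\<^esub> \<in> H"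
    and "\<And>x y. x \<in> H \<Longrightarrow> y \<in> H \<Longrightarrow> x \<oplus>\<^bsub>M\<^esub> y \<in> H"
    and s: "\<And>a x. a \<in> carrier R \<Longrightarrow> x \<in> H \<Longrightarrow> a \<odot>\<^bsub>M\<^esub> x \<in> H"
  shows "submodule H R M"
proof -
  have "\<ominus>\<^bsub>M\<^esub> x \<in> H" if "x \<in> H" for x
    using s[of "\<ominus>\<^bsub>R\<^esub> \<one>\<^bsub>R\<^esub>" x] smult_minus_one[of x] that assms(1) by auto
  then show ?thesis
    using assms unfolding submodule_def submodule_axioms_def subgroup_def
    by (auto simp: a_inv_def)
qed

lemma submoduleD:
  assumes "submodule H R M"
  shows "H \<subseteq> carrier M" "\<zero>\<^bsub>M\<^esub> \<in> H"
    "\<And>x y. x \<in> H \<Longrightarrow> y \<in> H \<Longrightarrow> x \<oplus>\<^bsub>M\<^esub> y \<in> H"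
    "\<And>a x. a \<in> carrier R \<Longrightarrow> x \<in> H \<Longrightarrow> a \<odot>\<^bsub>M\<^esub> x \<in> H"
    "\<And>x. x \<in> H \<Longrightarrow> \<ominus>\<^bsub>M\<^esub> x \<in> H"
  using assms unfolding submodule_def submodule_axioms_def subgroup_def
  by (auto simp: a_inv_def)

lemma submodule_carrier: "submodule (carrier M) R M"
  by (intro submoduleI) (auto simp: smult_closed)

end

text \<open>In place of additive inverses it asks that the scalar zero kills every element: then
  \<open>(- 1) x + x = 0 x = 0\<close>. This is easier to check for quotients, duals and transported
  structures than exhibiting inverses.\<close>

lemma left_moduleI:
  assumes "ring R"
    and "\<And>x y. x \<in> carrier M \<Longrightarrow> y \<in> carrier M \<Longrightarrow> x \<oplus>\<^bsub>M\<^esub> y \<in> carrier M"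
    and "\<zero>\<^bsub>M\<^esub> \<in> carrier M"
    and "\<And>x y z. x \<in> carrier M \<Longrightarrow> y \<in> carrier M \<Longrightarrow> z \<in> carrier M \<Longrightarrow>
           (x \<oplus>\<^bsub>M\<^esub> y) \<oplus>\<^bsub>M\<^esub> z = x \<oplus>\<^bsub>M\<^esub> (y \<oplus>\<^bsub>M\<^esub> z)"
    and "\<And>x y. x \<in> carrier M \<Longrightarrow> y \<in> carrier M \<Longrightarrow> x \<oplus>\<^bsub>M\<^esub> y = y \<oplus>\<^bsub>M\<^esub> x"
    and "\<And>x. x \<in> carrier M \<Longrightarrow> \<zero>\<^bsub>M\<^esub> \<oplus>\<^bsub>M\<^esub> x = x"
    and c: "\<And>a x. a \<in> carrier R \<Longrightarrow> x \<in> carrier M \<Longrightarrow> a \<odot>\<^bsub>M\<^esub> x \<in> carrier M"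
    and l: "\<And>a b x. a \<in> carrier R \<Longrightarrow> b \<in> carrier R \<Longrightarrow> x \<in> carrier M \<Longrightarrow>
           (a \<oplus>\<^bsub>R\<^esub> b) \<odot>\<^bsub>M\<^esub> x = a \<odot>\<^bsub>M\<^esub> x \<oplus>\<^bsub>M\<^esub> b \<odot>\<^bsub>M\<^esub> x"
    and "\<And>a x y. a \<in> carrier R \<Longrightarrow> x \<in> carrier M \<Longrightarrow> y \<in> carrier M \<Longrightarrow>
           a \<odot>\<^bsub>M\<^esub> (x \<oplus>\<^bsub>M\<^esub> y) = a \<odot>\<^bsub>M\<^esub> x \<oplus>\<^bsub>M\<^esub> a \<odot>\<^bsub>M\<^esub> y"
    and "\<And>a b x. a \<in> carrier R \<Longrightarrow> b \<in> carrier R \<Longrightarrow> x \<in> carrier M \<Longrightarrow>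
           (a \<otimes>\<^bsub>R\<^esub> b) \<odot>\<^bsub>M\<^esub> x = a \<odot>\<^bsub>M\<^esub> (b \<odot>\<^bsub>M\<^esub> x)"
    and o: "\<And>x. x \<in> carrier M \<Longrightarrow> \<one>\<^bsub>R\<^esub> \<odot>\<^bsub>M\<^esub> x = x"
    and z: "\<And>x. x \<in> carrier M \<Longrightarrow> \<zero>\<^bsub>R\<^esub> \<odot>\<^bsub>M\<^esub> x = \<zero>\<^bsub>M\<^esub>"
  shows "left_module R M"
proof -
  interpret R: ring R by fact
  have "\<exists>y\<in>carrier M. y \<oplus>\<^bsub>M\<^esub> x = \<zero>\<^bsub>M\<^esub>" if "x \<in> carrier M" for x
  proof
    show "(\<ominus>\<^bsub>R\<^esub> \<one>\<^bsub>R\<^esub>) \<odot>\<^bsub>M\<^esub> x \<oplus>\<^bsub>M\<^esub> x = \<zero>\<^bsub>M\<^esub>"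
      using l[of "\<ominus>\<^bsub>R\<^esub> \<one>\<^bsub>R\<^esub>" "\<one>\<^bsub>R\<^esub>" x] that o z by (simp add: R.l_neg)
  qed (use c that in auto)
  then have "abelian_group M"
    using assms by (intro abelian_groupI) auto
  then show ?thesis
    using assms by (intro left_module.intro left_module_axioms.intro)
qed

lemma left_module_ring: "left_module R M \<Longrightarrow> ring R"
  by (simp add: left_module_def)

lemma left_module_group: "left_module R M \<Longrightarrow> abelian_group M"
  by (simp add: left_module_def)

lemma submodule_left_module:
  assumes "left_module R M" "submodule H R M"
  shows "left_module R (M\<lparr>carrier := H\<rparr>)"
proof -
  interpret M: left_module R M by fact
  note H = M.submoduleD[OF assms(2)]
  have sub: "\<And>x. x \<in> H \<Longrightarrow> x \<in> carrier M" using H(1) by blast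
  show ?thesis
    by (rule left_moduleI)
      (auto simp: H(2-4) sub M.R.ring_axioms M.M.a_ac M.smult_l_distr M.smult_r_distr
        M.smult_assoc M.smult_one M.smult_l_null)
qed

lemma regular_module_simps [simp]:
  "carrier (regular_module R) = carrier R" "zero (regular_module R) = zero R"
  "add (regular_module R) = add R" "smult (regular_module R) = mult R"
  by (simp_all add: regular_module_def)

lemma left_module_regular:
  assumes "ring R" shows "left_module R (regular_module R)"
proof -
  interpret R: ring R by fact
  show ?thesis
    by (rule left_moduleI)
      (auto simp: R.ring_axioms R.a_ac R.l_distr R.r_distr R.m_assoc)
qed

lemma a_minus_eq_zero_iff:
  assumes "abelian_group M" "x \<in> carrier M" "y \<in> carrier M"
  shows "x \<ominus>\<^bsub>M\<^esub> y = \<zero>\<^bsub>M\<^esub> \<longleftrightarrow> x = y"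
proof -
  interpret M: abelian_group M by fact
  show ?thesis
    using assms(2,3) M.minus_equality[of x "\<ominus>\<^bsub>M\<^esub> y"] by (auto simp: a_minus_def M.r_neg)
qed

lemma a_minus_add_cancel:
  assumes "abelian_group M" "x \<in> carrier M" "y \<in> carrier M"
  shows "(x \<ominus>\<^bsub>M\<^esub> y) \<oplus>\<^bsub>M\<^esub> y = x" "y \<ominus>\<^bsub>M\<^esub> (y \<ominus>\<^bsub>M\<^esub> x) = x"
proof -
  interpret M: abelian_group M by fact
  show "(x \<ominus>\<^bsub>M\<^esub> y) \<oplus>\<^bsub>M\<^esub> y = x"
    using assms(2,3) by (simp add: a_minus_def M.a_assoc M.l_neg)
  show "y \<ominus>\<^bsub>M\<^esub> (y \<ominus>\<^bsub>M\<^esub> x) = x"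
    using assms(2,3) by (simp add: a_minus_def M.minus_add M.a_assoc[symmetric] M.r_neg)
qed

subsection \<open>Homomorphisms\<close>

lemma lmod_homI:
  assumes "\<And>x. x \<in> carrier M \<Longrightarrow> h x \<in> carrier N"
    and "\<And>x y. x \<in> carrier M \<Longrightarrow> y \<in> carrier M \<Longrightarrow> h (x \<oplus>\<^bsub>M\<^esub> y) = h x \<oplus>\<^bsub>N\<^esub> h y"
    and "\<And>a x. a \<in> carrier R \<Longrightarrow> x \<in> carrier M \<Longrightarrow> h (a \<odot>\<^bsub>M\<^esub> x) = a \<odot>\<^bsub>N\<^esub> h x"
  shows "h \<in> lmod_hom R M N"
  using assms by (auto simp: lmod_hom_def)

lemma lmod_homD:
  assumes "h \<in> lmod_hom R M N"
  shows "\<And>x. x \<in> carrier M \<Longrightarrow> h x \<in> carrier N"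
    and "\<And>x y. x \<in> carrier M \<Longrightarrow> y \<in> carrier M \<Longrightarrow> h (x \<oplus>\<^bsub>M\<^esub> y) = h x \<oplus>\<^bsub>N\<^esub> h y"
    and "\<And>a x. a \<in> carrier R \<Longrightarrow> x \<in> carrier M \<Longrightarrow> h (a \<odot>\<^bsub>M\<^esub> x) = a \<odot>\<^bsub>N\<^esub> h x"
  using assms by (auto simp: lmod_hom_def)

lemma lmod_hom_cong:
  assumes "left_module R M" "h \<in> lmod_hom R M N" "\<And>x. x \<in> carrier M \<Longrightarrow> h' x = h x"
  shows "h' \<in> lmod_hom R M N"
proof -
  interpret M: left_module R M by fact
  show ?thesis
    by (rule lmod_homI) (simp_all add: assms(3) lmod_homD[OF assms(2)] M.smult_closed)
qed

lemma lmod_hom_id: "(\<lambda>x. x) \<in> lmod_hom R M M"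
  by (rule lmod_homI) simp_all

lemma lmod_hom_comp:
  assumes "f \<in> lmod_hom R L M" "g \<in> lmod_hom R M N"
  shows "(\<lambda>x. g (f x)) \<in> lmod_hom R L N"
  by (rule lmod_homI) (simp_all add: lmod_homD[OF assms(1)] lmod_homD[OF assms(2)])

lemma lmod_hom_group_hom:
  assumes "left_module R M" "left_module R N" "h \<in> lmod_hom R M N"
  shows "abelian_group_hom M N h"
  using assms by (intro abelian_group_homI)
    (auto simp: left_module_group group_hom_def group_hom_axioms_def hom_def lmod_homD[OF assms(3)]
      abelian_group.a_group)

lemma lmod_hom_zero:
  assumes "left_module R M" "left_module R N" "h \<in> lmod_hom R M N"
  shows "h \<zero>\<^bsub>M\<^esub> = \<zero>\<^bsub>N\<^esub>"
  using abelian_group_hom.hom_zero[OF lmod_hom_group_hom[OF assms]] .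

lemma lmod_hom_a_inv:
  assumes "left_module R M" "left_module R N" "h \<in> lmod_hom R M N" "x \<in> carrier M"
  shows "h (\<ominus>\<^bsub>M\<^esub> x) = \<ominus>\<^bsub>N\<^esub> h x"
  using abelian_group_hom.hom_a_inv[OF lmod_hom_group_hom[OF assms(1-3)] assms(4)] .

lemma lmod_hom_minus:
  assumes "left_module R M" "left_module R N" "h \<in> lmod_hom R M N" "x \<in> carrier M" "y \<in> carrier M"
  shows "h (x \<ominus>\<^bsub>M\<^esub> y) = h x \<ominus>\<^bsub>N\<^esub> h y"
proof -
  interpret M: left_module R M by fact
  show ?thesis
    using assms by (simp add: a_minus_def lmod_homD(2)[OF assms(3)] lmod_hom_a_inv[OF assms(1-3)])
qed

lemma lmod_hom_finsum:
  assumes "left_module R M" "left_module R N" "h \<in> lmod_hom R M N" "finite A" "f \<in> A \<rightarrow> carrier M"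
  shows "h (\<Oplus>\<^bsub>M\<^esub>i\<in>A. f i) = (\<Oplus>\<^bsub>N\<^esub>i\<in>A. h (f i))"
proof -
  interpret M: left_module R M by fact
  interpret N: left_module R N by fact
  show ?thesis
    using assms(4,5)
  proof (induct set: finite)
    case (insert x F)
    then show ?case
      by (simp add: Pi_def lmod_homD[OF assms(3)])
  qed (simp add: lmod_hom_zero[OF assms(1-3)])
qed

lemma lmod_hom_plus:
  assumes "left_module R M" "left_module R N" "f \<in> lmod_hom R M N" "g \<in> lmod_hom R M N"
  shows "(\<lambda>x. f x \<oplus>\<^bsub>N\<^esub> g x) \<in> lmod_hom R M N"
proof -
  interpret M: left_module R M by fact
  interpret N: left_module R N by fact
  show ?thesis
    using lmod_homD[OF assms(3)] lmod_homD[OF assms(4)]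
    by (intro lmod_homI) (auto simp: N.M.a_ac N.smult_r_distr)
qed

lemma lmod_hom_uminus:
  assumes "left_module R M" "left_module R N" "f \<in> lmod_hom R M N"
  shows "(\<lambda>x. \<ominus>\<^bsub>N\<^esub> f x) \<in> lmod_hom R M N"
proof -
  interpret M: left_module R M by fact
  interpret N: left_module R N by fact
  note f = lmod_homD[OF assms(3)]
  have "\<ominus>\<^bsub>N\<^esub> (a \<odot>\<^bsub>N\<^esub> y) = a \<odot>\<^bsub>N\<^esub> (\<ominus>\<^bsub>N\<^esub> y)" if "a \<in> carrier R" "y \<in> carrier N" for a y
    using N.smult_r_distr[of a "\<ominus>\<^bsub>N\<^esub> y" y] that
    by (metis N.M.a_inv_closed N.M.l_neg N.M.minus_equality N.smult_closed N.smult_r_null)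
  then show ?thesis
    using f by (intro lmod_homI) (auto simp: N.M.minus_add M.smult_closed)
qed

lemma lmod_hom_diff:
  assumes "left_module R M" "left_module R N" "f \<in> lmod_hom R M N" "g \<in> lmod_hom R M N"
  shows "(\<lambda>x. f x \<ominus>\<^bsub>N\<^esub> g x) \<in> lmod_hom R M N"
  unfolding a_minus_def by (intro lmod_hom_plus lmod_hom_uminus assms)

lemma lmod_hom_const_zero:
  assumes "left_module R N"
  shows "(\<lambda>x. \<zero>\<^bsub>N\<^esub>) \<in> lmod_hom R M N"
proof -
  interpret N: left_module R N by fact
  show ?thesis by (intro lmod_homI) (auto simp: N.smult_r_null)
qed

lemma lmod_hom_into_submodule:
  assumes "h \<in> lmod_hom R M N" "\<And>x. x \<in> carrier M \<Longrightarrow> h x \<in> H"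
  shows "h \<in> lmod_hom R M (N\<lparr>carrier := H\<rparr>)"
  using assms(2) by (intro lmod_homI) (auto simp: lmod_homD[OF assms(1)])

lemma lmod_hom_from_submodule:
  assumes "left_module R M" "submodule H R M" "h \<in> lmod_hom R M N"
  shows "h \<in> lmod_hom R (M\<lparr>carrier := H\<rparr>) N"
proof -
  interpret M: left_module R M by fact
  have "\<And>x. x \<in> H \<Longrightarrow> x \<in> carrier M" using M.submoduleD(1)[OF assms(2)] by blast
  then show ?thesis by (intro lmod_homI) (auto simp: lmod_homD[OF assms(3)])
qed

lemma a_kernel_iff: "x \<in> a_kernel M N h \<longleftrightarrow> x \<in> carrier M \<and> h x = \<zero>\<^bsub>N\<^esub>"
  by (auto simp: a_kernel_def')

lemma submodule_a_kernel:
  assumes "left_module R M" "left_module R N" "h \<in> lmod_hom R M N"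
  shows "submodule (a_kernel M N h) R M"
proof -
  interpret M: left_module R M by fact
  interpret N: left_module R N by fact
  show ?thesis
    using lmod_homD[OF assms(3)] lmod_hom_zero[OF assms]
    by (intro M.submoduleI) (auto simp: a_kernel_iff M.smult_closed N.smult_r_null)
qed

lemma submodule_image:
  assumes "left_module R M" "left_module R N" "h \<in> lmod_hom R M N" "submodule H R M"
  shows "submodule (h ` H) R N"
proof -
  interpret M: left_module R M by fact
  interpret N: left_module R N by fact
  note H = M.submoduleD[OF assms(4)]
  note h = lmod_homD[OF assms(3)]
  have sub: "\<And>x. x \<in> H \<Longrightarrow> x \<in> carrier M" using H(1) by blast
  show ?thesis
  proof (rule N.submoduleI)
    show "h ` H \<subseteq> carrier N" using sub h(1) by blast
    show "\<zero>\<^bsub>N\<^esub> \<in> h ` H" using H(2) lmod_hom_zero[OF assms(1-3)] by (metis imageI)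
    show "x \<oplus>\<^bsub>N\<^esub> y \<in> h ` H" if "x \<in> h ` H" "y \<in> h ` H" for x y
    proof -
      obtain u v where "u \<in> H" "v \<in> H" "x = h u" "y = h v" using \<open>x \<in> h ` H\<close> \<open>y \<in> h ` H\<close> by blast
      then show ?thesis using h(2)[of u v] H(3)[of u v] sub by (metis imageI)
    qed
    show "a \<odot>\<^bsub>N\<^esub> x \<in> h ` H" if "a \<in> carrier R" "x \<in> h ` H" for a x
    proof -
      obtain u where "u \<in> H" "x = h u" using \<open>x \<in> h ` H\<close> by blast
      then show ?thesis using h(3)[of a u] H(4)[of a u] sub \<open>a \<in> carrier R\<close> by (metis imageI)
    qed
  qed
qed

lemma submodule_hom_image:
  assumes "left_module R M" "left_module R N" "h \<in> lmod_hom R M N"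
  shows "submodule (h ` carrier M) R N"
  using submodule_image[OF assms left_module.submodule_carrier[OF assms(1)]] .

lemma lmod_hom_inj_iff:
  assumes "left_module R M" "left_module R N" "h \<in> lmod_hom R M N"
  shows "inj_on h (carrier M) \<longleftrightarrow> (\<forall>x\<in>carrier M. h x = \<zero>\<^bsub>N\<^esub> \<longrightarrow> x = \<zero>\<^bsub>M\<^esub>)"
proof -
  interpret M: left_module R M by fact
  interpret N: left_module R N by fact
  show ?thesis
  proof
    assume "inj_on h (carrier M)"
    then show "\<forall>x\<in>carrier M. h x = \<zero>\<^bsub>N\<^esub> \<longrightarrow> x = \<zero>\<^bsub>M\<^esub>"
      using lmod_hom_zero[OF assms] by (metis M.M.zero_closed inj_onD)
  next
    assume z: "\<forall>x\<in>carrier M. h x = \<zero>\<^bsub>N\<^esub> \<longrightarrow> x = \<zero>\<^bsub>M\<^esub>"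
    show "inj_on h (carrier M)"
    proof (rule inj_onI)
      fix x y assume xy: "x \<in> carrier M" "y \<in> carrier M" "h x = h y"
      then have "h (x \<ominus>\<^bsub>M\<^esub> y) = \<zero>\<^bsub>N\<^esub>"
        using lmod_homD(1)[OF assms(3)]
        by (simp add: lmod_hom_minus[OF assms] a_minus_eq_zero_iff[OF N.M.abelian_group_axioms])
      then show "x = y"
        using z xy a_minus_eq_zero_iff[OF M.M.abelian_group_axioms] by auto
    qed
  qed
qed

lemma lmod_hom_inv_into:
  assumes "left_module R M" "h \<in> lmod_hom R M N" "inj_on h (carrier M)" "h ` carrier M = carrier N"
  shows "inv_into (carrier M) h \<in> lmod_hom R N M"
proof -
  interpret M: left_module R M by fact
  note h = lmod_homD[OF assms(2)]
  have in1: "inv_into (carrier M) h y \<in> carrier M" "h (inv_into (carrier M) h y) = y"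
    if "y \<in> carrier N" for y
    using that assms(4) inv_into_into[of y h "carrier M"] f_inv_into_f[of y h "carrier M"] by auto
  show ?thesis
  proof (rule lmod_homI)
    fix x y assume "x \<in> carrier N" "y \<in> carrier N"
    then show "inv_into (carrier M) h (x \<oplus>\<^bsub>N\<^esub> y) = inv_into (carrier M) h x \<oplus>\<^bsub>M\<^esub> inv_into (carrier M) h y"
      by (intro inv_into_f_eq assms(3)) (auto simp: in1 h)
  next
    fix a x assume "a \<in> carrier R" "x \<in> carrier N"
    then show "inv_into (carrier M) h (a \<odot>\<^bsub>N\<^esub> x) = a \<odot>\<^bsub>M\<^esub> inv_into (carrier M) h x"
      by (intro inv_into_f_eq assms(3)) (auto simp: in1 h M.smult_closed)
  qed (auto simp: in1)
qed

lemma lmod_isoE: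
  assumes "lmod_iso R M N" "left_module R M"
  obtains h h' where "h \<in> lmod_hom R M N" "h' \<in> lmod_hom R N M" "inj_on h (carrier M)"
    "h ` carrier M = carrier N" "inj_on h' (carrier N)" "h' ` carrier N = carrier M"
    "\<forall>x\<in>carrier M. h' (h x) = x" "\<forall>y\<in>carrier N. h (h' y) = y"
proof -
  obtain h where h: "h \<in> lmod_hom R M N" "bij_betw h (carrier M) (carrier N)"
    using assms by (auto simp: lmod_iso_def)
  then have b: "inj_on h (carrier M)" "h ` carrier M = carrier N" by (auto simp: bij_betw_def)
  have c: "bij_betw (inv_into (carrier M) h) (carrier N) (carrier M)"
    using h(2) by (rule bij_betw_inv_into)
  show thesis
  proof
    show "inv_into (carrier M) h \<in> lmod_hom R N M" using lmod_hom_inv_into[OF assms(2) h(1) b] .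
    show "inj_on (inv_into (carrier M) h) (carrier N)"
      "inv_into (carrier M) h ` carrier N = carrier M" using c by (auto simp: bij_betw_def)
  qed (use h b in \<open>auto simp: f_inv_into_f\<close>)
qed

lemma lmod_isoI:
  "h \<in> lmod_hom R M N \<Longrightarrow> inj_on h (carrier M) \<Longrightarrow> h ` carrier M = carrier N \<Longrightarrow> lmod_iso R M N"
  by (auto simp: lmod_iso_def bij_betw_def)

lemma lmod_iso_refl: "lmod_iso R M M"
  by (rule lmod_isoI[OF lmod_hom_id]) auto

lemma lmod_iso_sym:
  assumes "lmod_iso R M N" "left_module R M" shows "lmod_iso R N M"
  using lmod_isoE[OF assms] by (metis lmod_isoI)

lemma lmod_iso_trans:
  assumes "lmod_iso R L M" "lmod_iso R M N"
  shows "lmod_iso R L N"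
proof -
  obtain f g where "f \<in> lmod_hom R L M" "bij_betw f (carrier L) (carrier M)"
    "g \<in> lmod_hom R M N" "bij_betw g (carrier M) (carrier N)"
    using assms by (auto simp: lmod_iso_def)
  then show ?thesis
    using lmod_hom_comp[of f R L M g N] bij_betw_trans[of f _ _ g]
    unfolding lmod_iso_def comp_def by blast
qed

subsection \<open>Quotients and factorization\<close>

text \<open>The factor is \<open>h\<close> composed with an arbitrary section of \<open>g\<close>.
  Two preimages of one element differ by an element of the kernel of \<open>g\<close>, which
  \<open>h\<close> kills, so the choice does not matter and linearity follows.\<close>

lemma lmod_hom_factor:
  assumes "left_module R M" "left_module R N" "left_module R L"
    and g: "g \<in> lmod_hom R M N" "g ` carrier M = carrier N"
    and h: "h \<in> lmod_hom R M L"
    and k: "\<And>x. x \<in> carrier M \<Longrightarrow> g x = \<zero>\<^bsub>N\<^esub> \<Longrightarrow> h x = \<zero>\<^bsub>L\<^esub>"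
  shows "\<exists>u\<in>lmod_hom R N L. \<forall>x\<in>carrier M. u (g x) = h x"
proof -
  interpret M: left_module R M by fact
  interpret N: left_module R N by fact
  interpret L: left_module R L by fact
  note gD = lmod_homD[OF g(1)] and hD = lmod_homD[OF h]
  define s where "s = inv_into (carrier M) g"
  have s: "s y \<in> carrier M" "g (s y) = y" if "y \<in> carrier N" for y
    using that g(2) inv_into_into[of y g "carrier M"] f_inv_into_f[of y g "carrier M"]
    by (auto simp: s_def)
  have eq: "h x = h y" if "x \<in> carrier M" "y \<in> carrier M" "g x = g y" for x y
  proof -
    have "g (x \<ominus>\<^bsub>M\<^esub> y) = \<zero>\<^bsub>N\<^esub>"
      using that gD(1) by (simp add: lmod_hom_minus[OF assms(1,2) g(1)]
          a_minus_eq_zero_iff[OF N.M.abelian_group_axioms])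
    then have "h x \<ominus>\<^bsub>L\<^esub> h y = \<zero>\<^bsub>L\<^esub>"
      using k[of "x \<ominus>\<^bsub>M\<^esub> y"] that by (simp add: lmod_hom_minus[OF assms(1,3) h])
    then show ?thesis
      using that hD(1) a_minus_eq_zero_iff[OF L.M.abelian_group_axioms] by auto
  qed
  have "(\<lambda>y. h (s y)) \<in> lmod_hom R N L"
  proof (rule lmod_homI)
    fix x y assume xy: "x \<in> carrier N" "y \<in> carrier N"
    then have "h (s (x \<oplus>\<^bsub>N\<^esub> y)) = h (s x \<oplus>\<^bsub>M\<^esub> s y)"
      by (intro eq) (auto simp: s gD)
    then show "h (s (x \<oplus>\<^bsub>N\<^esub> y)) = h (s x) \<oplus>\<^bsub>L\<^esub> h (s y)" using xy s hD by simp
  next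
    fix a x assume ax: "a \<in> carrier R" "x \<in> carrier N"
    then have "h (s (a \<odot>\<^bsub>N\<^esub> x)) = h (a \<odot>\<^bsub>M\<^esub> s x)"
      by (intro eq) (auto simp: s gD M.smult_closed N.smult_closed)
    then show "h (s (a \<odot>\<^bsub>N\<^esub> x)) = a \<odot>\<^bsub>L\<^esub> h (s x)" using ax s hD by simp
  qed (auto simp: s hD)
  moreover have "\<forall>x\<in>carrier M. h (s (g x)) = h x"
    using s gD by (auto intro!: eq)
  ultimately show ?thesis by (intro bexI[of _ "\<lambda>y. h (s y)"])
qed

text \<open>This is how \<open>M\<close> is later identified with \<open>W 0\<close>, and
  \<open>X j\<close> with \<open>Ext\<close>: in each case both modules are quotients of one module
  with equal kernels.\<close>

lemma lmod_iso_of_same_kernel: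
  assumes "left_module R M" "left_module R N" "left_module R L"
    and g: "g \<in> lmod_hom R M N" "g ` carrier M = carrier N"
    and h: "h \<in> lmod_hom R M L" "h ` carrier M = carrier L"
    and k: "a_kernel M N g = a_kernel M L h"
  shows "\<exists>u\<in>lmod_hom R N L. bij_betw u (carrier N) (carrier L) \<and> (\<forall>x\<in>carrier M. u (g x) = h x)"
proof -
  have k': "g x = \<zero>\<^bsub>N\<^esub> \<longleftrightarrow> h x = \<zero>\<^bsub>L\<^esub>" if "x \<in> carrier M" for x
    using k that by (auto simp: a_kernel_def')
  obtain u where u: "u \<in> lmod_hom R N L" "\<forall>x\<in>carrier M. u (g x) = h x"
    using lmod_hom_factor[OF assms(1-3) g h(1)] k' by blast
  have "inj_on u (carrier N)"
    unfolding lmod_hom_inj_iff[OF assms(2,3) u(1)] using g(2) k' u(2) by (metis imageE)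
  moreover have "u ` carrier N = carrier L"
    using g(2) h(2) u(2) by (metis (no_types, lifting) image_cong image_image)
  ultimately show ?thesis using u by (auto simp: bij_betw_def)
qed

lemma quotient_module_simps [simp]:
  "carrier (quotient_module M N) = a_rcosets\<^bsub>M\<^esub> N" "zero (quotient_module M N) = N"
  "add (quotient_module M N) A B = A <+>\<^bsub>M\<^esub> B"
  "smult (quotient_module M N) a A = (\<Union>x\<in>A. N +>\<^bsub>M\<^esub> (a \<odot>\<^bsub>M\<^esub> x))"
  by (simp_all add: quotient_module_def)

context
  fixes R :: "'a ring" and M :: "('a, 'm) module" and N
  assumes M: "left_module R M" and N: "submodule N R M"
begin

interpretation M: left_module R M by (rule M)

interpretation N: abelian_subgroup N M
  using N by (intro abelian_subgroupI3 M.M.abelian_group_axioms additive_subgroupI) (auto simp: submodule_def)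

text \<open>The product is defined as a union over all representatives of the coset. Since
  \<open>N\<close> is a submodule, all members of this union are one and the same coset.\<close>

lemma quotient_coset_smult:
  assumes "a \<in> carrier R" "x \<in> carrier M"
  shows "a \<odot>\<^bsub>quotient_module M N\<^esub> (N +>\<^bsub>M\<^esub> x) = N +>\<^bsub>M\<^esub> (a \<odot>\<^bsub>M\<^esub> x)"
proof -
  have "N +>\<^bsub>M\<^esub> (a \<odot>\<^bsub>M\<^esub> y) = N +>\<^bsub>M\<^esub> (a \<odot>\<^bsub>M\<^esub> x)" if y: "y \<in> N +>\<^bsub>M\<^esub> x" for y
  proof -
    obtain n where n: "n \<in> N" "y = n \<oplus>\<^bsub>M\<^esub> x" using y unfolding a_r_coset_def' by auto
    then have nc: "n \<in> carrier M" using N.a_subset by blast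
    have "a \<odot>\<^bsub>M\<^esub> y = a \<odot>\<^bsub>M\<^esub> n \<oplus>\<^bsub>M\<^esub> a \<odot>\<^bsub>M\<^esub> x"
      using n assms nc by (simp add: M.smult_r_distr)
    then have "a \<odot>\<^bsub>M\<^esub> y \<in> N +>\<^bsub>M\<^esub> (a \<odot>\<^bsub>M\<^esub> x)"
      using M.submoduleD(4)[OF N, of a n] n assms by (auto simp: a_r_coset_def')
    then show ?thesis
      using M.M.a_repr_independence N.a_subgroup M.smult_closed assms by metis
  qed
  then have "(\<Union>y\<in>N +>\<^bsub>M\<^esub> x. N +>\<^bsub>M\<^esub> (a \<odot>\<^bsub>M\<^esub> y)) = (\<Union>y\<in>N +>\<^bsub>M\<^esub> x. N +>\<^bsub>M\<^esub> (a \<odot>\<^bsub>M\<^esub> x))"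
    by (intro SUP_cong refl)
  moreover have "x \<in> N +>\<^bsub>M\<^esub> x" using N.a_rcos_self assms by simp
  then have "N +>\<^bsub>M\<^esub> x \<noteq> {}" by blast
  ultimately show ?thesis by simp
qed

lemma quotient_coset_add:
  assumes "x \<in> carrier M" "y \<in> carrier M"
  shows "(N +>\<^bsub>M\<^esub> x) \<oplus>\<^bsub>quotient_module M N\<^esub> (N +>\<^bsub>M\<^esub> y) = N +>\<^bsub>M\<^esub> (x \<oplus>\<^bsub>M\<^esub> y)"
  using N.a_rcos_sum[OF assms] by simp

lemma quotient_carrier: "carrier (quotient_module M N) = (\<lambda>x. N +>\<^bsub>M\<^esub> x) ` carrier M"
  by (auto simp: A_RCOSETS_def')

lemma quotient_zero: "\<zero>\<^bsub>quotient_module M N\<^esub> = N +>\<^bsub>M\<^esub> \<zero>\<^bsub>M\<^esub>"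
  using M.M.a_coset_add_zero[OF N.a_subset] by simp

lemma left_module_quotient: "left_module R (quotient_module M N)"
proof -
  note [simp del] = quotient_module_simps
  note [simp] = quotient_coset_add quotient_coset_smult quotient_zero
  show ?thesis
    by (rule left_moduleI)
      (auto simp: quotient_carrier M.R.ring_axioms M.M.a_ac M.smult_l_distr M.smult_r_distr
        M.smult_assoc M.smult_one M.smult_l_null M.smult_closed)
qed

lemma quotient_proj_hom: "(\<lambda>x. N +>\<^bsub>M\<^esub> x) \<in> lmod_hom R M (quotient_module M N)"
  by (rule lmod_homI)
    (use quotient_coset_add quotient_coset_smult quotient_carrier in
      \<open>auto simp del: quotient_module_simps\<close>)

lemma quotient_proj_kernel: "a_kernel M (quotient_module M N) (\<lambda>x. N +>\<^bsub>M\<^esub> x) = N"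
  using M.M.a_coset_join1[of N] M.M.a_coset_join2[of _ N] N.a_subgroup N.a_subset
  by (auto simp: a_kernel_iff)

end

text \<open>Lets later arguments work with a surjection of known kernel instead of cosets.\<close>

lemma quotient_projection:
  assumes "left_module R M" "submodule N R M"
  obtains q where "q \<in> lmod_hom R M (quotient_module M N)"
    "q ` carrier M = carrier (quotient_module M N)" "a_kernel M (quotient_module M N) q = N"
  using quotient_proj_hom[OF assms] quotient_proj_kernel[OF assms] quotient_carrier[OF assms]
  by (metis (no_types, lifting))

subsection \<open>Transport of structure and direct sums\<close>

text \<open>The structure on the image of an injective \<open>h\<close> that makes \<open>h\<close>
  an isomorphism. It serves to move a module into another element type.\<close>

definition transport_module :: "('m \<Rightarrow> 'n) \<Rightarrow> ('a, 'm) module \<Rightarrow> ('a, 'n) module" where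
  "transport_module h M = (let k = inv_into (carrier M) h in
     \<lparr>carrier = h ` carrier M, mult = undefined, one = undefined, zero = h \<zero>\<^bsub>M\<^esub>,
      add = \<lambda>x y. h (k x \<oplus>\<^bsub>M\<^esub> k y), smult = \<lambda>a x. h (a \<odot>\<^bsub>M\<^esub> k x)\<rparr>)"

lemma transport_module:
  assumes "left_module R M" "inj_on h (carrier M)"
  shows "left_module R (transport_module h M)" "h \<in> lmod_hom R M (transport_module h M)"
    "h ` carrier M = carrier (transport_module h M)"
proof -
  interpret M: left_module R M by fact
  note [simp] = inv_into_f_f[OF assms(2)]
  show "left_module R (transport_module h M)"
    by (rule left_moduleI)
      (auto simp: transport_module_def Let_def M.R.ring_axioms M.M.a_ac M.smult_l_distr
        M.smult_r_distr M.smult_assoc M.smult_one M.smult_l_null M.smult_closed)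
  show "h \<in> lmod_hom R M (transport_module h M)"
    by (rule lmod_homI) (auto simp: transport_module_def Let_def)
qed (simp add: transport_module_def Let_def)

lemma direct_sum_simps [simp]:
  "carrier (direct_sum M N) = carrier M \<times> carrier N"
  "zero (direct_sum M N) = (\<zero>\<^bsub>M\<^esub>, \<zero>\<^bsub>N\<^esub>)"
  "add (direct_sum M N) x y = (fst x \<oplus>\<^bsub>M\<^esub> fst y, snd x \<oplus>\<^bsub>N\<^esub> snd y)"
  "smult (direct_sum M N) a x = (a \<odot>\<^bsub>M\<^esub> fst x, a \<odot>\<^bsub>N\<^esub> snd x)"
  by (simp_all add: direct_sum_def)

lemma left_module_direct_sum:
  assumes "left_module R M" "left_module R N"
  shows "left_module R (direct_sum M N)"
proof -
  interpret M: left_module R M by fact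
  interpret N: left_module R N by fact
  show ?thesis
    by (rule left_moduleI)
      (auto simp: M.R.ring_axioms M.M.a_ac M.smult_l_distr N.M.a_ac N.smult_l_distr
        M.smult_r_distr M.smult_assoc M.smult_one M.smult_l_null M.smult_closed
        N.smult_r_distr N.smult_assoc N.smult_one N.smult_l_null N.smult_closed)
qed

lemma direct_sum_homs:
  "fst \<in> lmod_hom R (direct_sum M N) M" "snd \<in> lmod_hom R (direct_sum M N) N"
  by (auto intro!: lmod_homI)

lemma direct_sum_hom_pair:
  assumes "f \<in> lmod_hom R L M" "g \<in> lmod_hom R L N"
  shows "(\<lambda>x. (f x, g x)) \<in> lmod_hom R L (direct_sum M N)"
  by (intro lmod_homI) (auto simp: lmod_homD[OF assms(1)] lmod_homD[OF assms(2)])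

lemma direct_sum_injections:
  assumes "left_module R M" "left_module R N"
  shows "(\<lambda>x. (x, \<zero>\<^bsub>N\<^esub>)) \<in> lmod_hom R M (direct_sum M N)"
    "(\<lambda>y. (\<zero>\<^bsub>M\<^esub>, y)) \<in> lmod_hom R N (direct_sum M N)"
  using assms by (auto intro!: direct_sum_hom_pair lmod_hom_id lmod_hom_const_zero)

section \<open>Finite generation and projectivity\<close>

definition fg_submodule :: "'a ring \<Rightarrow> ('a, 'm) module \<Rightarrow> 'm set \<Rightarrow> bool" where
  "fg_submodule R M N \<longleftrightarrow> submodule N R M \<and>
     (\<exists>A. finite A \<and> A \<subseteq> N \<and> (\<forall>H. submodule H R M \<longrightarrow> A \<subseteq> H \<longrightarrow> N \<subseteq> H))"

lemma fg_submoduleE: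
  assumes "fg_submodule R M N"
  obtains A where "finite A" "A \<subseteq> N" "\<forall>H. submodule H R M \<longrightarrow> A \<subseteq> H \<longrightarrow> N \<subseteq> H"
  using assms unfolding fg_submodule_def by (elim conjE exE) (rule that)

lemma submodule_Int:
  assumes "left_module R M" "submodule H R M" "submodule K R M"
  shows "submodule (H \<inter> K) R M"
proof -
  interpret M: left_module R M by fact
  show ?thesis
    using M.submoduleD[OF assms(2)] M.submoduleD[OF assms(3)] by (intro M.submoduleI) auto
qed

lemma submodule_Inter:
  assumes "left_module R M" "\<And>H. H \<in> \<A> \<Longrightarrow> submodule H R M" "\<A> \<noteq> {}"
  shows "submodule (\<Inter>\<A>) R M"
proof -
  interpret M: left_module R M by fact
  show ?thesis
    using M.submoduleD(1-4)[OF assms(2)] assms(3) by (intro M.submoduleI) (auto, blast)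
qed

lemma submodule_of_submodule_iff:
  assumes "left_module R M" "submodule N R M"
  shows "submodule H R (M\<lparr>carrier := N\<rparr>) \<longleftrightarrow> submodule H R M \<and> H \<subseteq> N"
proof -
  interpret M: left_module R M by fact
  interpret N: left_module R "M\<lparr>carrier := N\<rparr>" by (rule submodule_left_module[OF assms])
  show ?thesis
  proof
    assume H: "submodule H R (M\<lparr>carrier := N\<rparr>)"
    show "submodule H R M \<and> H \<subseteq> N"
      using N.submoduleD[OF H] M.submoduleD(1)[OF assms(2)] by (auto intro!: M.submoduleI)
  next
    assume H: "submodule H R M \<and> H \<subseteq> N"
    show "submodule H R (M\<lparr>carrier := N\<rparr>)"
      using M.submoduleD(1-4)[of H] H by (intro N.submoduleI) auto
  qed
qed

lemma fg_moduleE: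
  assumes "fg_module R M"
  obtains A where "finite A" "A \<subseteq> carrier M" "\<forall>H. submodule H R M \<longrightarrow> A \<subseteq> H \<longrightarrow> H = carrier M"
  using assms unfolding fg_module_def by metis

lemma fg_moduleI:
  assumes "left_module R M" "finite A" "A \<subseteq> carrier M"
    "\<And>H. submodule H R M \<Longrightarrow> A \<subseteq> H \<Longrightarrow> H = carrier M"
  shows "fg_module R M"
  unfolding fg_module_def using assms by metis

lemma fg_submodule_iff:
  assumes "left_module R M" "submodule N R M"
  shows "fg_module R (M\<lparr>carrier := N\<rparr>) \<longleftrightarrow> fg_submodule R M N"
proof
  assume "fg_module R (M\<lparr>carrier := N\<rparr>)"
  then obtain A where A: "finite A" "A \<subseteq> N" "\<forall>H. submodule H R M \<and> H \<subseteq> N \<longrightarrow> A \<subseteq> H \<longrightarrow> H = N"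
    by (rule fg_moduleE) (simp_all add: submodule_of_submodule_iff[OF assms])
  have "N \<subseteq> H" if "submodule H R M" "A \<subseteq> H" for H
  proof -
    have "H \<inter> N = N"
      using A(3)[rule_format, of "H \<inter> N"] submodule_Int[OF assms(1) that(1) assms(2)] A(2) that by simp
    then show ?thesis by (simp add: Int_absorb2 inf.order_iff inf_commute)
  qed
  then show "fg_submodule R M N"
    unfolding fg_submodule_def using A(1,2) assms(2) by (intro conjI exI[of _ A] allI impI) simp_all
next
  assume *: "fg_submodule R M N"
  show "fg_module R (M\<lparr>carrier := N\<rparr>)"
  proof (rule fg_submoduleE[OF *])
    fix A assume A: "finite A" "A \<subseteq> N" "\<forall>H. submodule H R M \<longrightarrow> A \<subseteq> H \<longrightarrow> N \<subseteq> H"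
    note A = A(1,2) A(3)[rule_format]
    show "fg_module R (M\<lparr>carrier := N\<rparr>)"
    proof (rule fg_moduleI[OF submodule_left_module[OF assms] A(1)])
      show "A \<subseteq> carrier (M\<lparr>carrier := N\<rparr>)" using A(2) by simp
    next
      fix H assume "submodule H R (M\<lparr>carrier := N\<rparr>)" "A \<subseteq> H"
      then have "submodule H R M" "H \<subseteq> N" by (simp_all add: submodule_of_submodule_iff[OF assms])
      then have "H = N" using A(3)[OF _ \<open>A \<subseteq> H\<close>] by (intro subset_antisym)
      then show "H = carrier (M\<lparr>carrier := N\<rparr>)" by simp
    qed
  qed
qed

lemma fg_module_left_module: "fg_module R M \<Longrightarrow> left_module R M"
  by (simp add: fg_module_def)

text \<open>The ideal of leading coefficients, as in the proof of Hilbert's basis theorem: the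
  coefficients at \<open>a\<close> of those elements of \<open>K\<close> that lie in
  \<open>R a + S\<close>. Through it the hypothesis on left ideals reaches submodules of arbitrary
  modules.\<close>

lemma submodule_coefficients:
  assumes "left_module R M" "submodule S R M" "submodule K R M" "a \<in> carrier M"
  shows "submodule {r \<in> carrier R. \<exists>m\<in>S. r \<odot>\<^bsub>M\<^esub> a \<oplus>\<^bsub>M\<^esub> m \<in> K} R (regular_module R)"
proof -
  interpret M: left_module R M by fact
  interpret Reg: left_module R "regular_module R" by (rule left_module_regular[OF M.R.ring_axioms])
  note S = M.submoduleD[OF assms(2)] and K = M.submoduleD[OF assms(3)]
  have sc: "\<And>x. x \<in> S \<Longrightarrow> x \<in> carrier M" using S(1) by blast
  show ?thesis
  proof (rule Reg.submoduleI)
    show "\<zero>\<^bsub>regular_module R\<^esub> \<in> {r \<in> carrier R. \<exists>m\<in>S. r \<odot>\<^bsub>M\<^esub> a \<oplus>\<^bsub>M\<^esub> m \<in> K}"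
      using S(2) K(2) assms(4) by (auto simp: M.smult_l_null intro!: bexI[of _ "\<zero>\<^bsub>M\<^esub>"])
    show "x \<oplus>\<^bsub>regular_module R\<^esub> y \<in> {r \<in> carrier R. \<exists>m\<in>S. r \<odot>\<^bsub>M\<^esub> a \<oplus>\<^bsub>M\<^esub> m \<in> K}"
      if xy: "x \<in> {r \<in> carrier R. \<exists>m\<in>S. r \<odot>\<^bsub>M\<^esub> a \<oplus>\<^bsub>M\<^esub> m \<in> K}"
        "y \<in> {r \<in> carrier R. \<exists>m\<in>S. r \<odot>\<^bsub>M\<^esub> a \<oplus>\<^bsub>M\<^esub> m \<in> K}" for x y
    proof -
      obtain m n where mn: "m \<in> S" "x \<odot>\<^bsub>M\<^esub> a \<oplus>\<^bsub>M\<^esub> m \<in> K" "n \<in> S" "y \<odot>\<^bsub>M\<^esub> a \<oplus>\<^bsub>M\<^esub> n \<in> K"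
        using xy by blast
      have "(x \<oplus>\<^bsub>R\<^esub> y) \<odot>\<^bsub>M\<^esub> a \<oplus>\<^bsub>M\<^esub> (m \<oplus>\<^bsub>M\<^esub> n) = (x \<odot>\<^bsub>M\<^esub> a \<oplus>\<^bsub>M\<^esub> m) \<oplus>\<^bsub>M\<^esub> (y \<odot>\<^bsub>M\<^esub> a \<oplus>\<^bsub>M\<^esub> n)"
        using xy mn sc assms(4) by (simp add: M.smult_l_distr M.smult_closed M.M.a_ac)
      then show ?thesis
        using xy S(3)[OF mn(1,3)] K(3)[OF mn(2,4)] by auto metis
    qed
    show "r \<odot>\<^bsub>regular_module R\<^esub> x \<in> {r \<in> carrier R. \<exists>m\<in>S. r \<odot>\<^bsub>M\<^esub> a \<oplus>\<^bsub>M\<^esub> m \<in> K}"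
      if r: "r \<in> carrier R" and x: "x \<in> {r \<in> carrier R. \<exists>m\<in>S. r \<odot>\<^bsub>M\<^esub> a \<oplus>\<^bsub>M\<^esub> m \<in> K}" for r x
    proof -
      obtain m where m: "m \<in> S" "x \<odot>\<^bsub>M\<^esub> a \<oplus>\<^bsub>M\<^esub> m \<in> K"
        using x by blast
      have "(r \<otimes>\<^bsub>R\<^esub> x) \<odot>\<^bsub>M\<^esub> a \<oplus>\<^bsub>M\<^esub> r \<odot>\<^bsub>M\<^esub> m = r \<odot>\<^bsub>M\<^esub> (x \<odot>\<^bsub>M\<^esub> a \<oplus>\<^bsub>M\<^esub> m)"
        using r x m sc assms(4) by (simp add: M.smult_assoc M.smult_r_distr M.smult_closed)
      then show ?thesis
        using r x S(4)[OF r m(1)] K(4)[OF r m(2)] by auto metis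
    qed
  qed auto
qed

text \<open>The second premise places \<open>N\<close> in the span of the finite set
  \<open>A\<close>, and the induction is on \<open>A\<close>. Modulo \<open>N \<inter> S\<close>,
  where \<open>S\<close> is the span of the old generators, \<open>N\<close> is governed by the
  ideal of coefficients at the new generator. The ideal is finitely generated by the noetherian
  hypothesis, the intersection by induction.\<close>

lemma submodule_fg_aux:
  assumes noeth: "left_noetherian R" and M: "left_module R M" and A: "finite A" "A \<subseteq> carrier M"
  shows "submodule N R M \<Longrightarrow> (\<And>H. submodule H R M \<Longrightarrow> A \<subseteq> H \<Longrightarrow> N \<subseteq> H) \<Longrightarrow> fg_submodule R M N"
  using A
proof (induction A arbitrary: N rule: finite_induct)
  case empty
  then show ?case by (auto simp: fg_submodule_def)
next
  case (insert a A)
  interpret M: left_module R M by fact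
  have a: "a \<in> carrier M" using insert.prems by simp
  define S where "S = \<Inter>{H. submodule H R M \<and> A \<subseteq> H}"
  have S: "submodule S R M"
    unfolding S_def using M.submodule_carrier insert.prems(3) by (intro submodule_Inter[OF M]) auto
  note SD = M.submoduleD[OF S]
  have sc: "\<And>x. x \<in> S \<Longrightarrow> x \<in> carrier M" using SD(1) by blast
  have AS: "A \<subseteq> S" by (auto simp: S_def)
  define T where "T = {r \<odot>\<^bsub>M\<^esub> a \<oplus>\<^bsub>M\<^esub> m |r m. r \<in> carrier R \<and> m \<in> S}"
  have "submodule T R M"
  proof (rule M.submoduleI)
    show "T \<subseteq> carrier M" using a sc by (auto simp: T_def M.smult_closed)
    show "\<zero>\<^bsub>M\<^esub> \<in> T"
      using a SD(2) by (auto simp: T_def M.smult_l_null intro!: exI[of _ "\<zero>\<^bsub>R\<^esub>"] exI[of _ "\<zero>\<^bsub>M\<^esub>"])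
    show "x \<oplus>\<^bsub>M\<^esub> y \<in> T" if xy: "x \<in> T" "y \<in> T" for x y
    proof -
      obtain r m s n where rm: "r \<in> carrier R" "m \<in> S" "x = r \<odot>\<^bsub>M\<^esub> a \<oplus>\<^bsub>M\<^esub> m"
        "s \<in> carrier R" "n \<in> S" "y = s \<odot>\<^bsub>M\<^esub> a \<oplus>\<^bsub>M\<^esub> n"
        using xy unfolding T_def by blast
      have "x \<oplus>\<^bsub>M\<^esub> y = (r \<oplus>\<^bsub>R\<^esub> s) \<odot>\<^bsub>M\<^esub> a \<oplus>\<^bsub>M\<^esub> (m \<oplus>\<^bsub>M\<^esub> n)"
        using rm a sc by (simp add: M.smult_l_distr M.smult_closed M.M.a_ac)
      then show ?thesis using rm SD(3) unfolding T_def by blast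
    qed
    show "r \<odot>\<^bsub>M\<^esub> x \<in> T" if r: "r \<in> carrier R" and x: "x \<in> T" for r x
    proof -
      obtain s m where rm: "s \<in> carrier R" "m \<in> S" "x = s \<odot>\<^bsub>M\<^esub> a \<oplus>\<^bsub>M\<^esub> m"
        using x unfolding T_def by blast
      have "r \<odot>\<^bsub>M\<^esub> x = (r \<otimes>\<^bsub>R\<^esub> s) \<odot>\<^bsub>M\<^esub> a \<oplus>\<^bsub>M\<^esub> r \<odot>\<^bsub>M\<^esub> m"
        using rm a sc r by (simp add: M.smult_assoc M.smult_r_distr M.smult_closed)
      then show ?thesis using rm r SD(4) unfolding T_def by blast
    qed
  qed
  moreover have "insert a A \<subseteq> T"
  proof -
    have "\<one>\<^bsub>R\<^esub> \<odot>\<^bsub>M\<^esub> a \<oplus>\<^bsub>M\<^esub> \<zero>\<^bsub>M\<^esub> = a" using a by (simp add: M.smult_one)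
    then have "a \<in> T"
      using SD(2) unfolding T_def by (intro CollectI exI[of _ "\<one>\<^bsub>R\<^esub>"] exI[of _ "\<zero>\<^bsub>M\<^esub>"]) auto
    moreover have "x \<in> T" if "x \<in> A" for x
    proof -
      have "\<zero>\<^bsub>R\<^esub> \<odot>\<^bsub>M\<^esub> a \<oplus>\<^bsub>M\<^esub> x = x" using a that AS sc by (auto simp: M.smult_l_null)
      then show ?thesis
        using AS that unfolding T_def by (intro CollectI exI[of _ "\<zero>\<^bsub>R\<^esub>"] exI[of _ x]) auto
    qed
    ultimately show ?thesis by blast
  qed
  ultimately have NT: "N \<subseteq> T" using insert.prems(2) by blast
  note N = \<open>submodule N R M\<close>
  note ND = M.submoduleD[OF N]
  have "fg_submodule R M (N \<inter> S)"
  proof (rule insert.IH)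
    show "submodule (N \<inter> S) R M" using submodule_Int[OF M N S] .
    show "N \<inter> S \<subseteq> H" if "submodule H R M" "A \<subseteq> H" for H using that by (auto simp: S_def)
  qed (use insert.prems in auto)
  then obtain B where B: "finite B" "B \<subseteq> N \<inter> S" "\<forall>H. submodule H R M \<longrightarrow> B \<subseteq> H \<longrightarrow> N \<inter> S \<subseteq> H"
    by (rule fg_submoduleE)
  note B = B(1,2) B(3)[rule_format]
  define J where "J K = {r \<in> carrier R. \<exists>m\<in>S. r \<odot>\<^bsub>M\<^esub> a \<oplus>\<^bsub>M\<^esub> m \<in> K}" for K
  have J: "submodule (J K) R (regular_module R)" if "submodule K R M" for K
    unfolding J_def using submodule_coefficients[OF M S that a] .
  have "fg_submodule R (regular_module R) (J N)"
  proof -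
    have "fg_module R ((regular_module R)\<lparr>carrier := J N\<rparr>)"
      by (rule noeth[unfolded left_noetherian_def, THEN conjunct2, rule_format, OF J[OF N]])
    then show ?thesis
      by (rule fg_submodule_iff[OF left_module_regular[OF M.R.ring_axioms] J[OF N], THEN iffD1])
  qed
  then obtain G where G: "finite G" "G \<subseteq> J N"
    "\<forall>H. submodule H R (regular_module R) \<longrightarrow> G \<subseteq> H \<longrightarrow> J N \<subseteq> H"
    by (rule fg_submoduleE)
  note G = G(1,2) G(3)[rule_format]
  obtain m where m: "\<And>r. r \<in> G \<Longrightarrow> m r \<in> S \<and> r \<odot>\<^bsub>M\<^esub> a \<oplus>\<^bsub>M\<^esub> m r \<in> N"
  proof -
    have "\<forall>r\<in>G. \<exists>m. m \<in> S \<and> r \<odot>\<^bsub>M\<^esub> a \<oplus>\<^bsub>M\<^esub> m \<in> N" using G(2) unfolding J_def by blast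
    then have "\<exists>f. \<forall>r\<in>G. f r \<in> S \<and> r \<odot>\<^bsub>M\<^esub> a \<oplus>\<^bsub>M\<^esub> f r \<in> N" by (rule bchoice)
    then show ?thesis using that by blast
  qed
  \<comment> \<open>Generators of \<open>N\<close>: a lift \<open>r a + m r\<close> into
    \<open>N\<close> of every generator \<open>r\<close> of the coefficient ideal, together with the
    generators \<open>B\<close> of \<open>N \<inter> S\<close>.\<close>
  let ?A = "(\<lambda>r. r \<odot>\<^bsub>M\<^esub> a \<oplus>\<^bsub>M\<^esub> m r) ` G \<union> B"
  have "N \<subseteq> H" if H: "submodule H R M" "?A \<subseteq> H" for H
  proof
    fix x assume x: "x \<in> N"
    then obtain r n where rn: "r \<in> carrier R" "n \<in> S" "x = r \<odot>\<^bsub>M\<^esub> a \<oplus>\<^bsub>M\<^esub> n"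
      using NT unfolding T_def by blast
    \<comment> \<open>Intersecting with \<open>N\<close> makes the element \<open>?y\<close> found
      below lie in \<open>H\<close> and in \<open>N\<close> at once, so that \<open>x - ?y\<close>
      falls into \<open>N \<inter> S\<close>, which \<open>H\<close> contains.\<close>
    have HN: "submodule (H \<inter> N) R M" using submodule_Int[OF M H(1) N] .
    have "G \<subseteq> J (H \<inter> N)" using m H(2) G(2) unfolding J_def by blast
    then have "J N \<subseteq> J (H \<inter> N)" by (rule G(3)[OF J[OF HN]])
    moreover have "r \<in> J N" using x rn by (auto simp: J_def)
    ultimately obtain k where k: "k \<in> S" "r \<odot>\<^bsub>M\<^esub> a \<oplus>\<^bsub>M\<^esub> k \<in> H" "r \<odot>\<^bsub>M\<^esub> a \<oplus>\<^bsub>M\<^esub> k \<in> N"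
      unfolding J_def by blast
    let ?y = "r \<odot>\<^bsub>M\<^esub> a \<oplus>\<^bsub>M\<^esub> k"
    have yc: "?y \<in> carrier M" "x \<in> carrier M" using k ND(1) x by blast+
    have "x \<oplus>\<^bsub>M\<^esub> \<ominus>\<^bsub>M\<^esub> ?y \<in> N" using ND x k by blast
    moreover have "x \<oplus>\<^bsub>M\<^esub> \<ominus>\<^bsub>M\<^esub> ?y = n \<oplus>\<^bsub>M\<^esub> \<ominus>\<^bsub>M\<^esub> k"
      using rn k sc a M.smult_closed[of r a]
      by (simp add: M.M.minus_add M.M.a_ac) (metis M.M.a_lcomm M.M.a_inv_closed M.M.add.m_closed M.M.r_neg M.M.r_zero)
    then have "x \<oplus>\<^bsub>M\<^esub> \<ominus>\<^bsub>M\<^esub> ?y \<in> S" using rn k SD by simp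
    ultimately have "x \<oplus>\<^bsub>M\<^esub> \<ominus>\<^bsub>M\<^esub> ?y \<in> H" using B(3)[OF H(1)] H(2) by blast
    then have "(x \<oplus>\<^bsub>M\<^esub> \<ominus>\<^bsub>M\<^esub> ?y) \<oplus>\<^bsub>M\<^esub> ?y \<in> H"
      using M.submoduleD(3)[OF H(1)] k by blast
    then show "x \<in> H" using yc by (simp add: M.M.a_assoc M.M.l_neg)
  qed
  moreover have "?A \<subseteq> N" using m B by blast
  ultimately show ?case
    unfolding fg_submodule_def using N G(1) B(1) by (intro conjI exI[of _ ?A] allI impI) simp_all
qed

lemma noetherian_fg_submodule:
  assumes "left_noetherian R" "fg_module R M" "submodule N R M"
  shows "fg_module R (M\<lparr>carrier := N\<rparr>)"
proof -
  note M = fg_module_left_module[OF assms(2)]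
  obtain A where A: "finite A" "A \<subseteq> carrier M" "\<forall>H. submodule H R M \<longrightarrow> A \<subseteq> H \<longrightarrow> H = carrier M"
    by (rule fg_moduleE[OF assms(2)])
  note A = A(1,2) A(3)[rule_format]
  have "N \<subseteq> carrier M" using left_module.submoduleD(1)[OF M assms(3)] .
  then have "fg_submodule R M N"
    using A(3) by (intro submodule_fg_aux[OF assms(1) M A(1,2) assms(3)]) simp
  then show ?thesis using fg_submodule_iff[OF M assms(3)] by simp
qed

lemma fg_module_image:
  assumes "fg_module R M" "left_module R N" "h \<in> lmod_hom R M N" "h ` carrier M = carrier N"
  shows "fg_module R N"
proof -
  note M = fg_module_left_module[OF assms(1)]
  interpret M: left_module R M by fact
  interpret N: left_module R N by fact
  obtain A where A: "finite A" "A \<subseteq> carrier M" "\<forall>H. submodule H R M \<longrightarrow> A \<subseteq> H \<longrightarrow> H = carrier M"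
    by (rule fg_moduleE[OF assms(1)])
  note A = A(1,2) A(3)[rule_format]
  have "H = carrier N" if H: "submodule H R N" "h ` A \<subseteq> H" for H
  proof -
    note HD = N.submoduleD[OF H(1)]
    have "submodule {x \<in> carrier M. h x \<in> H} R M"
      using HD lmod_homD[OF assms(3)] lmod_hom_zero[OF M assms(2,3)]
      by (intro M.submoduleI) (auto simp: M.smult_closed)
    then have "{x \<in> carrier M. h x \<in> H} = carrier M"
      using A(2) H(2) by (intro A(3)) auto
    then have "\<And>x. x \<in> carrier M \<Longrightarrow> h x \<in> H" by blast
    then have "h ` carrier M \<subseteq> H" by (rule image_subsetI)
    then show ?thesis unfolding assms(4) using HD(1) by (intro subset_antisym)
  qed
  then show ?thesis
    using fg_moduleI[OF assms(2) finite_imageI[OF A(1), of h]] A(2) unfolding assms(4)[symmetric]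
    by (simp add: image_mono)
qed

subsection \<open>Free modules\<close>

text \<open>Sequences that vanish from position \<open>n\<close> on. All ranks thus share the
  element type \<open>nat \<Rightarrow> 'a\<close>, which is why sets of such sequences can serve as
  the universe.\<close>

definition free_module :: "'a ring \<Rightarrow> nat \<Rightarrow> ('a, nat \<Rightarrow> 'a) module" where
  "free_module R n =
     \<lparr>carrier = {x. (\<forall>i<n. x i \<in> carrier R) \<and> (\<forall>i\<ge>n. x i = \<zero>\<^bsub>R\<^esub>)}, mult = undefined, one = undefined,
      zero = \<lambda>i. \<zero>\<^bsub>R\<^esub>, add = \<lambda>x y i. x i \<oplus>\<^bsub>R\<^esub> y i, smult = \<lambda>a x i. a \<otimes>\<^bsub>R\<^esub> x i\<rparr>"

definition unit_vector :: "'a ring \<Rightarrow> nat \<Rightarrow> nat \<Rightarrow> 'a" where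
  "unit_vector R j = (\<lambda>i. if i = j then \<one>\<^bsub>R\<^esub> else \<zero>\<^bsub>R\<^esub>)"

context
  fixes R :: "'a ring"
  assumes R: "ring R"
begin

interpretation R: ring R by (rule R)

lemma free_module_coord: "x \<in> carrier (free_module R n) \<Longrightarrow> x i \<in> carrier R"
  by (cases "i < n") (auto simp: free_module_def)

lemma left_module_free: "left_module R (free_module R n)"
proof (rule left_moduleI)
  note c = free_module_coord
  show "(x \<oplus>\<^bsub>free_module R n\<^esub> y) \<oplus>\<^bsub>free_module R n\<^esub> z = x \<oplus>\<^bsub>free_module R n\<^esub> (y \<oplus>\<^bsub>free_module R n\<^esub> z)"
    if "x \<in> carrier (free_module R n)" "y \<in> carrier (free_module R n)" "z \<in> carrier (free_module R n)" for x y z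
    using c[OF that(1)] c[OF that(2)] c[OF that(3)] by (simp add: free_module_def R.a_assoc)
  show "x \<oplus>\<^bsub>free_module R n\<^esub> y = y \<oplus>\<^bsub>free_module R n\<^esub> x"
    if "x \<in> carrier (free_module R n)" "y \<in> carrier (free_module R n)" for x y
    using c[OF that(1)] c[OF that(2)] by (simp add: free_module_def R.a_comm)
  show "a \<odot>\<^bsub>free_module R n\<^esub> (x \<oplus>\<^bsub>free_module R n\<^esub> y) =
      a \<odot>\<^bsub>free_module R n\<^esub> x \<oplus>\<^bsub>free_module R n\<^esub> a \<odot>\<^bsub>free_module R n\<^esub> y"
    if "a \<in> carrier R" "x \<in> carrier (free_module R n)" "y \<in> carrier (free_module R n)" for a x y
    using c[OF that(2)] c[OF that(3)] that(1) by (simp add: free_module_def R.r_distr)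
  show "\<zero>\<^bsub>free_module R n\<^esub> \<oplus>\<^bsub>free_module R n\<^esub> x = x" if "x \<in> carrier (free_module R n)" for x
    using c[OF that] by (simp add: free_module_def)
  show "\<one>\<^bsub>R\<^esub> \<odot>\<^bsub>free_module R n\<^esub> x = x" if "x \<in> carrier (free_module R n)" for x
    using c[OF that] by (simp add: free_module_def)
  show "\<zero>\<^bsub>R\<^esub> \<odot>\<^bsub>free_module R n\<^esub> x = \<zero>\<^bsub>free_module R n\<^esub>" if "x \<in> carrier (free_module R n)" for x
    using c[OF that] by (simp add: free_module_def)
  show "(a \<oplus>\<^bsub>R\<^esub> b) \<odot>\<^bsub>free_module R n\<^esub> x = a \<odot>\<^bsub>free_module R n\<^esub> x \<oplus>\<^bsub>free_module R n\<^esub> b \<odot>\<^bsub>free_module R n\<^esub> x"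
    if "a \<in> carrier R" "b \<in> carrier R" "x \<in> carrier (free_module R n)" for a b x
    using c[OF that(3)] that by (simp add: free_module_def R.l_distr)
  show "(a \<otimes>\<^bsub>R\<^esub> b) \<odot>\<^bsub>free_module R n\<^esub> x = a \<odot>\<^bsub>free_module R n\<^esub> (b \<odot>\<^bsub>free_module R n\<^esub> x)"
    if "a \<in> carrier R" "b \<in> carrier R" "x \<in> carrier (free_module R n)" for a b x
    using c[OF that(3)] that by (simp add: free_module_def R.m_assoc)
qed (auto simp: free_module_def R.ring_axioms)

lemma coord_hom: "(\<lambda>x. x i) \<in> lmod_hom R (free_module R n) (regular_module R)"
  by (rule lmod_homI) (auto simp: free_module_coord, auto simp: free_module_def)

lemma unit_vector_closed: "j < n \<Longrightarrow> unit_vector R j \<in> carrier (free_module R n)"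
  by (auto simp: free_module_def unit_vector_def)

lemma free_comb_hom:
  assumes "left_module R M" "\<And>i. i < n \<Longrightarrow> a i \<in> carrier M"
  shows "(\<lambda>x. \<Oplus>\<^bsub>M\<^esub>i\<in>{..<n}. x i \<odot>\<^bsub>M\<^esub> a i) \<in> lmod_hom R (free_module R n) M"
proof -
  interpret M: left_module R M by fact
  have cl: "x i \<odot>\<^bsub>M\<^esub> a i \<in> carrier M" if "x \<in> carrier (free_module R n)" "i < n" for x i
    using free_module_coord[OF that(1)] assms(2) that(2) by (auto simp: M.smult_closed)
  show ?thesis
  proof (rule lmod_homI)
    fix x y assume xy: "x \<in> carrier (free_module R n)" "y \<in> carrier (free_module R n)"
    have "(\<Oplus>\<^bsub>M\<^esub>i\<in>{..<n}. (x \<oplus>\<^bsub>free_module R n\<^esub> y) i \<odot>\<^bsub>M\<^esub> a i)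
        = (\<Oplus>\<^bsub>M\<^esub>i\<in>{..<n}. x i \<odot>\<^bsub>M\<^esub> a i \<oplus>\<^bsub>M\<^esub> y i \<odot>\<^bsub>M\<^esub> a i)"
      using xy cl assms(2) free_module_coord[OF xy(1)] free_module_coord[OF xy(2)]
      by (intro M.M.finsum_cong') (auto simp: free_module_def M.smult_l_distr M.smult_closed)
    also have "\<dots> = (\<Oplus>\<^bsub>M\<^esub>i\<in>{..<n}. x i \<odot>\<^bsub>M\<^esub> a i) \<oplus>\<^bsub>M\<^esub> (\<Oplus>\<^bsub>M\<^esub>i\<in>{..<n}. y i \<odot>\<^bsub>M\<^esub> a i)"
      using cl xy by (intro M.M.finsum_addf) auto
    finally show "(\<Oplus>\<^bsub>M\<^esub>i\<in>{..<n}. (x \<oplus>\<^bsub>free_module R n\<^esub> y) i \<odot>\<^bsub>M\<^esub> a i)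
        = (\<Oplus>\<^bsub>M\<^esub>i\<in>{..<n}. x i \<odot>\<^bsub>M\<^esub> a i) \<oplus>\<^bsub>M\<^esub> (\<Oplus>\<^bsub>M\<^esub>i\<in>{..<n}. y i \<odot>\<^bsub>M\<^esub> a i)" .
  next
    fix b x assume bx: "b \<in> carrier R" "x \<in> carrier (free_module R n)"
    have "(\<Oplus>\<^bsub>M\<^esub>i\<in>{..<n}. (b \<odot>\<^bsub>free_module R n\<^esub> x) i \<odot>\<^bsub>M\<^esub> a i)
        = (\<Oplus>\<^bsub>M\<^esub>i\<in>{..<n}. b \<odot>\<^bsub>M\<^esub> (x i \<odot>\<^bsub>M\<^esub> a i))"
      using bx cl assms(2) free_module_coord[OF bx(2)]
      by (intro M.M.finsum_cong') (auto simp: free_module_def M.smult_assoc M.smult_closed)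
    also have "\<dots> = b \<odot>\<^bsub>M\<^esub> (\<Oplus>\<^bsub>M\<^esub>i\<in>{..<n}. x i \<odot>\<^bsub>M\<^esub> a i)"
      using cl bx by (intro M.finsum_smult_ldistr[symmetric]) auto
    finally show "(\<Oplus>\<^bsub>M\<^esub>i\<in>{..<n}. (b \<odot>\<^bsub>free_module R n\<^esub> x) i \<odot>\<^bsub>M\<^esub> a i)
        = b \<odot>\<^bsub>M\<^esub> (\<Oplus>\<^bsub>M\<^esub>i\<in>{..<n}. x i \<odot>\<^bsub>M\<^esub> a i)" .
  qed (use cl in \<open>auto intro!: M.M.finsum_closed\<close>)
qed

lemma free_comb_unit:
  assumes "left_module R M" "\<And>i. i < n \<Longrightarrow> a i \<in> carrier M" "j < n"
  shows "(\<Oplus>\<^bsub>M\<^esub>i\<in>{..<n}. unit_vector R j i \<odot>\<^bsub>M\<^esub> a i) = a j"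
proof -
  interpret M: left_module R M by fact
  have "(\<Oplus>\<^bsub>M\<^esub>i\<in>{..<n}. unit_vector R j i \<odot>\<^bsub>M\<^esub> a i) = (\<Oplus>\<^bsub>M\<^esub>i\<in>{..<n}. if j = i then a i else \<zero>\<^bsub>M\<^esub>)"
    using assms by (intro M.M.finsum_cong') (auto simp: unit_vector_def M.smult_one M.smult_l_null)
  also have "\<dots> = a j"
    using assms by (intro M.M.finsum_singleton) auto
  finally show ?thesis .
qed

lemma free_module_expand:
  assumes "x \<in> carrier (free_module R n)"
  shows "x = (\<Oplus>\<^bsub>free_module R n\<^esub>i\<in>{..<n}. x i \<odot>\<^bsub>free_module R n\<^esub> unit_vector R i)" (is "x = ?s")
proof
  interpret F: left_module R "free_module R n" by (rule left_module_free)
  fix j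
  have cl: "(\<lambda>i. x i \<odot>\<^bsub>free_module R n\<^esub> unit_vector R i) \<in> {..<n} \<rightarrow> carrier (free_module R n)"
    using free_module_coord[OF assms] by (auto intro!: F.smult_closed unit_vector_closed)
  have "?s j = (\<Oplus>\<^bsub>regular_module R\<^esub>i\<in>{..<n}. (x i \<odot>\<^bsub>free_module R n\<^esub> unit_vector R i) j)"
    using lmod_hom_finsum[OF left_module_free left_module_regular[OF R] coord_hom _ cl] by simp
  interpret Reg: left_module R "regular_module R" by (rule left_module_regular[OF R])
  have "?s j = (\<Oplus>\<^bsub>regular_module R\<^esub>i\<in>{..<n}. if j = i then x i else \<zero>\<^bsub>R\<^esub>)"
    unfolding \<open>?s j = _\<close> using free_module_coord[OF assms]
    by (intro Reg.M.finsum_cong') (auto simp: free_module_def unit_vector_def)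
  also have "\<dots> = x j"
  proof (cases "j < n")
    case True
    then show ?thesis
      using Reg.M.finsum_singleton[of j "{..<n}" x] free_module_coord[OF assms]
      unfolding regular_module_simps by simp
  next
    case False
    then have "(\<Oplus>\<^bsub>regular_module R\<^esub>i\<in>{..<n}. if j = i then x i else \<zero>\<^bsub>R\<^esub>)
        = (\<Oplus>\<^bsub>regular_module R\<^esub>i\<in>{..<n}. \<zero>\<^bsub>R\<^esub>)"
      using False by (intro Reg.M.finsum_cong') auto
    also have "\<dots> = \<zero>\<^bsub>R\<^esub>" using Reg.M.finsum_zero[of "{..<n}"] by simp
    also have "\<dots> = x j" using assms False by (simp add: free_module_def)
    finally show ?thesis .
  qed
  finally show "x j = ?s j" by simp
qed

end

definition free_comb :: "('a, 'm) module \<Rightarrow> nat \<Rightarrow> (nat \<Rightarrow> 'm) \<Rightarrow> (nat \<Rightarrow> 'a) \<Rightarrow> 'm" where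
  "free_comb M n a x = (\<Oplus>\<^bsub>M\<^esub>i\<in>{..<n}. x i \<odot>\<^bsub>M\<^esub> a i)"

lemma fg_module_free_cover:
  assumes "fg_module R M"
  shows "\<exists>n a. (\<forall>i<n. a i \<in> carrier M) \<and> free_comb M n a \<in> lmod_hom R (free_module R n) M \<and>
    free_comb M n a ` carrier (free_module R n) = carrier M"
proof -
  note M = fg_module_left_module[OF assms]
  note R = left_module_ring[OF M]
  obtain A where A: "finite A" "A \<subseteq> carrier M" "\<forall>H. submodule H R M \<longrightarrow> A \<subseteq> H \<longrightarrow> H = carrier M"
    by (rule fg_moduleE[OF assms])
  note A = A(1,2) A(3)[rule_format]
  obtain n and a :: "nat \<Rightarrow> _" where n: "A = a ` {i. i < n}"
    using finite_imp_nat_seg_image_inj_on[OF A(1)] by metis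
  have a: "\<And>i. i < n \<Longrightarrow> a i \<in> carrier M" using n A(2) by blast
  have hom: "free_comb M n a \<in> lmod_hom R (free_module R n) M"
    unfolding free_comb_def[abs_def] by (rule free_comb_hom[OF R M a])
  have "A \<subseteq> free_comb M n a ` carrier (free_module R n)"
  proof
    fix y assume "y \<in> A"
    then obtain j where "j < n" "y = a j" using n by blast
    then show "y \<in> free_comb M n a ` carrier (free_module R n)"
      using free_comb_unit[OF R M, of n a j] a unit_vector_closed[OF R, of j n]
      by (intro image_eqI[of _ _ "unit_vector R j"]) (simp_all add: free_comb_def)
  qed
  then have "free_comb M n a ` carrier (free_module R n) = carrier M"
    by (intro A(3) submodule_hom_image[OF left_module_free[OF R] M hom])
  with hom a show ?thesis by blast
qed

text \<open>An element of \<open>M\<close> is encoded as its fibre under a surjection \<open>R\<^sup>n \<rightarrow> M\<close>.\<close>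

lemma left_module_embed_univ:
  assumes "fg_module R (M :: ('a, 'm) module)"
  obtains M' :: "('a, 'a univ) module" and h where "left_module R M'" "h \<in> lmod_hom R M M'"
    "inj_on h (carrier M)" "h ` carrier M = carrier M'"
proof -
  note M = fg_module_left_module[OF assms]
  obtain n a where a: "\<forall>i<n. a i \<in> carrier M" "free_comb M n a \<in> lmod_hom R (free_module R n) M"
    "free_comb M n a ` carrier (free_module R n) = carrier M"
    using fg_module_free_cover[OF assms] by blast
  note a = a(1)[rule_format] a(3,2)
  define h where "h y = {x \<in> carrier (free_module R n). free_comb M n a x = y}" for y
  have "inj_on h (carrier M)"
  proof (rule inj_onI)
    fix y z assume yz: "y \<in> carrier M" "z \<in> carrier M" "h y = h z"
    then obtain x where "x \<in> carrier (free_module R n)" "y = free_comb M n a x"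
      using a(2) by blast
    then show "y = z" using yz(3) by (auto simp: h_def)
  qed
  note t = transport_module[OF M this]
  show thesis by (rule that[OF t(1,2) \<open>inj_on h (carrier M)\<close> t(3)])
qed

lemma fg_module_univ:
  assumes "fg_module R (M :: ('a, 'm) module)"
  obtains M' :: "('a, 'a univ) module" and h h' where "fg_module R M'" "left_module R M'"
    "h \<in> lmod_hom R M M'" "h' \<in> lmod_hom R M' M"
    "inj_on h (carrier M)" "h ` carrier M = carrier M'"
    "inj_on h' (carrier M')" "h' ` carrier M' = carrier M"
    "\<forall>x\<in>carrier M. h' (h x) = x" "\<forall>y\<in>carrier M'. h (h' y) = y"
proof -
  note M = fg_module_left_module[OF assms]
  obtain M' :: "('a, 'a univ) module" and h where h: "left_module R M'" "h \<in> lmod_hom R M M'"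
    "inj_on h (carrier M)" "h ` carrier M = carrier M'"
    by (rule left_module_embed_univ[OF assms])
  have iso: "lmod_iso R M M'" using h(2-4) by (rule lmod_isoI)
  obtain k k' where k: "k \<in> lmod_hom R M M'" "k' \<in> lmod_hom R M' M" "inj_on k (carrier M)"
    "k ` carrier M = carrier M'" "inj_on k' (carrier M')" "k' ` carrier M' = carrier M"
    "\<forall>x\<in>carrier M. k' (k x) = x" "\<forall>y\<in>carrier M'. k (k' y) = y"
    by (rule lmod_isoE[OF iso M])
  show thesis
    by (rule that[OF fg_module_image[OF assms h(1,2,4)] h(1) k])
qed

subsection \<open>Dual bases\<close>

text \<open>The finite dual basis criterion for projectivity: the \<open>\<phi> i\<close> are
  coordinate functionals for the generators \<open>p i\<close>. It quantifies over no other modules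
  and hence is bound to no element type, which makes it the working form of projectivity.\<close>

definition dual_basis ::
  "'a ring \<Rightarrow> ('a, 'm) module \<Rightarrow> nat \<Rightarrow> (nat \<Rightarrow> 'm) \<Rightarrow> (nat \<Rightarrow> 'm \<Rightarrow> 'a) \<Rightarrow> bool" where
  "dual_basis R P n p \<phi> \<longleftrightarrow>
     (\<forall>i<n. p i \<in> carrier P \<and> \<phi> i \<in> lmod_hom R P (regular_module R)) \<and>
     (\<forall>x\<in>carrier P. x = (\<Oplus>\<^bsub>P\<^esub>i\<in>{..<n}. \<phi> i x \<odot>\<^bsub>P\<^esub> p i))"

lemma dual_basis_comb_hom:
  fixes n :: nat
  assumes "left_module R P" "left_module R X" "\<And>i. i < n \<Longrightarrow> \<phi> i \<in> lmod_hom R P (regular_module R)"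
    "\<And>i. i < n \<Longrightarrow> a i \<in> carrier X"
  shows "(\<lambda>x. \<Oplus>\<^bsub>X\<^esub>i\<in>{..<n}. \<phi> i x \<odot>\<^bsub>X\<^esub> a i) \<in> lmod_hom R P X"
proof -
  interpret P: left_module R P by fact
  interpret X: left_module R X by fact
  let ?F = "free_module R n"
  have t: "(\<lambda>x i. if i < n then \<phi> i x else \<zero>\<^bsub>R\<^esub>) \<in> lmod_hom R P ?F"
    using lmod_homD[OF assms(3)] by (intro lmod_homI) (auto simp: free_module_def fun_eq_iff)
  have "(\<lambda>x. \<Oplus>\<^bsub>X\<^esub>i\<in>{..<n}. (if i < n then \<phi> i x else \<zero>\<^bsub>R\<^esub>) \<odot>\<^bsub>X\<^esub> a i) \<in> lmod_hom R P X"
    using lmod_hom_comp[OF t free_comb_hom[OF P.R.ring_axioms assms(2,4)]] by simp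
  moreover have "(\<Oplus>\<^bsub>X\<^esub>i\<in>{..<n}. \<phi> i x \<odot>\<^bsub>X\<^esub> a i) = (\<Oplus>\<^bsub>X\<^esub>i\<in>{..<n}. (if i < n then \<phi> i x else \<zero>\<^bsub>R\<^esub>) \<odot>\<^bsub>X\<^esub> a i)"
    if "x \<in> carrier P" for x
    using lmod_homD(1)[OF assms(3) that] assms(4) by (intro X.M.finsum_cong') (auto simp: X.smult_closed)
  ultimately show ?thesis by (rule lmod_hom_cong[OF assms(1)])
qed

lemma dual_basisD:
  assumes "dual_basis R P n p \<phi>"
  shows "\<And>i. i < n \<Longrightarrow> p i \<in> carrier P" "\<And>i. i < n \<Longrightarrow> \<phi> i \<in> lmod_hom R P (regular_module R)"
    "\<And>x. x \<in> carrier P \<Longrightarrow> x = (\<Oplus>\<^bsub>P\<^esub>i\<in>{..<n}. \<phi> i x \<odot>\<^bsub>P\<^esub> p i)"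
  using assms unfolding dual_basis_def by blast+

text \<open>Choose a preimage \<open>a i\<close> of each \<open>h (p i)\<close> and extend by the
  coordinates. \<open>X\<close> and \<open>Y\<close> may have any element type, and \<open>h\<close>
  need only land in the image of \<open>g\<close>, which is the form that lifting into exact
  complexes calls for.\<close>

lemma dual_basis_lift:
  assumes lm: "left_module R P" and db: "dual_basis R P n p \<phi>" and XY: "left_module R X" "left_module R Y"
    and g: "g \<in> lmod_hom R X Y" and h: "h \<in> lmod_hom R P Y"
    and im: "\<And>x. x \<in> carrier P \<Longrightarrow> h x \<in> g ` carrier X"
  shows "\<exists>l\<in>lmod_hom R P X. \<forall>x\<in>carrier P. g (l x) = h x"
proof -
  note d = dual_basisD[OF db]
  interpret P: left_module R P by fact
  interpret Y: left_module R Y by fact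
  interpret X: left_module R X by fact
  have "\<exists>y\<in>carrier X. g y = h (p i)" if "i < n" for i
    using im[OF d(1)[OF that]] by (metis imageE)
  then obtain a where a: "\<And>i. i < n \<Longrightarrow> a i \<in> carrier X" "\<And>i. i < n \<Longrightarrow> g (a i) = h (p i)" by metis
  let ?l = "\<lambda>x. \<Oplus>\<^bsub>X\<^esub>i\<in>{..<n}. \<phi> i x \<odot>\<^bsub>X\<^esub> a i"
  have "g (?l x) = h x" if x: "x \<in> carrier P" for x
  proof -
    have c: "\<phi> i x \<in> carrier R" if "i < n" for i using lmod_homD(1)[OF d(2)[OF that] x] by simp
    have "g (?l x) = (\<Oplus>\<^bsub>Y\<^esub>i\<in>{..<n}. g (\<phi> i x \<odot>\<^bsub>X\<^esub> a i))"
      using a c by (intro lmod_hom_finsum[OF XY g(1)]) (auto intro!: X.smult_closed)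
    also have "\<dots> = (\<Oplus>\<^bsub>Y\<^esub>i\<in>{..<n}. h (\<phi> i x \<odot>\<^bsub>P\<^esub> p i))"
      using a c d(1) lmod_homD[OF h]
      by (intro Y.M.finsum_cong') (auto simp: lmod_homD[OF g(1)] intro!: P.smult_closed Y.smult_closed)
    also have "\<dots> = h (\<Oplus>\<^bsub>P\<^esub>i\<in>{..<n}. \<phi> i x \<odot>\<^bsub>P\<^esub> p i)"
      using c d(1) by (intro lmod_hom_finsum[OF lm XY(2) h, symmetric]) (auto intro!: P.smult_closed)
    also have "\<dots> = h x" by (rule arg_cong[OF d(3)[OF x], of h, symmetric])
    finally show ?thesis .
  qed
  then show ?thesis
    by (intro bexI[of _ ?l] ballI dual_basis_comb_hom[OF lm XY(1) d(2) a(1)])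
qed

text \<open>The definition tests lifting only on modules in the universe. One such test suffices:
  the isomorphism of \<open>P\<close> with its copy \<open>Y\<close> is lifted through a copy of a
  free cover. The coordinates of the lift are the functionals of the dual basis.\<close>

lemma fg_projective_iff_dual_basis:
  "fg_projective R (P :: ('a, 'p) module) \<longleftrightarrow> left_module R P \<and> (\<exists>n p \<phi>. dual_basis R P n p \<phi>)"
proof
  assume P: "fg_projective R P"
  then have fg: "fg_module R P" and lm: "left_module R P"
    unfolding fg_projective_def fg_module_def by blast+
  note R = left_module_ring[OF lm]
  obtain Y :: "('a, 'a univ) module" and h where h: "left_module R Y" "h \<in> lmod_hom R P Y"
    "inj_on h (carrier P)" "h ` carrier P = carrier Y"
    by (rule left_module_embed_univ[OF fg])
  obtain n a where a: "\<forall>i<n. a i \<in> carrier P" "free_comb P n a \<in> lmod_hom R (free_module R n) P"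
    "free_comb P n a ` carrier (free_module R n) = carrier P"
    using fg_module_free_cover[OF fg] by blast
  note a = a(1)[rule_format] a(3,2)
  define \<pi> where "\<pi> = free_comb P n a"
  note \<pi> = a(3)[folded \<pi>_def]
  \<comment> \<open>The universe consists of sets of sequences, so the free module enters it through
    singletons.\<close>
  define F :: "('a, 'a univ) module" where "F = transport_module (\<lambda>x. {x}) (free_module R n)"
  have single: "inj_on (\<lambda>x. {x}) (carrier (free_module R n))" by simp
  note F = transport_module[OF left_module_free[OF R] single, folded F_def]
  have iso: "lmod_iso R F (free_module R n)"
    using F(2,3) single by (intro lmod_iso_sym[OF lmod_isoI] left_module_free[OF R])
  obtain \<rho> where \<rho>: "\<rho> \<in> lmod_hom R F (free_module R n)" "\<rho> ` carrier F = carrier (free_module R n)"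
    by (rule lmod_isoE[OF iso F(1)])
  have "\<exists>l\<in>lmod_hom R P F. \<forall>x\<in>carrier P. (\<lambda>x. h (\<pi> (\<rho> x))) (l x) = h x"
  proof -
    have "(\<lambda>x. h (\<pi> (\<rho> x))) \<in> lmod_hom R F Y"
      using lmod_hom_comp[OF lmod_hom_comp[OF \<rho>(1) \<pi>] h(2)] .
    moreover have "(\<lambda>x. h (\<pi> (\<rho> x))) ` carrier F = carrier Y"
      using h(4) a(2)[folded \<pi>_def] \<rho>(2) by (metis image_image)
    moreover note F(1)
    ultimately show ?thesis
      using P[unfolded fg_projective_def, THEN conjunct2, rule_format, of F Y] h(1,2) by blast
  qed
  then obtain l where l: "l \<in> lmod_hom R P F" "\<And>x. x \<in> carrier P \<Longrightarrow> h (\<pi> (\<rho> (l x))) = h x" by blast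
  have "dual_basis R P n a (\<lambda>i x. \<rho> (l x) i)"
    unfolding dual_basis_def
  proof (intro conjI allI impI ballI)
    fix i assume "i < n"
    show "(\<lambda>x. \<rho> (l x) i) \<in> lmod_hom R P (regular_module R)"
      using lmod_hom_comp[OF lmod_hom_comp[OF l(1) \<rho>(1)] coord_hom[OF R]] .
  next
    fix x assume x: "x \<in> carrier P"
    have "\<pi> (\<rho> (l x)) \<in> carrier P"
      using lmod_homD(1)[OF \<pi>] lmod_homD(1)[OF \<rho>(1)] lmod_homD(1)[OF l(1)] x by blast
    then show "x = (\<Oplus>\<^bsub>P\<^esub>i\<in>{..<n}. \<rho> (l x) i \<odot>\<^bsub>P\<^esub> a i)"
      using l(2)[OF x] h(3) x by (simp add: \<pi>_def free_comb_def inj_on_eq_iff)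
  qed (rule a)
  then show "left_module R P \<and> (\<exists>n p \<phi>. dual_basis R P n p \<phi>)" using lm by blast
next
  assume "left_module R P \<and> (\<exists>n p \<phi>. dual_basis R P n p \<phi>)"
  then obtain n p \<phi> where lm: "left_module R P" and db: "dual_basis R P n p \<phi>" by blast
  note d = dual_basisD[OF db]
  interpret P: left_module R P by fact
  have "fg_module R P"
  proof -
    have "H = carrier P" if H: "submodule H R P" "p ` {..<n} \<subseteq> H" for H
    proof -
      note HD = P.submoduleD[OF H(1)]
      have "(\<Oplus>\<^bsub>P\<^esub>i\<in>J. \<phi> i x \<odot>\<^bsub>P\<^esub> p i) \<in> H" if "finite J" "J \<subseteq> {..<n}" "x \<in> carrier P" for x J
        using that
      proof (induction J rule: finite_induct)
        case (insert j J)
        have "\<phi> j x \<odot>\<^bsub>P\<^esub> p j \<in> H"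
          using HD(4) lmod_homD(1)[OF d(2)] insert.prems H(2) by auto
        moreover have "(\<lambda>i. \<phi> i x \<odot>\<^bsub>P\<^esub> p i) \<in> insert j J \<rightarrow> carrier P"
          using lmod_homD(1)[OF d(2)] insert.prems d(1) by (auto intro!: P.smult_closed)
        ultimately show ?case using insert HD(3) by (simp add: Pi_def)
      qed (simp add: HD)
      from this[OF finite_lessThan subset_refl] have "carrier P \<subseteq> H"
        using d(3) by (intro subsetI) metis
      then show ?thesis using HD(1) by (intro subset_antisym)
    qed
    then show ?thesis
      using d(1) by (intro fg_moduleI[OF lm, of "p ` {..<n}"]) blast+
  qed
  then show "fg_projective R P"
    unfolding fg_projective_def
  proof (intro conjI allI impI)
    fix X Y :: "('a, 'a univ) module" and g h
    assume *: "left_module R X \<and> left_module R Y \<and> g \<in> lmod_hom R X Y \<and>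
      g ` carrier X = carrier Y \<and> h \<in> lmod_hom R P Y"
    then have "left_module R X" "left_module R Y" "g \<in> lmod_hom R X Y" "h \<in> lmod_hom R P Y"
      by simp_all
    moreover have "h x \<in> g ` carrier X" if "x \<in> carrier P" for x
      using * lmod_homD(1)[of h R P Y, OF _ that] by simp
    ultimately show "\<exists>l\<in>lmod_hom R P X. \<forall>x\<in>carrier P. g (l x) = h x"
      by (rule dual_basis_lift[OF lm db])
  qed
qed

lemma fg_projective_left_module: "fg_projective R P \<Longrightarrow> left_module R P"
  by (simp add: fg_projective_iff_dual_basis)

lemma fg_projective_fg: "fg_projective R P \<Longrightarrow> fg_module R P"
  by (simp add: fg_projective_def)

lemma fg_projective_lift:
  assumes "fg_projective R P" "left_module R X" "left_module R Y"
    and g: "g \<in> lmod_hom R X Y" and h: "h \<in> lmod_hom R P Y"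
    and im: "\<And>x. x \<in> carrier P \<Longrightarrow> h x \<in> g ` carrier X"
  shows "\<exists>l\<in>lmod_hom R P X. \<forall>x\<in>carrier P. g (l x) = h x"
proof -
  obtain n p \<phi> where lm: "left_module R P" and db: "dual_basis R P n p \<phi>"
    using assms(1) unfolding fg_projective_iff_dual_basis by blast
  show ?thesis by (rule dual_basis_lift[OF lm db assms(2-)])
qed

text \<open>Basis elements are pushed forward along \<open>h\<close> and functionals pulled back
  along \<open>h'\<close>. This is the statement that a retract of a projective is
  projective.\<close>

lemma fg_projective_transfer:
  assumes "fg_projective R P" "left_module R Q" "h \<in> lmod_hom R P Q" "h' \<in> lmod_hom R Q P"
    "\<And>y. y \<in> carrier Q \<Longrightarrow> h (h' y) = y"
  shows "fg_projective R Q"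
proof -
  obtain n p \<phi> where lm: "left_module R P" and db: "dual_basis R P n p \<phi>"
    using assms(1) unfolding fg_projective_iff_dual_basis by blast
  note d = dual_basisD[OF db]
  interpret P: left_module R P by fact
  interpret Q: left_module R Q by fact
  have "dual_basis R Q n (\<lambda>i. h (p i)) (\<lambda>i x. \<phi> i (h' x))"
    unfolding dual_basis_def
  proof (intro conjI allI impI ballI)
    fix i assume i: "i < n"
    show "h (p i) \<in> carrier Q" using lmod_homD(1)[OF assms(3)] d(1)[OF i] .
    show "(\<lambda>x. \<phi> i (h' x)) \<in> lmod_hom R Q (regular_module R)"
      using lmod_hom_comp[OF assms(4) d(2)[OF i]] .
  next
    fix y assume y: "y \<in> carrier Q"
    then have x: "h' y \<in> carrier P" using lmod_homD(1)[OF assms(4)] by blast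
    have c: "\<phi> i (h' y) \<in> carrier R" if "i < n" for i using lmod_homD(1)[OF d(2)[OF that] x] by simp
    have "y = h (\<Oplus>\<^bsub>P\<^esub>i\<in>{..<n}. \<phi> i (h' y) \<odot>\<^bsub>P\<^esub> p i)"
      by (rule trans[OF assms(5)[OF y, symmetric] arg_cong[OF d(3)[OF x], of h]])
    also have "\<dots> = (\<Oplus>\<^bsub>Q\<^esub>i\<in>{..<n}. h (\<phi> i (h' y) \<odot>\<^bsub>P\<^esub> p i))"
      using c d(1) by (intro lmod_hom_finsum[OF lm assms(2,3)]) (auto intro!: P.smult_closed)
    also have "\<dots> = (\<Oplus>\<^bsub>Q\<^esub>i\<in>{..<n}. \<phi> i (h' y) \<odot>\<^bsub>Q\<^esub> h (p i))"
      using c d(1) lmod_homD[OF assms(3)] by (intro Q.M.finsum_cong') (auto intro!: Q.smult_closed)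
    finally show "y = (\<Oplus>\<^bsub>Q\<^esub>i\<in>{..<n}. \<phi> i (h' y) \<odot>\<^bsub>Q\<^esub> h (p i))" .
  qed
  then show ?thesis using assms(2) by (auto simp: fg_projective_iff_dual_basis)
qed

lemma fg_projective_free:
  assumes "ring R" shows "fg_projective R (free_module R n)"
  unfolding fg_projective_iff_dual_basis dual_basis_def
  using left_module_free[OF assms] free_module_expand[OF assms, of _ n] unit_vector_closed[OF assms] coord_hom[OF assms]
  by (intro conjI exI[of _ n] exI[of _ "unit_vector R"] exI[of _ "\<lambda>i x. x i"] allI impI ballI)

lemma fg_projective_univ:
  assumes "fg_projective R (P :: ('a, 'p) module)"
  obtains P' :: "('a, 'a univ) module" and h h' where "fg_projective R P'"
    "h \<in> lmod_hom R P P'" "h' \<in> lmod_hom R P' P"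
    "inj_on h (carrier P)" "h ` carrier P = carrier P'"
    "inj_on h' (carrier P')" "h' ` carrier P' = carrier P"
    "\<forall>x\<in>carrier P. h' (h x) = x" "\<forall>y\<in>carrier P'. h (h' y) = y"
proof -
  obtain P' :: "('a, 'a univ) module" and k k' where k: "fg_module R P'" "left_module R P'"
    "k \<in> lmod_hom R P P'" "k' \<in> lmod_hom R P' P" "inj_on k (carrier P)"
    "k ` carrier P = carrier P'" "inj_on k' (carrier P')" "k' ` carrier P' = carrier P"
    "\<forall>x\<in>carrier P. k' (k x) = x" "\<forall>y\<in>carrier P'. k (k' y) = y"
    by (rule fg_module_univ[OF fg_projective_fg[OF assms]])
  have "fg_projective R P'"
    using fg_projective_transfer[OF assms k(2,3,4)] k(10) by blast
  then show thesis by (rule that[OF _ k(3-10)])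
qed

lemma fg_module_projective_cover:
  assumes "fg_module R (M :: ('a, 'm) module)"
  obtains P :: "('a, 'a univ) module" and h where "fg_projective R P" "h \<in> lmod_hom R P M"
    "h ` carrier P = carrier M"
proof -
  note M = fg_module_left_module[OF assms]
  note R = left_module_ring[OF M]
  obtain n a where a: "\<forall>i<n. a i \<in> carrier M" "free_comb M n a \<in> lmod_hom R (free_module R n) M"
    "free_comb M n a ` carrier (free_module R n) = carrier M"
    using fg_module_free_cover[OF assms] by blast
  note a = a(1)[rule_format] a(3,2)
  obtain P :: "('a, 'a univ) module" and h where h: "fg_projective R P"
    "h \<in> lmod_hom R P (free_module R n)" "h ` carrier P = carrier (free_module R n)"
    by (rule fg_projective_univ[OF fg_projective_free[OF R, of n]])
  show thesis
  proof (rule that[OF h(1)])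
    show "(\<lambda>x. free_comb M n a (h x)) \<in> lmod_hom R P M"
      using lmod_hom_comp[OF h(2) a(3)] .
    show "(\<lambda>x. free_comb M n a (h x)) ` carrier P = carrier M"
      using a(2) h(3) by (simp add: image_image[of "free_comb M n a" h, symmetric])
  qed
qed

text \<open>The elements \<open>x\<close> with \<open>(x, 0)\<close> in a given submodule form a
  submodule of \<open>M\<close>, and likewise for \<open>N\<close>. If the generators of both
  factors are present, both are everything, and sums give the whole direct sum.\<close>

lemma fg_module_direct_sum:
  assumes "fg_module R M" "fg_module R N" shows "fg_module R (direct_sum M N)"
proof -
  note M = fg_module_left_module[OF assms(1)] and N = fg_module_left_module[OF assms(2)]
  interpret M: left_module R M by fact
  interpret N: left_module R N by fact
  note D = left_module_direct_sum[OF M N]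
  interpret D: left_module R "direct_sum M N" by (rule D)
  obtain A where A: "finite A" "A \<subseteq> carrier M" "\<forall>H. submodule H R M \<longrightarrow> A \<subseteq> H \<longrightarrow> H = carrier M"
    by (rule fg_moduleE[OF assms(1)])
  note A = A(1,2) A(3)[rule_format]
  obtain B where B: "finite B" "B \<subseteq> carrier N" "\<forall>H. submodule H R N \<longrightarrow> B \<subseteq> H \<longrightarrow> H = carrier N"
    by (rule fg_moduleE[OF assms(2)])
  note B = B(1,2) B(3)[rule_format]
  let ?C = "(\<lambda>x. (x, \<zero>\<^bsub>N\<^esub>)) ` A \<union> (\<lambda>y. (\<zero>\<^bsub>M\<^esub>, y)) ` B"
  have "H = carrier (direct_sum M N)" if H: "submodule H R (direct_sum M N)" "?C \<subseteq> H" for H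
  proof -
    note HD = D.submoduleD(1-4)[OF H(1), simplified]
    have "submodule {x \<in> carrier M. (x, \<zero>\<^bsub>N\<^esub>) \<in> H} R M"
    proof (rule M.submoduleI)
      show "x \<oplus>\<^bsub>M\<^esub> y \<in> {x \<in> carrier M. (x, \<zero>\<^bsub>N\<^esub>) \<in> H}" if "x \<in> {x \<in> carrier M. (x, \<zero>\<^bsub>N\<^esub>) \<in> H}"
        "y \<in> {x \<in> carrier M. (x, \<zero>\<^bsub>N\<^esub>) \<in> H}" for x y
        using HD(3)[of "(x, \<zero>\<^bsub>N\<^esub>)" "(y, \<zero>\<^bsub>N\<^esub>)"] that by auto
      show "a \<odot>\<^bsub>M\<^esub> x \<in> {x \<in> carrier M. (x, \<zero>\<^bsub>N\<^esub>) \<in> H}" if "a \<in> carrier R" "x \<in> {x \<in> carrier M. (x, \<zero>\<^bsub>N\<^esub>) \<in> H}" for a x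
        using HD(4)[of a "(x, \<zero>\<^bsub>N\<^esub>)"] that by (auto simp: N.smult_r_null M.smult_closed)
    qed (use HD(2) in auto)
    moreover have "A \<subseteq> {x \<in> carrier M. (x, \<zero>\<^bsub>N\<^esub>) \<in> H}" using A(2) H(2) by auto
    ultimately have "{x \<in> carrier M. (x, \<zero>\<^bsub>N\<^esub>) \<in> H} = carrier M" by (rule A(3))
    then have 1: "\<And>x. x \<in> carrier M \<Longrightarrow> (x, \<zero>\<^bsub>N\<^esub>) \<in> H" by auto
    have "submodule {x \<in> carrier N. (\<zero>\<^bsub>M\<^esub>, x) \<in> H} R N"
    proof (rule N.submoduleI)
      show "x \<oplus>\<^bsub>N\<^esub> y \<in> {x \<in> carrier N. (\<zero>\<^bsub>M\<^esub>, x) \<in> H}" if "x \<in> {x \<in> carrier N. (\<zero>\<^bsub>M\<^esub>, x) \<in> H}"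
        "y \<in> {x \<in> carrier N. (\<zero>\<^bsub>M\<^esub>, x) \<in> H}" for x y
        using HD(3)[of "(\<zero>\<^bsub>M\<^esub>, x)" "(\<zero>\<^bsub>M\<^esub>, y)"] that by auto
      show "a \<odot>\<^bsub>N\<^esub> x \<in> {x \<in> carrier N. (\<zero>\<^bsub>M\<^esub>, x) \<in> H}" if "a \<in> carrier R" "x \<in> {x \<in> carrier N. (\<zero>\<^bsub>M\<^esub>, x) \<in> H}" for a x
        using HD(4)[of a "(\<zero>\<^bsub>M\<^esub>, x)"] that by (auto simp: M.smult_r_null N.smult_closed)
    qed (use HD(2) in auto)
    moreover have "B \<subseteq> {x \<in> carrier N. (\<zero>\<^bsub>M\<^esub>, x) \<in> H}" using B(2) H(2) by auto
    ultimately have "{x \<in> carrier N. (\<zero>\<^bsub>M\<^esub>, x) \<in> H} = carrier N" by (rule B(3))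
    then have 2: "\<And>x. x \<in> carrier N \<Longrightarrow> (\<zero>\<^bsub>M\<^esub>, x) \<in> H" by auto
    have "(x, y) \<in> H" if "x \<in> carrier M" "y \<in> carrier N" for x y
      using HD(3)[OF 1[OF that(1)] 2[OF that(2)]] that by simp
    then show ?thesis using HD(1) by auto
  qed
  moreover have "?C \<subseteq> carrier (direct_sum M N)" using A(2) B(2) by auto
  ultimately show ?thesis
    using A(1) B(1) by (intro fg_moduleI[OF D, of ?C]) simp_all
qed

lemma fg_projective_direct_sum:
  assumes "fg_projective R P" "fg_projective R Q"
  shows "fg_projective R (direct_sum P Q)"
  unfolding fg_projective_def
proof (intro conjI allI impI)
  show "fg_module R (direct_sum P Q)"
    by (intro fg_module_direct_sum fg_projective_fg assms)
  fix X Y :: "('a, 'a univ) module" and g h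
  assume a: "left_module R X \<and> left_module R Y \<and>
        g \<in> lmod_hom R X Y \<and> g ` carrier X = carrier Y \<and> h \<in> lmod_hom R (direct_sum P Q) Y"
  then have XY: "left_module R X" "left_module R Y" and g: "g \<in> lmod_hom R X Y" "g ` carrier X = carrier Y"
    and h: "h \<in> lmod_hom R (direct_sum P Q) Y" by auto
  note P = fg_projective_left_module[OF assms(1)] and Q = fg_projective_left_module[OF assms(2)]
  interpret P: left_module R P by fact
  interpret Q: left_module R Q by fact
  note inj = direct_sum_injections[OF P Q]
  have 1: "(\<lambda>x. h (x, \<zero>\<^bsub>Q\<^esub>)) \<in> lmod_hom R P Y" "(\<lambda>y. h (\<zero>\<^bsub>P\<^esub>, y)) \<in> lmod_hom R Q Y"
    using lmod_hom_comp[OF inj(1) h] lmod_hom_comp[OF inj(2) h] .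
  obtain l1 where l1: "l1 \<in> lmod_hom R P X" "\<And>x. x \<in> carrier P \<Longrightarrow> g (l1 x) = h (x, \<zero>\<^bsub>Q\<^esub>)"
    using fg_projective_lift[OF assms(1) XY g(1) 1(1)] lmod_homD(1)[OF 1(1)] unfolding g(2) by blast
  obtain l2 where l2: "l2 \<in> lmod_hom R Q X" "\<And>x. x \<in> carrier Q \<Longrightarrow> g (l2 x) = h (\<zero>\<^bsub>P\<^esub>, x)"
    using fg_projective_lift[OF assms(2) XY g(1) 1(2)] lmod_homD(1)[OF 1(2)] unfolding g(2) by blast
  have "(\<lambda>z. l1 (fst z) \<oplus>\<^bsub>X\<^esub> l2 (snd z)) \<in> lmod_hom R (direct_sum P Q) X"
    by (intro lmod_hom_plus left_module_direct_sum P Q XY lmod_hom_comp[OF direct_sum_homs(1) l1(1)]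
        lmod_hom_comp[OF direct_sum_homs(2) l2(1)])
  moreover have "g (l1 (fst z) \<oplus>\<^bsub>X\<^esub> l2 (snd z)) = h z" if z: "z \<in> carrier (direct_sum P Q)" for z
  proof -
    obtain x y where xy: "z = (x, y)" "x \<in> carrier P" "y \<in> carrier Q" using z by auto
    have "g (l1 x \<oplus>\<^bsub>X\<^esub> l2 y) = h (x, \<zero>\<^bsub>Q\<^esub>) \<oplus>\<^bsub>Y\<^esub> h (\<zero>\<^bsub>P\<^esub>, y)"
      using xy l1(2) l2(2) lmod_homD(2)[OF g(1)] lmod_homD(1)[OF l1(1)] lmod_homD(1)[OF l2(1)] by simp
    also have "\<dots> = h z"
      using lmod_homD(2)[OF h, of "(x, \<zero>\<^bsub>Q\<^esub>)" "(\<zero>\<^bsub>P\<^esub>, y)"] xy by simp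
    finally show ?thesis using xy by simp
  qed
  ultimately show "\<exists>l\<in>lmod_hom R (direct_sum P Q) X. \<forall>x\<in>carrier (direct_sum P Q). g (l x) = h x"
    by (intro bexI[of _ "\<lambda>z. l1 (fst z) \<oplus>\<^bsub>X\<^esub> l2 (snd z)"]) auto
qed

section \<open>Duality\<close>

lemma op_ring_simps [simp]:
  "carrier (op_ring R) = carrier R" "zero (op_ring R) = zero R" "one (op_ring R) = one R"
  "add (op_ring R) = add R" "mult (op_ring R) x y = mult R y x"
  by (simp_all add: op_ring_def)

lemma op_ring_op_ring [simp]: "op_ring (op_ring R) = R"
  by (simp add: op_ring_def)

lemma ring_op_ring:
  assumes "ring R" shows "ring (op_ring R)"
proof -
  interpret R: ring R by fact
  have "abelian_group (op_ring R)"
    by (rule abelian_groupI) (auto simp: R.a_ac intro: R.add.l_inv_ex)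
  moreover have "monoid (op_ring R)"
    by (rule monoidI) (auto simp: R.m_assoc)
  ultimately show ?thesis
    by (rule ringI) (auto simp: R.l_distr R.r_distr)
qed

lemma dual_module_simps [simp]:
  "zero (dual_module R M) = (\<lambda>x\<in>carrier M. \<zero>\<^bsub>R\<^esub>)"
  "add (dual_module R M) f g = (\<lambda>x\<in>carrier M. f x \<oplus>\<^bsub>R\<^esub> g x)"
  "smult (dual_module R M) a f = (\<lambda>x\<in>carrier M. f x \<otimes>\<^bsub>R\<^esub> a)"
  by (simp_all add: dual_module_def)

lemma dual_carrier_iff:
  "\<phi> \<in> carrier (dual_module R M) \<longleftrightarrow>
     \<phi> \<in> lmod_hom R M (regular_module R) \<and> \<phi> \<in> extensional (carrier M)"
  by (simp add: dual_module_def)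

lemma dualD:
  assumes "\<phi> \<in> carrier (dual_module R M)"
  shows "\<phi> \<in> lmod_hom R M (regular_module R)" "\<phi> \<in> extensional (carrier M)"
    "\<And>x. x \<in> carrier M \<Longrightarrow> \<phi> x \<in> carrier R"
  using assms lmod_homD(1)[of \<phi> R M "regular_module R"] by (auto simp: dual_carrier_iff)

lemma dual_eqI:
  assumes "\<phi> \<in> extensional (carrier M)" "\<psi> \<in> extensional (carrier M)"
    "\<And>x. x \<in> carrier M \<Longrightarrow> \<phi> x = \<psi> x"
  shows "\<phi> = \<psi>"
  using assms by (rule extensionalityI)

lemma restrict_dual:
  assumes "left_module R M" "\<phi> \<in> lmod_hom R M (regular_module R)"
  shows "restrict \<phi> (carrier M) \<in> carrier (dual_module R M)"
  unfolding dual_carrier_iff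
  by (intro conjI lmod_hom_cong[OF assms] restrict_extensional) simp

lemma left_module_dual:
  assumes "left_module R M"
  shows "left_module (op_ring R) (dual_module R M)"
proof -
  interpret M: left_module R M by fact
  note reg = left_module_regular[OF M.R.ring_axioms]
  note D = dualD(1,2)
  have cl: "f x \<in> carrier R" if "f \<in> carrier (dual_module R M)" "x \<in> carrier M" for f x
    using dualD(3)[OF that] .
  show ?thesis
  proof (rule left_moduleI)
    show "ring (op_ring R)" by (rule ring_op_ring[OF M.R.ring_axioms])
    show "f \<oplus>\<^bsub>dual_module R M\<^esub> g \<in> carrier (dual_module R M)"
      if "f \<in> carrier (dual_module R M)" "g \<in> carrier (dual_module R M)" for f g
      using restrict_dual[OF assms lmod_hom_plus[OF assms reg D(1)[OF that(1)] D(1)[OF that(2)]]] by simp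
    show "\<zero>\<^bsub>dual_module R M\<^esub> \<in> carrier (dual_module R M)"
      using restrict_dual[OF assms lmod_hom_const_zero[OF reg]] by simp
    show "a \<odot>\<^bsub>dual_module R M\<^esub> f \<in> carrier (dual_module R M)"
      if a: "a \<in> carrier (op_ring R)" and f: "f \<in> carrier (dual_module R M)" for a f
    proof -
      have "(\<lambda>x. f x \<otimes>\<^bsub>R\<^esub> a) \<in> lmod_hom R M (regular_module R)"
        using a lmod_homD[OF D(1)[OF f]]
        by (intro lmod_homI) (simp_all add: M.R.l_distr M.R.m_assoc)
      from restrict_dual[OF assms this] show ?thesis by simp
    qed
    show "(f \<oplus>\<^bsub>dual_module R M\<^esub> g) \<oplus>\<^bsub>dual_module R M\<^esub> h = f \<oplus>\<^bsub>dual_module R M\<^esub> (g \<oplus>\<^bsub>dual_module R M\<^esub> h)"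
      if "f \<in> carrier (dual_module R M)" "g \<in> carrier (dual_module R M)" "h \<in> carrier (dual_module R M)" for f g h
      unfolding dual_module_simps
      by (intro restrict_ext) (simp add: cl[OF that(1)] cl[OF that(2)] cl[OF that(3)] M.R.a_assoc)
    show "f \<oplus>\<^bsub>dual_module R M\<^esub> g = g \<oplus>\<^bsub>dual_module R M\<^esub> f"
      if "f \<in> carrier (dual_module R M)" "g \<in> carrier (dual_module R M)" for f g
      unfolding dual_module_simps
      by (intro restrict_ext) (simp add: cl[OF that(1)] cl[OF that(2)] M.R.a_comm)
    show "\<zero>\<^bsub>dual_module R M\<^esub> \<oplus>\<^bsub>dual_module R M\<^esub> f = f" if "f \<in> carrier (dual_module R M)" for f
      using D(2)[OF that] cl[OF that] by (intro dual_eqI[of _ M]) simp_all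
    show "(a \<oplus>\<^bsub>op_ring R\<^esub> b) \<odot>\<^bsub>dual_module R M\<^esub> f = a \<odot>\<^bsub>dual_module R M\<^esub> f \<oplus>\<^bsub>dual_module R M\<^esub> b \<odot>\<^bsub>dual_module R M\<^esub> f"
      if "a \<in> carrier (op_ring R)" "b \<in> carrier (op_ring R)" "f \<in> carrier (dual_module R M)" for a b f
      unfolding dual_module_simps using that(1,2)
      by (intro restrict_ext) (simp add: cl[OF that(3)] M.R.r_distr)
    show "a \<odot>\<^bsub>dual_module R M\<^esub> (f \<oplus>\<^bsub>dual_module R M\<^esub> g) = a \<odot>\<^bsub>dual_module R M\<^esub> f \<oplus>\<^bsub>dual_module R M\<^esub> a \<odot>\<^bsub>dual_module R M\<^esub> g"
      if "a \<in> carrier (op_ring R)" "f \<in> carrier (dual_module R M)" "g \<in> carrier (dual_module R M)" for a f g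
      unfolding dual_module_simps using that(1)
      by (intro restrict_ext) (simp add: cl[OF that(2)] cl[OF that(3)] M.R.l_distr)
    show "(a \<otimes>\<^bsub>op_ring R\<^esub> b) \<odot>\<^bsub>dual_module R M\<^esub> f = a \<odot>\<^bsub>dual_module R M\<^esub> (b \<odot>\<^bsub>dual_module R M\<^esub> f)"
      if "a \<in> carrier (op_ring R)" "b \<in> carrier (op_ring R)" "f \<in> carrier (dual_module R M)" for a b f
      unfolding dual_module_simps using that(1,2)
      by (intro restrict_ext) (simp add: cl[OF that(3)] M.R.m_assoc)
    show "\<one>\<^bsub>op_ring R\<^esub> \<odot>\<^bsub>dual_module R M\<^esub> f = f" if "f \<in> carrier (dual_module R M)" for f
      using D(2)[OF that] cl[OF that] by (intro dual_eqI[of _ M]) simp_all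
    show "\<zero>\<^bsub>op_ring R\<^esub> \<odot>\<^bsub>dual_module R M\<^esub> f = \<zero>\<^bsub>dual_module R M\<^esub>" if "f \<in> carrier (dual_module R M)" for f
      unfolding dual_module_simps
      by (intro restrict_ext) (simp add: cl[OF that])
  qed
qed

text \<open>Evaluations are the elements of the bidual that come from \<open>M\<close>. They also
  allow finite sums and differences in a dual module to be computed pointwise.\<close>

lemma dual_eval_hom:
  assumes "x \<in> carrier M"
  shows "(\<lambda>\<phi>. \<phi> x) \<in> lmod_hom (op_ring R) (dual_module R M) (regular_module (op_ring R))"
  using assms by (intro lmod_homI) (simp_all add: dualD(3))

lemma dual_map_apply [simp]: "x \<in> carrier M \<Longrightarrow> dual_map M f \<phi> x = \<phi> (f x)"
  by (simp add: dual_map_def)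

lemma dual_map_extensional [simp]: "dual_map M f \<phi> \<in> extensional (carrier M)"
  by (simp add: dual_map_def)

lemma dual_map_hom:
  assumes "left_module R M" "left_module R N" "f \<in> lmod_hom R M N"
  shows "dual_map M f \<in> lmod_hom (op_ring R) (dual_module R N) (dual_module R M)"
proof (rule lmod_homI)
  interpret M: left_module R M by fact
  interpret N: left_module R N by fact
  note f = lmod_homD[OF assms(3)]
  fix \<phi> assume \<phi>: "\<phi> \<in> carrier (dual_module R N)"
  show "dual_map M f \<phi> \<in> carrier (dual_module R M)"
    unfolding dual_map_def
    by (rule restrict_dual[OF assms(1) lmod_hom_comp[OF assms(3) dualD(1)[OF \<phi>]]])
  show "dual_map M f (\<phi> \<oplus>\<^bsub>dual_module R N\<^esub> \<psi>) = dual_map M f \<phi> \<oplus>\<^bsub>dual_module R M\<^esub> dual_map M f \<psi>" for \<psi>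
    by (rule dual_eqI[of _ M]) (simp_all add: f)
  show "dual_map M f (a \<odot>\<^bsub>dual_module R N\<^esub> \<phi>) = a \<odot>\<^bsub>dual_module R M\<^esub> dual_map M f \<phi>" for a
    by (rule dual_eqI[of _ M]) (simp_all add: f)
qed

section \<open>Dualizing short exact sequences\<close>

definition extends_along :: "'a ring \<Rightarrow> ('a, 'l) module \<Rightarrow> ('a, 'm) module \<Rightarrow> ('l \<Rightarrow> 'm) \<Rightarrow> bool" where
  "extends_along R L M f \<longleftrightarrow> (\<forall>\<phi>\<in>lmod_hom R L (regular_module R).
     \<exists>\<psi>\<in>lmod_hom R M (regular_module R). \<forall>x\<in>carrier L. \<phi> x = \<psi> (f x))"

lemma short_exactD:
  assumes "short_exact R L M N f g"
  shows "left_module R L" "left_module R M" "left_module R N"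
    "f \<in> lmod_hom R L M" "g \<in> lmod_hom R M N" "inj_on f (carrier L)"
    "f ` carrier L = a_kernel M N g" "g ` carrier M = carrier N"
    "\<And>x. x \<in> carrier L \<Longrightarrow> g (f x) = \<zero>\<^bsub>N\<^esub>"
    "\<And>y. y \<in> carrier M \<Longrightarrow> g y = \<zero>\<^bsub>N\<^esub> \<Longrightarrow> \<exists>x\<in>carrier L. f x = y"
proof -
  show *: "left_module R L" "left_module R M" "left_module R N"
    "f \<in> lmod_hom R L M" "g \<in> lmod_hom R M N" "inj_on f (carrier L)"
    "f ` carrier L = a_kernel M N g" "g ` carrier M = carrier N"
    using assms unfolding short_exact_def by simp_all
  show "g (f x) = \<zero>\<^bsub>N\<^esub>" if "x \<in> carrier L" for x
  proof -
    have "f x \<in> a_kernel M N g" using that by (simp add: *(7)[symmetric])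
    then show ?thesis by (simp add: a_kernel_iff)
  qed
  show "\<exists>x\<in>carrier L. f x = y" if "y \<in> carrier M" "g y = \<zero>\<^bsub>N\<^esub>" for y
  proof -
    have "y \<in> f ` carrier L" using that by (simp add: *(7) a_kernel_iff)
    then show ?thesis by (elim imageE) (rule bexI, simp_all)
  qed
qed

lemma short_exactI:
  assumes "left_module R L" "left_module R M" "left_module R N"
    "f \<in> lmod_hom R L M" "g \<in> lmod_hom R M N"
    "\<And>x. x \<in> carrier L \<Longrightarrow> f x = \<zero>\<^bsub>M\<^esub> \<Longrightarrow> x = \<zero>\<^bsub>L\<^esub>"
    "\<And>x. x \<in> carrier L \<Longrightarrow> g (f x) = \<zero>\<^bsub>N\<^esub>"
    "\<And>y. y \<in> carrier M \<Longrightarrow> g y = \<zero>\<^bsub>N\<^esub> \<Longrightarrow> \<exists>x\<in>carrier L. f x = y"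
    "\<And>z. z \<in> carrier N \<Longrightarrow> \<exists>y\<in>carrier M. g y = z"
  shows "short_exact R L M N f g"
proof -
  have "inj_on f (carrier L)"
    unfolding lmod_hom_inj_iff[OF assms(1,2,4)] using assms(6) by simp
  moreover have "f ` carrier L = a_kernel M N g"
    using assms(7,8) lmod_homD(1)[OF assms(4)] unfolding set_eq_iff a_kernel_iff image_iff by metis
  moreover have "g ` carrier M = carrier N"
    using assms(9) lmod_homD(1)[OF assms(5)] unfolding set_eq_iff image_iff by metis
  ultimately show ?thesis using assms(1-5) unfolding short_exact_def by simp
qed

text \<open>Exactness on the left and in the middle holds for every short exact sequence, the latter
  by factoring a functional that kills the kernel of \<open>g\<close>. Surjectivity at the right end
  is what \<open>extends_along\<close> supplies.\<close>

lemma short_exact_dual: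
  assumes "short_exact R L M N f g" "extends_along R L M f"
  shows "short_exact (op_ring R) (dual_module R N) (dual_module R M) (dual_module R L) (dual_map M g) (dual_map L f)"
proof -
  note e = short_exactD[OF assms(1)]
  show ?thesis
  proof (rule short_exactI)
    show "left_module (op_ring R) (dual_module R L)" "left_module (op_ring R) (dual_module R M)"
      "left_module (op_ring R) (dual_module R N)" using e(1-3) by (simp_all add: left_module_dual)
    show "dual_map M g \<in> lmod_hom (op_ring R) (dual_module R N) (dual_module R M)"
      by (rule dual_map_hom[OF e(2,3,5)])
    show "dual_map L f \<in> lmod_hom (op_ring R) (dual_module R M) (dual_module R L)"
      by (rule dual_map_hom[OF e(1,2,4)])
    show "\<phi> = \<zero>\<^bsub>dual_module R N\<^esub>"
      if \<phi>: "\<phi> \<in> carrier (dual_module R N)" "dual_map M g \<phi> = \<zero>\<^bsub>dual_module R M\<^esub>" for \<phi>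
    proof (rule dual_eqI[of _ N])
      fix y assume "y \<in> carrier N"
      then have "y \<in> g ` carrier M" by (simp add: e(8))
      then obtain x where x: "y = g x" "x \<in> carrier M" by (rule imageE)
      have "dual_map M g \<phi> x = \<zero>\<^bsub>R\<^esub>" using \<phi>(2) x by simp
      then show "\<phi> y = \<zero>\<^bsub>dual_module R N\<^esub> y" using x \<open>y \<in> carrier N\<close> by simp
    qed (use dualD(2)[OF \<phi>(1)] in simp_all)
    show "dual_map L f (dual_map M g \<phi>) = \<zero>\<^bsub>dual_module R L\<^esub>" if "\<phi> \<in> carrier (dual_module R N)" for \<phi>
    proof (rule dual_eqI[of _ L])
      fix x assume x: "x \<in> carrier L"
      have "\<phi> \<zero>\<^bsub>N\<^esub> = \<zero>\<^bsub>R\<^esub>"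
        using lmod_hom_zero[OF e(3) left_module_regular[OF left_module_ring[OF e(3)]] dualD(1)[OF that]] by simp
      then show "dual_map L f (dual_map M g \<phi>) x = \<zero>\<^bsub>dual_module R L\<^esub> x"
        using x lmod_homD(1)[OF e(4) x] e(9)[OF x] by simp
    qed simp_all
    show "\<exists>\<psi>\<in>carrier (dual_module R N). dual_map M g \<psi> = \<phi>"
      if \<phi>: "\<phi> \<in> carrier (dual_module R M)" "dual_map L f \<phi> = \<zero>\<^bsub>dual_module R L\<^esub>" for \<phi>
    proof -
      have "\<phi> y = \<zero>\<^bsub>regular_module R\<^esub>" if y: "y \<in> carrier M" "g y = \<zero>\<^bsub>N\<^esub>" for y
      proof -
        obtain x where x: "x \<in> carrier L" "f x = y" using e(10)[OF y] by (elim bexE)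
        have "dual_map L f \<phi> x = \<zero>\<^bsub>R\<^esub>" using \<phi>(2) x(1) by simp
        then show ?thesis using x by simp
      qed
      then obtain u where u: "u \<in> lmod_hom R N (regular_module R)" "\<forall>x\<in>carrier M. u (g x) = \<phi> x"
        using lmod_hom_factor[OF e(2,3) left_module_regular[OF left_module_ring[OF e(3)]] e(5,8) dualD(1)[OF \<phi>(1)]]
        by metis
      have "dual_map M g (restrict u (carrier N)) = \<phi>"
        using u(2) lmod_homD(1)[OF e(5)] dualD(2)[OF \<phi>(1)] by (intro dual_eqI[of _ M]) simp_all
      then show ?thesis
        by (intro bexI[of _ "restrict u (carrier N)"] restrict_dual[OF e(3) u(1)])
    qed
    show "\<exists>\<psi>\<in>carrier (dual_module R M). dual_map L f \<psi> = \<phi>" if \<phi>: "\<phi> \<in> carrier (dual_module R L)" for \<phi>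
    proof -
      obtain \<psi> where \<psi>: "\<psi> \<in> lmod_hom R M (regular_module R)" "\<forall>x\<in>carrier L. \<phi> x = \<psi> (f x)"
        using assms(2) dualD(1)[OF \<phi>] unfolding extends_along_def by metis
      have "dual_map L f (restrict \<psi> (carrier M)) = \<phi>"
        using \<psi>(2) lmod_homD(1)[OF e(4)] dualD(2)[OF \<phi>] by (intro dual_eqI[of _ L]) simp_all
      then show ?thesis
        by (intro bexI[of _ "restrict \<psi> (carrier M)"] restrict_dual[OF e(2) \<psi>(1)])
    qed
  qed
qed

section \<open>Duals and biduals of finitely generated projectives\<close>

lemma finsum_regular_op [simp]: "finsum (regular_module (op_ring R)) = finsum (regular_module R)"
  by (simp add: finsum_def fun_eq_iff)

text \<open>Applying \<open>\<psi>\<close> to the expansion of \<open>x\<close> gives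
  \<open>\<psi> x\<close> as the sum of the products of \<open>\<phi> i x\<close> and
  \<open>\<psi> (p i)\<close>. The second factor stands on the right, which is the scalar action on
  the dual. So the \<open>\<phi> i\<close> generate the dual, with evaluations at the
  \<open>p i\<close> as coordinates.\<close>

lemma dual_basis_dual_expand:
  assumes lm: "left_module R P" and db: "dual_basis R P n p \<phi>" and \<psi>: "\<psi> \<in> carrier (dual_module R P)"
  shows "(\<lambda>i. \<psi> (p i) \<odot>\<^bsub>dual_module R P\<^esub> restrict (\<phi> i) (carrier P)) \<in> {..<n} \<rightarrow> carrier (dual_module R P)"
    and "\<psi> = (\<Oplus>\<^bsub>dual_module R P\<^esub>i\<in>{..<n}. \<psi> (p i) \<odot>\<^bsub>dual_module R P\<^esub> restrict (\<phi> i) (carrier P))"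
      (is "_ = ?s")
proof -
  note d = dual_basisD[OF db]
  interpret P: left_module R P by fact
  note reg = left_module_regular[OF P.R.ring_axioms]
  note reg' = left_module_regular[OF ring_op_ring[OF P.R.ring_axioms]]
  note D = left_module_dual[OF lm]
  interpret D: left_module "op_ring R" "dual_module R P" by (rule D)
  interpret Reg: left_module R "regular_module R" by (rule reg)
  let ?\<phi> = "\<lambda>i. restrict (\<phi> i) (carrier P)"
  have \<phi>: "?\<phi> i \<in> carrier (dual_module R P)" if "i < n" for i
    by (rule restrict_dual[OF lm d(2)[OF that]])
  show cl: "(\<lambda>i. \<psi> (p i) \<odot>\<^bsub>dual_module R P\<^esub> ?\<phi> i) \<in> {..<n} \<rightarrow> carrier (dual_module R P)"
    using dualD(3)[OF \<psi>] d(1) \<phi> by (intro funcsetI D.smult_closed) simp_all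
  show "\<psi> = ?s"
  proof (rule dual_eqI[of _ P])
    show "\<psi> \<in> extensional (carrier P)" by (rule dualD(2)[OF \<psi>])
    show "?s \<in> extensional (carrier P)" by (rule dualD(2)[OF D.M.finsum_closed[OF cl]])
    fix x assume x: "x \<in> carrier P"
    have c: "\<phi> i x \<in> carrier R" if "i < n" for i using lmod_homD(1)[OF d(2)[OF that] x] by simp
    have "?s x = (\<Oplus>\<^bsub>regular_module R\<^esub>i\<in>{..<n}. (\<psi> (p i) \<odot>\<^bsub>dual_module R P\<^esub> ?\<phi> i) x)"
      using lmod_hom_finsum[OF D reg' dual_eval_hom[OF x] finite_lessThan cl] by simp
    also have "\<dots> = (\<Oplus>\<^bsub>regular_module R\<^esub>i\<in>{..<n}. \<psi> (\<phi> i x \<odot>\<^bsub>P\<^esub> p i))"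
      using c d(1) lmod_homD(3)[OF dualD(1)[OF \<psi>]] dualD(3)[OF \<psi>] x
      by (intro Reg.M.finsum_cong') (simp_all add: Pi_def P.smult_closed)
    also have "\<dots> = \<psi> (\<Oplus>\<^bsub>P\<^esub>i\<in>{..<n}. \<phi> i x \<odot>\<^bsub>P\<^esub> p i)"
      using c d(1)
      by (intro lmod_hom_finsum[OF lm reg dualD(1)[OF \<psi>], symmetric]) (simp_all add: Pi_def P.smult_closed)
    also have "\<dots> = \<psi> x" by (rule arg_cong[OF d(3)[OF x], of \<psi>, symmetric])
    finally show "\<psi> x = ?s x" by simp
  qed
qed

lemma fg_projective_dual:
  assumes "fg_projective R P"
  shows "fg_projective (op_ring R) (dual_module R P)"
proof -
  obtain n p \<phi> where lm: "left_module R P" and db: "dual_basis R P n p \<phi>"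
    using assms(1) unfolding fg_projective_iff_dual_basis by blast
  note d = dual_basisD[OF db]
  have "dual_basis (op_ring R) (dual_module R P) n (\<lambda>i. restrict (\<phi> i) (carrier P)) (\<lambda>i \<psi>. \<psi> (p i))"
    unfolding dual_basis_def
    by (intro conjI allI impI ballI restrict_dual[OF lm d(2)] dual_eval_hom[OF d(1)]
        dual_basis_dual_expand(2)[OF lm db])
  then show ?thesis unfolding fg_projective_iff_dual_basis using left_module_dual[OF lm] by blast
qed

text \<open>Surjectivity of the map from \<open>P\<close> to its bidual: expanding
  \<open>\<psi>\<close> in the dual basis shows that \<open>\<Xi>\<close> is evaluation at the point
  with coordinates \<open>\<Xi> (\<phi> i)\<close>.\<close>

lemma fg_projective_reflexive:
  assumes "fg_projective R P"
    and "\<Xi> \<in> lmod_hom (op_ring R) (dual_module R P) (regular_module (op_ring R))"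
  shows "\<exists>x\<in>carrier P. \<forall>\<psi>\<in>carrier (dual_module R P). \<Xi> \<psi> = \<psi> x"
proof -
  obtain n p \<phi> where lm: "left_module R P" and db: "dual_basis R P n p \<phi>"
    using assms(1) unfolding fg_projective_iff_dual_basis by blast
  note d = dual_basisD[OF db]
  interpret P: left_module R P by fact
  note reg = left_module_regular[OF P.R.ring_axioms]
  interpret Reg: left_module R "regular_module R" by (rule reg)
  let ?\<phi> = "\<lambda>i. restrict (\<phi> i) (carrier P)"
  have \<phi>: "?\<phi> i \<in> carrier (dual_module R P)" if "i < n" for i
    by (rule restrict_dual[OF lm d(2)[OF that]])
  have \<Xi>c: "\<Xi> (?\<phi> i) \<in> carrier R" if "i < n" for i
    using lmod_homD(1)[OF assms(2) \<phi>[OF that]] by simp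
  define x where "x = (\<Oplus>\<^bsub>P\<^esub>i\<in>{..<n}. \<Xi> (?\<phi> i) \<odot>\<^bsub>P\<^esub> p i)"
  have xc: "(\<lambda>i. \<Xi> (?\<phi> i) \<odot>\<^bsub>P\<^esub> p i) \<in> {..<n} \<rightarrow> carrier P"
    using \<Xi>c d(1) by (intro funcsetI P.smult_closed) simp_all
  have x: "x \<in> carrier P" unfolding x_def by (rule P.M.finsum_closed[OF xc])
  have "\<Xi> \<psi> = \<psi> x" if \<psi>: "\<psi> \<in> carrier (dual_module R P)" for \<psi>
  proof -
    have \<psi>c: "\<psi> (p i) \<in> carrier R" if "i < n" for i using dualD(3)[OF \<psi> d(1)[OF that]] .
    interpret D: left_module "op_ring R" "dual_module R P" by (rule left_module_dual[OF lm])
    note ex = dual_basis_dual_expand[OF lm db \<psi>]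
    note cl = ex(1)
    have "\<Xi> \<psi> = \<Xi> (\<Oplus>\<^bsub>dual_module R P\<^esub>i\<in>{..<n}. \<psi> (p i) \<odot>\<^bsub>dual_module R P\<^esub> ?\<phi> i)"
      by (rule arg_cong[OF ex(2)])
    also have "\<dots> = (\<Oplus>\<^bsub>regular_module R\<^esub>i\<in>{..<n}. \<Xi> (\<psi> (p i) \<odot>\<^bsub>dual_module R P\<^esub> ?\<phi> i))"
      using lmod_hom_finsum[OF D.left_module_axioms left_module_regular[OF ring_op_ring[OF P.R.ring_axioms]]
            assms(2) finite_lessThan cl] by simp
    also have "\<dots> = (\<Oplus>\<^bsub>regular_module R\<^esub>i\<in>{..<n}. \<psi> (\<Xi> (?\<phi> i) \<odot>\<^bsub>P\<^esub> p i))"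
    proof (rule Reg.M.finsum_cong')
      fix i assume "i \<in> {..<n}"
      then have i: "i < n" by simp
      have "\<Xi> (\<psi> (p i) \<odot>\<^bsub>dual_module R P\<^esub> ?\<phi> i) = \<Xi> (?\<phi> i) \<otimes>\<^bsub>R\<^esub> \<psi> (p i)"
        using lmod_homD(3)[OF assms(2), of "\<psi> (p i)" "?\<phi> i"] \<psi>c[OF i] \<phi>[OF i]
        unfolding regular_module_simps op_ring_simps by blast
      also have "\<dots> = \<psi> (\<Xi> (?\<phi> i) \<odot>\<^bsub>P\<^esub> p i)"
        using lmod_homD(3)[OF dualD(1)[OF \<psi>], of "\<Xi> (?\<phi> i)" "p i"] \<Xi>c[OF i] d(1)[OF i] by simp
      finally show "\<Xi> (\<psi> (p i) \<odot>\<^bsub>dual_module R P\<^esub> ?\<phi> i) = \<psi> (\<Xi> (?\<phi> i) \<odot>\<^bsub>P\<^esub> p i)" .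
    next
      show "(\<lambda>i. \<psi> (\<Xi> (?\<phi> i) \<odot>\<^bsub>P\<^esub> p i)) \<in> {..<n} \<rightarrow> carrier (regular_module R)"
        using \<Xi>c d(1) dualD(3)[OF \<psi>] by (simp add: Pi_def P.smult_closed)
    qed simp
    also have "\<dots> = \<psi> x"
      unfolding x_def by (rule lmod_hom_finsum[OF lm reg dualD(1)[OF \<psi>] finite_lessThan xc, symmetric])
    finally show ?thesis .
  qed
  then show ?thesis using x by (intro bexI[of _ x] ballI)
qed

text \<open>Injectivity of the map from \<open>P\<close> to its bidual: the coordinate functionals
  of a dual basis already detect zero.\<close>

lemma fg_projective_separated:
  assumes "fg_projective R P" "x \<in> carrier P"
    "\<And>\<psi>. \<psi> \<in> carrier (dual_module R P) \<Longrightarrow> \<psi> x = \<zero>\<^bsub>R\<^esub>"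
  shows "x = \<zero>\<^bsub>P\<^esub>"
proof -
  obtain n p \<phi> where lm: "left_module R P" and db: "dual_basis R P n p \<phi>"
    using assms(1) unfolding fg_projective_iff_dual_basis by blast
  note d = dual_basisD[OF db]
  interpret P: left_module R P by fact
  have "\<phi> i x = \<zero>\<^bsub>R\<^esub>" if "i < n" for i
    using assms(3)[OF restrict_dual[OF lm d(2)[OF that]]] assms(2) by simp
  then have "(\<Oplus>\<^bsub>P\<^esub>i\<in>{..<n}. \<phi> i x \<odot>\<^bsub>P\<^esub> p i) = (\<Oplus>\<^bsub>P\<^esub>i\<in>{..<n}. \<zero>\<^bsub>P\<^esub>)"
    using d(1) by (intro P.M.finsum_cong') (simp_all add: P.smult_l_null)
  then show ?thesis using d(3)[OF assms(2)] P.M.finsum_zero by simp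
qed

section \<open>Complexes of projectives\<close>

text \<open>
  Exactness of \<open>Hom\<^sub>R(P, N)\<close> in degree \<open>n\<close>. For a projective resolution \<open>P\<close> of \<open>X\<close> this says
  \<open>Ext\<^sup>n(X, N) = 0\<close>, also for modules \<open>N\<close> other than \<open>R\<close>.
\<close>

definition hom_exact_at ::
  "'a ring \<Rightarrow> (nat \<Rightarrow> ('a, 'm) module) \<Rightarrow> (nat \<Rightarrow> 'm \<Rightarrow> 'm) \<Rightarrow> ('a, 'n) module \<Rightarrow> nat \<Rightarrow> bool" where
  "hom_exact_at R P f N n \<longleftrightarrow>
     (\<forall>h\<in>lmod_hom R (P n) N. (\<forall>x\<in>carrier (P (Suc n)). h (f n x) = \<zero>\<^bsub>N\<^esub>) \<longrightarrow>
       (case n of 0 \<Rightarrow> \<forall>x\<in>carrier (P n). h x = \<zero>\<^bsub>N\<^esub>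
        | Suc m \<Rightarrow> \<exists>t\<in>lmod_hom R (P m) N. \<forall>x\<in>carrier (P n). h x = t (f m x)))"

lemma hom_exact_at_0D:
  assumes "hom_exact_at R P f N 0" "h \<in> lmod_hom R (P 0) N"
    "\<And>x. x \<in> carrier (P (Suc 0)) \<Longrightarrow> h (f 0 x) = \<zero>\<^bsub>N\<^esub>" "x \<in> carrier (P 0)"
  shows "h x = \<zero>\<^bsub>N\<^esub>"
  using assms unfolding hom_exact_at_def by simp

lemma hom_exact_at_SucD:
  assumes "hom_exact_at R P f N (Suc n)" "h \<in> lmod_hom R (P (Suc n)) N"
    "\<forall>x\<in>carrier (P (Suc (Suc n))). h (f (Suc n) x) = \<zero>\<^bsub>N\<^esub>"
  shows "\<exists>t\<in>lmod_hom R (P n) N. \<forall>x\<in>carrier (P (Suc n)). h x = t (f n x)"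
  using assms unfolding hom_exact_at_def by simp

lemma hom_exact_at_0I:
  assumes "\<And>h x. h \<in> lmod_hom R (P 0) N \<Longrightarrow> \<forall>x\<in>carrier (P (Suc 0)). h (f 0 x) = \<zero>\<^bsub>N\<^esub> \<Longrightarrow>
    x \<in> carrier (P 0) \<Longrightarrow> h x = \<zero>\<^bsub>N\<^esub>"
  shows "hom_exact_at R P f N 0"
  using assms unfolding hom_exact_at_def by simp

lemma hom_exact_at_SucI:
  assumes "\<And>h. h \<in> lmod_hom R (P (Suc n)) N \<Longrightarrow> \<forall>x\<in>carrier (P (Suc (Suc n))). h (f (Suc n) x) = \<zero>\<^bsub>N\<^esub> \<Longrightarrow>
    \<exists>t\<in>lmod_hom R (P n) N. \<forall>x\<in>carrier (P (Suc n)). h x = t (f n x)"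
  shows "hom_exact_at R P f N (Suc n)"
  using assms unfolding hom_exact_at_def by simp

section \<open>Lifting through short exact sequences\<close>

lemma short_exact_kernel_lift:
  assumes e: "short_exact R L M N i \<pi>" and P: "left_module R P" and t: "t \<in> lmod_hom R P M"
    and z: "\<forall>x\<in>carrier P. \<pi> (t x) = \<zero>\<^bsub>N\<^esub>"
  shows "\<exists>k\<in>lmod_hom R P L. \<forall>x\<in>carrier P. i (k x) = t x"
proof -
  note e' = short_exactD[OF e]
  let ?I = "M\<lparr>carrier := i ` carrier L\<rparr>"
  have i: "i \<in> lmod_hom R L ?I" by (rule lmod_hom_into_submodule[OF e'(4)]) simp
  have "inv_into (carrier L) i \<in> lmod_hom R ?I L"
    by (rule lmod_hom_inv_into[OF e'(1) i e'(6)]) simp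
  moreover have im: "t x \<in> i ` carrier L" if "x \<in> carrier P" for x
    unfolding e'(7) a_kernel_iff using z that lmod_homD(1)[OF t that] by simp
  then have "t \<in> lmod_hom R P ?I" by (rule lmod_hom_into_submodule[OF t])
  ultimately show ?thesis
    using lmod_hom_comp[of t R P ?I "inv_into (carrier L) i" L] f_inv_into_f[OF im]
    by (intro bexI[of _ "\<lambda>x. inv_into (carrier L) i (t x)"]) simp_all
qed

lemma short_exact_lift:
  assumes e: "short_exact R L M N i \<pi>" and P: "fg_projective R P" and t: "t \<in> lmod_hom R P N"
  shows "\<exists>k\<in>lmod_hom R P M. \<forall>x\<in>carrier P. \<pi> (k x) = t x"
proof (rule fg_projective_lift[OF P short_exactD(2,3,5)[OF e] t])
  fix x assume x: "x \<in> carrier P"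
  show "t x \<in> \<pi> ` carrier M"
    unfolding short_exactD(8)[OF e] using lmod_homD(1)[OF t x] .
qed

locale projective_complex =
  fixes R :: "'a ring" and P :: "nat \<Rightarrow> ('a, 'm) module" and f :: "nat \<Rightarrow> 'm \<Rightarrow> 'm"
  assumes proj: "fg_projective R (P i)"
    and diff: "f i \<in> lmod_hom R (P (Suc i)) (P i)"
    and diff_diff: "x \<in> carrier (P (Suc (Suc i))) \<Longrightarrow> f i (f (Suc i) x) = \<zero>\<^bsub>P i\<^esub>"
begin

lemma lm: "left_module R (P i)"
  using fg_projective_left_module[OF proj] .

lemma ring: "ring R"
  using left_module_ring[OF lm] .

text \<open>Composing with the functionals of a dual basis of \<open>E\<close> turns a cocycle with
  values in \<open>E\<close> into finitely many cocycles with values in \<open>R\<close>; their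
  preimages are reassembled with the basis elements \<open>p k\<close>. This is where the grade
  hypothesis, which speaks of \<open>R\<close> alone, passes to all finitely generated
  projectives.\<close>

lemma hom_exact_at_projective:
  assumes ex: "hom_exact_at R P f (regular_module R) n" and E: "fg_projective R E"
  shows "hom_exact_at R P f E n"
proof -
  obtain N p \<phi> where lmE: "left_module R E" and db: "dual_basis R E N p \<phi>"
    using E unfolding fg_projective_iff_dual_basis by blast
  note d = dual_basisD[OF db]
  interpret E: left_module R E by fact
  have \<phi>0: "\<phi> k \<zero>\<^bsub>E\<^esub> = \<zero>\<^bsub>R\<^esub>" if "k < N" for k
    using lmod_hom_zero[OF lmE left_module_regular[OF ring] d(2)[OF that]] by simp
  show ?thesis
  proof (cases n)
    case 0
    show ?thesis
      unfolding 0
    proof (rule hom_exact_at_0I)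
      fix h x assume h: "h \<in> lmod_hom R (P 0) E" "\<forall>x\<in>carrier (P (Suc 0)). h (f 0 x) = \<zero>\<^bsub>E\<^esub>"
        and x: "x \<in> carrier (P 0)"
      have "\<phi> k (h x) = \<zero>\<^bsub>R\<^esub>" if k: "k < N" for k
      proof -
        have "\<phi> k (h x) = \<zero>\<^bsub>regular_module R\<^esub>"
          by (rule hom_exact_at_0D[OF ex[unfolded 0] lmod_hom_comp[OF h(1) d(2)[OF k]] _ x])
            (use h(2) \<phi>0[OF k] in simp)
        then show ?thesis by simp
      qed
      then have "(\<Oplus>\<^bsub>E\<^esub>i\<in>{..<N}. \<phi> i (h x) \<odot>\<^bsub>E\<^esub> p i) = (\<Oplus>\<^bsub>E\<^esub>i\<in>{..<N}. \<zero>\<^bsub>E\<^esub>)"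
        using d(1) by (intro E.M.finsum_cong') (simp_all add: E.smult_l_null)
      then show "h x = \<zero>\<^bsub>E\<^esub>" using d(3)[OF lmod_homD(1)[OF h(1) x]] E.M.finsum_zero by simp
    qed
  next
    case (Suc m)
    show ?thesis
      unfolding Suc
    proof (rule hom_exact_at_SucI)
      fix h assume h: "h \<in> lmod_hom R (P (Suc m)) E" "\<forall>x\<in>carrier (P (Suc (Suc m))). h (f (Suc m) x) = \<zero>\<^bsub>E\<^esub>"
      have "\<exists>t. t \<in> lmod_hom R (P m) (regular_module R) \<and> (\<forall>x\<in>carrier (P (Suc m)). \<phi> k (h x) = t (f m x))"
        if k: "k < N" for k
        unfolding Bex_def[symmetric]
        by (rule hom_exact_at_SucD[OF ex[unfolded Suc] lmod_hom_comp[OF h(1) d(2)[OF k]]])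
          (use h(2) \<phi>0[OF k] in simp)
      then obtain t where t: "\<And>k. k < N \<Longrightarrow> t k \<in> lmod_hom R (P m) (regular_module R)"
        "\<And>k x. k < N \<Longrightarrow> x \<in> carrier (P (Suc m)) \<Longrightarrow> \<phi> k (h x) = t k (f m x)" by metis
      let ?T = "\<lambda>y. \<Oplus>\<^bsub>E\<^esub>k\<in>{..<N}. t k y \<odot>\<^bsub>E\<^esub> p k"
      have "h x = ?T (f m x)" if x: "x \<in> carrier (P (Suc m))" for x
      proof -
        have "h x = (\<Oplus>\<^bsub>E\<^esub>i\<in>{..<N}. \<phi> i (h x) \<odot>\<^bsub>E\<^esub> p i)" by (rule d(3)[OF lmod_homD(1)[OF h(1) x]])
        also have "\<dots> = ?T (f m x)"
          using t(2)[OF _ x] d(1) lmod_homD(1)[OF t(1) lmod_homD(1)[OF diff x]]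
          by (intro E.M.finsum_cong') (simp_all add: Pi_def E.smult_closed)
        finally show ?thesis .
      qed
      then show "\<exists>t\<in>lmod_hom R (P m) E. \<forall>x\<in>carrier (P (Suc m)). h x = t (f m x)"
        by (intro bexI[of _ ?T] ballI dual_basis_comb_hom[OF lm lmE t(1) d(1)])
    qed
  qed
qed

text \<open>For a resolution of \<open>X\<close> this is the embedding of \<open>Hom(X, M)\<close>
  into \<open>Hom(X, Q)\<close>. It ends the dimension shift, at the last module that still embeds
  into a projective.\<close>

lemma hom_exact_at_kernel_0:
  assumes e: "short_exact R M Q N i \<pi>" and Q: "hom_exact_at R P f Q 0"
  shows "hom_exact_at R P f M 0"
proof (rule hom_exact_at_0I)
  note e' = short_exactD[OF e]
  have i0: "i \<zero>\<^bsub>M\<^esub> = \<zero>\<^bsub>Q\<^esub>" by (rule lmod_hom_zero[OF e'(1,2,4)])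
  fix h x assume h: "h \<in> lmod_hom R (P 0) M" "\<forall>x\<in>carrier (P (Suc 0)). h (f 0 x) = \<zero>\<^bsub>M\<^esub>"
    and x: "x \<in> carrier (P 0)"
  have "i (h x) = \<zero>\<^bsub>Q\<^esub>"
    by (rule hom_exact_at_0D[OF Q lmod_hom_comp[OF h(1) e'(4)] _ x]) (use h(2) i0 in simp)
  then show "h x = \<zero>\<^bsub>M\<^esub>"
    using e'(6) lmod_homD(1)[OF h(1) x] unfolding lmod_hom_inj_iff[OF e'(1,2,4)] by blast
qed

text \<open>The piece \<open>Ext^n(X, N) \<rightarrow> Ext^(n+1)(X, M) \<rightarrow> Ext^(n+1)(X,
  Q)\<close> of the long exact sequence. In \<open>Q\<close> the cocycle becomes \<open>t\<close>
  composed with \<open>f n\<close>, and \<open>t\<close> has to be corrected by a coboundary until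
  it takes values in \<open>M\<close>.\<close>

lemma hom_exact_at_kernel_Suc:
  assumes e: "short_exact R M Q N i \<pi>" and Q: "hom_exact_at R P f Q (Suc n)" and N: "hom_exact_at R P f N n"
  shows "hom_exact_at R P f M (Suc n)"
proof (rule hom_exact_at_SucI)
  note e' = short_exactD[OF e]
  interpret Qm: left_module R Q by (rule e'(2))
  have i0: "i \<zero>\<^bsub>M\<^esub> = \<zero>\<^bsub>Q\<^esub>" by (rule lmod_hom_zero[OF e'(1,2,4)])
  have inj: "x = y" if "x \<in> carrier M" "y \<in> carrier M" "i x = i y" for x y
    using inj_onD[OF e'(6) that(3,1,2)] .
  fix h assume h: "h \<in> lmod_hom R (P (Suc n)) M" "\<forall>x\<in>carrier (P (Suc (Suc n))). h (f (Suc n) x) = \<zero>\<^bsub>M\<^esub>"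
  have "\<exists>t\<in>lmod_hom R (P n) Q. \<forall>x\<in>carrier (P (Suc n)). i (h x) = t (f n x)"
    by (rule hom_exact_at_SucD[OF Q lmod_hom_comp[OF h(1) e'(4)]]) (use h(2) i0 in simp)
  then obtain t where t: "t \<in> lmod_hom R (P n) Q" "\<forall>x\<in>carrier (P (Suc n)). i (h x) = t (f n x)" by (elim bexE)
  have cyc: "\<pi> (t (f n x)) = \<zero>\<^bsub>N\<^esub>" if x: "x \<in> carrier (P (Suc n))" for x
    using e'(9)[OF lmod_homD(1)[OF h(1) x]] t(2) x by simp
  have "\<exists>u\<in>lmod_hom R (P n) Q. (\<forall>x\<in>carrier (P (Suc n)). u (f n x) = t (f n x)) \<and>
    (\<forall>x\<in>carrier (P n). \<pi> (u x) = \<zero>\<^bsub>N\<^esub>)"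
  proof (cases n)
    case 0
    have "\<pi> (t x) = \<zero>\<^bsub>N\<^esub>" if "x \<in> carrier (P n)" for x
      using hom_exact_at_0D[OF N[unfolded 0] lmod_hom_comp[OF t(1)[unfolded 0] e'(5)] cyc[unfolded 0]] that 0 by simp
    then show ?thesis using t(1) by (intro bexI[of _ t]) simp_all
  next
    case (Suc m)
    have "\<exists>s\<in>lmod_hom R (P m) N. \<forall>x\<in>carrier (P (Suc m)). \<pi> (t x) = s (f m x)"
      by (rule hom_exact_at_SucD[OF N[unfolded Suc] lmod_hom_comp[OF t(1)[unfolded Suc] e'(5)]])
        (use cyc[unfolded Suc] in simp)
    then obtain s where s: "s \<in> lmod_hom R (P m) N" "\<forall>x\<in>carrier (P (Suc m)). \<pi> (t x) = s (f m x)" by (elim bexE)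
    obtain s' where s': "s' \<in> lmod_hom R (P m) Q" "\<forall>x\<in>carrier (P m). \<pi> (s' x) = s x"
      using short_exact_lift[OF e proj s(1)] by (elim bexE)
    \<comment> \<open>Subtracting \<open>s'\<close> composed with \<open>f m\<close> does not change
      the composite with \<open>f n\<close>, because \<open>f m\<close> and \<open>f n\<close>
      compose to zero, and it cancels the image of \<open>t\<close> in \<open>N\<close>.\<close>
    let ?u = "\<lambda>x. t x \<ominus>\<^bsub>Q\<^esub> s' (f m x)"
    have u: "?u \<in> lmod_hom R (P n) Q"
      unfolding Suc by (intro lmod_hom_diff lm e'(2) t(1)[unfolded Suc] lmod_hom_comp[OF diff s'(1)])
    have c1: "t x \<in> carrier Q" "s' (f m x) \<in> carrier Q" if "x \<in> carrier (P n)" for x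
      using lmod_homD(1)[OF t(1) that] lmod_homD(1)[OF s'(1) lmod_homD(1)[OF diff]] that unfolding Suc by blast+
    have "?u (f n x) = t (f n x)" if x: "x \<in> carrier (P (Suc n))" for x
    proof -
      have "s' (f m (f n x)) = \<zero>\<^bsub>Q\<^esub>"
        using diff_diff[of x m] x lmod_hom_zero[OF lm e'(2) s'(1)] unfolding Suc by simp
      then show ?thesis using c1(1)[OF lmod_homD(1)[OF diff x]] by (simp add: a_minus_def)
    qed
    moreover have "\<pi> (?u x) = \<zero>\<^bsub>N\<^esub>" if x: "x \<in> carrier (P n)" for x
    proof -
      have fx: "f m x \<in> carrier (P m)" using lmod_homD(1)[OF diff] x unfolding Suc by blast
      have "\<pi> (?u x) = \<pi> (t x) \<ominus>\<^bsub>N\<^esub> \<pi> (s' (f m x))"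
        by (rule lmod_hom_minus[OF e'(2,3,5) c1[OF x]])
      also have "\<pi> (s' (f m x)) = \<pi> (t x)" using s(2) s'(2) fx x unfolding Suc by simp
      finally show ?thesis
        using a_minus_eq_zero_iff[OF left_module_group[OF e'(3)]] lmod_homD(1)[OF e'(5) c1(1)[OF x]] by simp
    qed
    ultimately show ?thesis using u by (intro bexI[of _ ?u]) simp_all
  qed
  then obtain u where u: "u \<in> lmod_hom R (P n) Q" "\<forall>x\<in>carrier (P (Suc n)). u (f n x) = t (f n x)"
    "\<forall>x\<in>carrier (P n). \<pi> (u x) = \<zero>\<^bsub>N\<^esub>" by (elim bexE conjE)
  obtain k where k: "k \<in> lmod_hom R (P n) M" "\<forall>x\<in>carrier (P n). i (k x) = u x"
    using short_exact_kernel_lift[OF e lm u(1) u(3)] by (elim bexE)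
  have "h x = k (f n x)" if x: "x \<in> carrier (P (Suc n))" for x
    using t(2) u(2) k(2) x lmod_homD(1)[OF diff x]
    by (intro inj lmod_homD(1)[OF h(1)] lmod_homD(1)[OF k(1)]) simp_all
  then show "\<exists>t\<in>lmod_hom R (P n) M. \<forall>x\<in>carrier (P (Suc n)). h x = t (f n x)"
    using k(1) by (intro bexI[of _ k]) simp_all
qed

text \<open>The piece \<open>Ext^n(X, E) \<rightarrow> Ext^n(X, N) \<rightarrow> Ext^(n+1)(X,
  M)\<close>. A cocycle with values in \<open>N\<close> lifts to \<open>E\<close>; the failure of
  the lift to be a cocycle is a cocycle in \<open>M\<close> one degree higher, and writing this as a
  coboundary corrects the lift.\<close>

lemma hom_exact_at_cokernel:
  assumes e: "short_exact R M E N i \<pi>" and M: "hom_exact_at R P f M (Suc n)" and E: "hom_exact_at R P f E n"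
  shows "hom_exact_at R P f N n"
proof -
  note e' = short_exactD[OF e]
  interpret Em: left_module R E by (rule e'(2))
  interpret Nm: left_module R N by (rule e'(3))
  have i0: "i \<zero>\<^bsub>M\<^esub> = \<zero>\<^bsub>E\<^esub>" by (rule lmod_hom_zero[OF e'(1,2,4)])
  have key: "\<exists>u\<in>lmod_hom R (P n) E. (\<forall>x\<in>carrier (P (Suc n)). u (f n x) = \<zero>\<^bsub>E\<^esub>) \<and>
      (\<forall>x\<in>carrier (P n). \<pi> (u x) = h x)"
    if h: "h \<in> lmod_hom R (P n) N" "\<forall>x\<in>carrier (P (Suc n)). h (f n x) = \<zero>\<^bsub>N\<^esub>" for h
  proof -
    obtain h' where h': "h' \<in> lmod_hom R (P n) E" "\<forall>x\<in>carrier (P n). \<pi> (h' x) = h x"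
      using short_exact_lift[OF e proj h(1)] by (elim bexE)
    have z: "\<forall>x\<in>carrier (P (Suc n)). \<pi> (h' (f n x)) = \<zero>\<^bsub>N\<^esub>"
      using h'(2) h(2) lmod_homD(1)[OF diff] by simp
    obtain s where s: "s \<in> lmod_hom R (P (Suc n)) M" "\<forall>x\<in>carrier (P (Suc n)). i (s x) = h' (f n x)"
      using short_exact_kernel_lift[OF e lm lmod_hom_comp[OF diff h'(1)] z] by (elim bexE)
    have "\<forall>x\<in>carrier (P (Suc (Suc n))). s (f (Suc n) x) = \<zero>\<^bsub>M\<^esub>"
    proof (intro ballI inj_onD[OF e'(6)])
      fix x assume x: "x \<in> carrier (P (Suc (Suc n)))"
      show "i (s (f (Suc n) x)) = i \<zero>\<^bsub>M\<^esub>"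
        using s(2) lmod_homD(1)[OF diff x] diff_diff[OF x] lmod_hom_zero[OF lm e'(2) h'(1)] i0 by simp
      show "s (f (Suc n) x) \<in> carrier M" using lmod_homD(1)[OF s(1) lmod_homD(1)[OF diff x]] .
      show "\<zero>\<^bsub>M\<^esub> \<in> carrier M" by (rule abelian_groupE(2)[OF left_module_group[OF e'(1)]])
    qed
    from hom_exact_at_SucD[OF M s(1) this]
    obtain t where t: "t \<in> lmod_hom R (P n) M" "\<forall>x\<in>carrier (P (Suc n)). s x = t (f n x)" by (elim bexE)
    let ?u = "\<lambda>x. h' x \<ominus>\<^bsub>E\<^esub> i (t x)"
    have c1: "h' x \<in> carrier E" "i (t x) \<in> carrier E" if "x \<in> carrier (P n)" for x
      using lmod_homD(1)[OF h'(1) that] lmod_homD(1)[OF e'(4) lmod_homD(1)[OF t(1) that]] by simp_all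
    have "?u \<in> lmod_hom R (P n) E"
      by (intro lmod_hom_diff lm e'(2) h'(1) lmod_hom_comp[OF t(1) e'(4)])
    moreover have "?u (f n x) = \<zero>\<^bsub>E\<^esub>" if x: "x \<in> carrier (P (Suc n))" for x
      using a_minus_eq_zero_iff[OF left_module_group[OF e'(2)] c1[OF lmod_homD(1)[OF diff x]]] s(2) t(2) x by simp
    moreover have "\<pi> (?u x) = h x" if x: "x \<in> carrier (P n)" for x
    proof -
      have "\<pi> (?u x) = \<pi> (h' x) \<ominus>\<^bsub>N\<^esub> \<pi> (i (t x))" by (rule lmod_hom_minus[OF e'(2,3,5) c1[OF x]])
      also have "\<dots> = h x"
        using h'(2) x e'(9)[OF lmod_homD(1)[OF t(1) x]] lmod_homD(1)[OF h(1) x] by (simp add: a_minus_def)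
      finally show ?thesis .
    qed
    ultimately show ?thesis by (intro bexI[of _ ?u]) simp_all
  qed
  show ?thesis
  proof (cases n)
    case 0
    show ?thesis
      unfolding 0
    proof (rule hom_exact_at_0I)
      fix h x assume h: "h \<in> lmod_hom R (P 0) N" "\<forall>x\<in>carrier (P (Suc 0)). h (f 0 x) = \<zero>\<^bsub>N\<^esub>" "x \<in> carrier (P 0)"
      obtain u where u: "u \<in> lmod_hom R (P 0) E" "\<forall>x\<in>carrier (P (Suc 0)). u (f 0 x) = \<zero>\<^bsub>E\<^esub>"
        "\<forall>x\<in>carrier (P 0). \<pi> (u x) = h x"
        using key[unfolded 0, OF h(1,2)] by (elim bexE conjE)
      have "u x = \<zero>\<^bsub>E\<^esub>" using hom_exact_at_0D[OF E[unfolded 0] u(1)] u(2) h(3) by simp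
      then show "h x = \<zero>\<^bsub>N\<^esub>" using u(3) h(3) lmod_hom_zero[OF e'(2,3,5)] by metis
    qed
  next
    case (Suc m)
    show ?thesis
      unfolding Suc
    proof (rule hom_exact_at_SucI)
      fix h assume h: "h \<in> lmod_hom R (P (Suc m)) N" "\<forall>x\<in>carrier (P (Suc (Suc m))). h (f (Suc m) x) = \<zero>\<^bsub>N\<^esub>"
      obtain u where u: "u \<in> lmod_hom R (P (Suc m)) E" "\<forall>x\<in>carrier (P (Suc (Suc m))). u (f (Suc m) x) = \<zero>\<^bsub>E\<^esub>"
        "\<forall>x\<in>carrier (P (Suc m)). \<pi> (u x) = h x"
        using key[unfolded Suc, OF h(1,2)] by (elim bexE conjE)
      obtain v where v: "v \<in> lmod_hom R (P m) E" "\<forall>x\<in>carrier (P (Suc m)). u x = v (f m x)"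
        using hom_exact_at_SucD[OF E[unfolded Suc] u(1,2)] by (elim bexE)
      show "\<exists>t\<in>lmod_hom R (P m) N. \<forall>x\<in>carrier (P (Suc m)). h x = t (f m x)"
        using u(3) v(2) by (intro bexI[of _ "\<lambda>x. \<pi> (v x)"] lmod_hom_comp[OF v(1) e'(5)]) simp
    qed
  qed
qed

end

subsection \<open>Projective resolutions\<close>

lemma projective_resolution_complex:
  assumes "projective_resolution R X P f e"
  shows "projective_complex R P f"
proof -
  have a: "\<And>i. fg_projective R (P i)" "\<And>i. f i \<in> lmod_hom R (P (Suc i)) (P i)"
    "\<And>i. f (Suc i) ` carrier (P (Suc (Suc i))) = a_kernel (P (Suc i)) (P i) (f i)"
    using assms unfolding projective_resolution_def by simp_all
  show ?thesis
  proof
    fix x i assume "x \<in> carrier (P (Suc (Suc i)))"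
    then have "f (Suc i) x \<in> a_kernel (P (Suc i)) (P i) (f i)" unfolding a(3)[symmetric] by (rule imageI)
    then show "f i (f (Suc i) x) = \<zero>\<^bsub>P i\<^esub>" by (simp add: a_kernel_iff)
  qed (rule a)+
qed

lemma projective_resolutionD:
  assumes "projective_resolution R X P f e"
  shows "left_module R X" "e \<in> lmod_hom R (P 0) X" "e ` carrier (P 0) = carrier X"
    "f 0 ` carrier (P (Suc 0)) = a_kernel (P 0) X e"
    "\<And>i. f (Suc i) ` carrier (P (Suc (Suc i))) = a_kernel (P (Suc i)) (P i) (f i)"
    "\<And>x. x \<in> carrier (P (Suc 0)) \<Longrightarrow> e (f 0 x) = \<zero>\<^bsub>X\<^esub>"
proof -
  show *: "left_module R X" "e \<in> lmod_hom R (P 0) X" "e ` carrier (P 0) = carrier X"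
    "f 0 ` carrier (P (Suc 0)) = a_kernel (P 0) X e"
    "\<And>i. f (Suc i) ` carrier (P (Suc (Suc i))) = a_kernel (P (Suc i)) (P i) (f i)"
    using assms unfolding projective_resolution_def by simp_all
  fix x assume "x \<in> carrier (P (Suc 0))"
  then have "f 0 x \<in> a_kernel (P 0) X e" unfolding *(4)[symmetric] by (rule imageI)
  then show "e (f 0 x) = \<zero>\<^bsub>X\<^esub>" by (simp add: a_kernel_iff)
qed

text \<open>Prolongs a resolution by one term: over a noetherian ring the kernel is finitely
  generated, hence an image of a finitely generated projective.\<close>

lemma kernel_cover:
  assumes "left_noetherian R" "fg_projective R A" "left_module R B" "h \<in> lmod_hom R A B"
  shows "\<exists>(C :: ('a, 'a univ) module) k. fg_projective R C \<and> k \<in> lmod_hom R C A \<and>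
    k ` carrier C = a_kernel A B h"
proof -
  note A = fg_projective_left_module[OF assms(2)]
  note K = submodule_a_kernel[OF A assms(3,4)]
  obtain C :: "('a, 'a univ) module" and k where k: "fg_projective R C"
    "k \<in> lmod_hom R C (A\<lparr>carrier := a_kernel A B h\<rparr>)"
    "k ` carrier C = carrier (A\<lparr>carrier := a_kernel A B h\<rparr>)"
    by (rule fg_module_projective_cover[OF noetherian_fg_submodule[OF assms(1) fg_projective_fg[OF assms(2)] K]])
  have "k \<in> lmod_hom R C A"
    using lmod_homD[OF k(2)] left_module.submoduleD(1)[OF A K] by (intro lmod_homI) auto
  then show ?thesis using k(1,3) by (intro exI[of _ C] exI[of _ k]) simp
qed

text \<open>The first map is prescribed, because the resolution of the transpose has to begin with
  the dual of the given presentation. The recursion carries the last two terms together with the map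
  between them.\<close>

lemma resolution_continue:
  fixes A B :: "('a, 'a univ) module"
  assumes "left_noetherian R" "fg_projective R A" "fg_projective R B" "h \<in> lmod_hom R A B"
  shows "\<exists>(P :: nat \<Rightarrow> ('a, 'a univ) module) f. P 0 = B \<and> P 1 = A \<and> f 0 = h \<and> (\<forall>i. fg_projective R (P i)) \<and>
    (\<forall>i. f i \<in> lmod_hom R (P (Suc i)) (P i)) \<and>
    (\<forall>i. f (Suc i) ` carrier (P (Suc (Suc i))) = a_kernel (P (Suc i)) (P i) (f i))"
proof -
  let ?ok = "\<lambda>s :: ('a, 'a univ) module \<times> ('a, 'a univ) module \<times> ('a univ \<Rightarrow> 'a univ).
    fg_projective R (fst s) \<and> fg_projective R (fst (snd s)) \<and> snd (snd s) \<in> lmod_hom R (fst (snd s)) (fst s)"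
  have "\<exists>s. \<forall>n. (?ok (s n) \<and> (n = 0 \<longrightarrow> s n = (B, A, h))) \<and>
    (fst (s (Suc n)) = fst (snd (s n)) \<and> snd (snd (s (Suc n))) ` carrier (fst (snd (s (Suc n)))) =
      a_kernel (fst (snd (s n))) (fst (s n)) (snd (snd (s n))))"
  proof (rule dependent_nat_choice)
    show "\<exists>x. ?ok x \<and> (0 = (0::nat) \<longrightarrow> x = (B, A, h))" using assms by (intro exI[of _ "(B, A, h)"]) simp
    fix s and n :: nat assume s: "?ok s \<and> (n = 0 \<longrightarrow> s = (B, A, h))"
    obtain C :: "('a, 'a univ) module" and k where "fg_projective R C" "k \<in> lmod_hom R C (fst (snd s))"
      "k ` carrier C = a_kernel (fst (snd s)) (fst s) (snd (snd s))"
      using kernel_cover[OF assms(1), of "fst (snd s)" "fst s" "snd (snd s)"] s fg_projective_left_module by metis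
    then show "\<exists>y. (?ok y \<and> (Suc n = 0 \<longrightarrow> y = (B, A, h))) \<and>
        (fst y = fst (snd s) \<and> snd (snd y) ` carrier (fst (snd y)) =
      a_kernel (fst (snd s)) (fst s) (snd (snd s)))"
      using s by (intro exI[of _ "(fst (snd s), C, k)"]) simp
  qed
  then obtain s where s: "\<And>n. ?ok (s n)" "s 0 = (B, A, h)" "\<And>n. fst (s (Suc n)) = fst (snd (s n))"
    "\<And>n. snd (snd (s (Suc n))) ` carrier (fst (snd (s (Suc n)))) =
      a_kernel (fst (snd (s n))) (fst (s n)) (snd (snd (s n)))" by metis
  have "fst (s (Suc 0)) = A" using s(2,3) by simp
  then show ?thesis
    using s(1,2,4) s(3)[symmetric] by (intro exI[of _ "\<lambda>n. fst (s n)"] exI[of _ "\<lambda>n. snd (snd (s n))"]) simp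
qed

lemma projective_resolution_exists:
  assumes "left_noetherian R" "fg_module R (X :: ('a, 'm) module)"
  shows "\<exists>P f e. projective_resolution R X P f e"
proof -
  note X = fg_module_left_module[OF assms(2)]
  obtain B :: "('a, 'a univ) module" and e where B: "fg_projective R B" "e \<in> lmod_hom R B X" "e ` carrier B = carrier X"
    by (rule fg_module_projective_cover[OF assms(2)])
  obtain A :: "('a, 'a univ) module" and h where A: "fg_projective R A" "h \<in> lmod_hom R A B" "h ` carrier A = a_kernel B X e"
    using kernel_cover[OF assms(1) B(1) X B(2)] by metis
  obtain P :: "nat \<Rightarrow> ('a, 'a univ) module" and f where P: "P 0 = B" "P 1 = A" "f 0 = h" "\<forall>i. fg_projective R (P i)"
    "\<forall>i. f i \<in> lmod_hom R (P (Suc i)) (P i)"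
    "\<forall>i. f (Suc i) ` carrier (P (Suc (Suc i))) = a_kernel (P (Suc i)) (P i) (f i)"
    using resolution_continue[OF assms(1) A(1) B(1) A(2)] by (elim exE conjE)
  have "projective_resolution R X P f e"
    unfolding projective_resolution_def using P A(3) B X by simp
  then show ?thesis by (intro exI)
qed

lemma chosen_resolution:
  assumes "left_noetherian R" "fg_module R X"
  obtains P f e where "chosen_resolution R X = (P, f)" "projective_resolution R X P f e"
proof -
  obtain P f e where "projective_resolution R X P f e"
    using projective_resolution_exists[OF assms] by (elim exE)
  then have "case (P, f) of (P, f) \<Rightarrow> \<exists>e. projective_resolution R X P f e" by (simp, intro exI)
  then have "case chosen_resolution R X of (P, f) \<Rightarrow> \<exists>e. projective_resolution R X P f e"
    unfolding chosen_resolution_def by (rule someI)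
  then show thesis using that by (cases "chosen_resolution R X") auto
qed

lemma projective_resolution_iso:
  assumes res: "projective_resolution R X P f e"
    and iso: "lmod_iso R X Y" and X: "left_module R X" and Y: "left_module R Y"
  shows "\<exists>e'. projective_resolution R Y P f e'"
proof -
  obtain h h' where h: "h \<in> lmod_hom R X Y" "h' \<in> lmod_hom R Y X" "inj_on h (carrier X)"
    "h ` carrier X = carrier Y" "inj_on h' (carrier Y)" "h' ` carrier Y = carrier X"
    "\<forall>x\<in>carrier X. h' (h x) = x" "\<forall>y\<in>carrier Y. h (h' y) = y"
    by (rule lmod_isoE[OF iso X])
  note r = projective_resolutionD[OF res]
  have "h (e x) = \<zero>\<^bsub>Y\<^esub> \<longleftrightarrow> e x = \<zero>\<^bsub>X\<^esub>" if "x \<in> carrier (P 0)" for x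
    using h(3) lmod_homD(1)[OF r(2) that] lmod_hom_zero[OF X Y h(1)]
    unfolding lmod_hom_inj_iff[OF X Y h(1)] by metis
  then have "a_kernel (P 0) Y (\<lambda>x. h (e x)) = a_kernel (P 0) X e"
    unfolding set_eq_iff a_kernel_iff by metis
  moreover have "(\<lambda>x. h (e x)) ` carrier (P 0) = carrier Y"
    using r(3) h(4) by (metis image_image)
  ultimately have "projective_resolution R Y P f (\<lambda>x. h (e x))"
    using res Y lmod_hom_comp[OF r(2) h(1)] unfolding projective_resolution_def by simp
  then show ?thesis by (intro exI)
qed

text \<open>Isomorphic modules have the same resolutions, so even the chosen ones coincide.\<close>

lemma chosen_resolution_iso:
  assumes "lmod_iso R X Y" "left_module R X" "left_module R Y"
  shows "chosen_resolution R X = chosen_resolution R Y"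
proof -
  have "(\<exists>e. projective_resolution R X P f e) \<longleftrightarrow> (\<exists>e. projective_resolution R Y P f e)" for P f
    using projective_resolution_iso[OF _ assms]
      projective_resolution_iso[OF _ lmod_iso_sym[OF assms(1,2)] assms(3,2)] by metis
  then show ?thesis unfolding chosen_resolution_def by simp
qed

text \<open>An equality rather than an isomorphism, since \<open>Ext\<close> depends on the module
  only through the chosen resolution.\<close>

lemma Ext_iso:
  assumes "lmod_iso R X Y" "left_module R X" "left_module R Y"
  shows "Ext R n X = Ext R n Y"
  unfolding Ext_def chosen_resolution_iso[OF assms] ..

subsection \<open>Comparison of resolutions\<close>

text \<open>The recursion maintains that \<open>\<phi> n\<close> maps the image of
  \<open>f n\<close> into the image of \<open>f' n\<close>. Exactness of the second resolution
  provides this, and it is exactly what the next lift requires.\<close>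

lemma chain_map_exists:
  assumes r: "projective_resolution R X P f e" and r': "projective_resolution R X P' f' e'"
  shows "\<exists>\<phi>. (\<forall>n. \<phi> n \<in> lmod_hom R (P n) (P' n)) \<and> (\<forall>x\<in>carrier (P 0). e' (\<phi> 0 x) = e x) \<and>
    (\<forall>n. \<forall>x\<in>carrier (P (Suc n)). f' n (\<phi> (Suc n) x) = \<phi> n (f n x))"
proof -
  interpret P: projective_complex R P f by (rule projective_resolution_complex[OF r])
  interpret P': projective_complex R P' f' by (rule projective_resolution_complex[OF r'])
  note rD = projective_resolutionD[OF r] and rD' = projective_resolutionD[OF r']
  let ?ok = "\<lambda>n \<phi>. \<phi> \<in> lmod_hom R (P n) (P' n) \<and> (n = 0 \<longrightarrow> (\<forall>x\<in>carrier (P 0). e' (\<phi> x) = e x)) \<and>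
    (\<forall>x\<in>carrier (P (Suc n)). \<phi> (f n x) \<in> f' n ` carrier (P' (Suc n)))"
  have "\<exists>\<phi>. \<forall>n. ?ok n (\<phi> n) \<and> (\<forall>x\<in>carrier (P (Suc n)). f' n (\<phi> (Suc n) x) = \<phi> n (f n x))"
  proof (rule dependent_nat_choice)
    have "\<exists>\<phi>\<in>lmod_hom R (P 0) (P' 0). \<forall>x\<in>carrier (P 0). e' (\<phi> x) = e x"
      by (rule fg_projective_lift[OF P.proj P'.lm rD(1) rD'(2) rD(2)])
        (use rD'(3) lmod_homD(1)[OF rD(2)] in simp)
    then obtain \<phi> where \<phi>: "\<phi> \<in> lmod_hom R (P 0) (P' 0)" "\<forall>x\<in>carrier (P 0). e' (\<phi> x) = e x" by (elim bexE)
    moreover have "\<phi> (f 0 x) \<in> f' 0 ` carrier (P' (Suc 0))" if x: "x \<in> carrier (P (Suc 0))" for x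
      unfolding rD'(4) a_kernel_iff
      using \<phi>(2) lmod_homD(1)[OF P.diff x] rD(6)[OF x] lmod_homD(1)[OF \<phi>(1) lmod_homD(1)[OF P.diff x]] by simp
    ultimately show "\<exists>\<phi>. ?ok 0 \<phi>" by (intro exI[of _ \<phi>]) simp
  next
    fix \<phi> n assume \<phi>: "?ok n \<phi>"
    have "\<exists>\<psi>\<in>lmod_hom R (P (Suc n)) (P' (Suc n)). \<forall>x\<in>carrier (P (Suc n)). f' n (\<psi> x) = \<phi> (f n x)"
      by (rule fg_projective_lift[OF P.proj P'.lm P'.lm P'.diff lmod_hom_comp[OF P.diff]]) (use \<phi> in simp_all)
    then obtain \<psi> where \<psi>: "\<psi> \<in> lmod_hom R (P (Suc n)) (P' (Suc n))"
      "\<forall>x\<in>carrier (P (Suc n)). f' n (\<psi> x) = \<phi> (f n x)" by (elim bexE)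
    have "\<psi> (f (Suc n) x) \<in> f' (Suc n) ` carrier (P' (Suc (Suc n)))" if x: "x \<in> carrier (P (Suc (Suc n)))" for x
    proof -
      have "\<phi> \<zero>\<^bsub>P n\<^esub> = \<zero>\<^bsub>P' n\<^esub>" using lmod_hom_zero[OF P.lm P'.lm] \<phi> by simp
      then show ?thesis
        unfolding rD'(5) a_kernel_iff
        using \<psi>(2) lmod_homD(1)[OF P.diff x] P.diff_diff[OF x] lmod_homD(1)[OF \<psi>(1) lmod_homD(1)[OF P.diff x]] by simp
    qed
    then show "\<exists>\<psi>. ?ok (Suc n) \<psi> \<and> (\<forall>x\<in>carrier (P (Suc n)). f' n (\<psi> x) = \<phi> (f n x))"
      using \<psi> by (intro exI[of _ \<psi>]) simp
  qed
  then obtain \<phi> where \<phi>: "\<forall>n. ?ok n (\<phi> n) \<and> (\<forall>x\<in>carrier (P (Suc n)). f' n (\<phi> (Suc n) x) = \<phi> n (f n x))" by (elim exE)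
  show ?thesis using \<phi> by (intro exI[of _ \<phi>]) simp
qed

text \<open>A chain endomorphism over the zero map is null-homotopic. The recursion maintains that
  \<open>\<theta> (Suc n)\<close> minus \<open>s n\<close> after \<open>f n\<close> lands in the
  image of \<open>f (Suc n)\<close>, so that \<open>s (Suc n)\<close> can be lifted. The formula is
  recorded in positive degrees, where resolutions are to be compared.\<close>

lemma homotopy_exists:
  assumes r: "projective_resolution R X P f e"
    and \<theta>: "\<And>n. \<theta> n \<in> lmod_hom R (P n) (P n)" "\<And>x. x \<in> carrier (P 0) \<Longrightarrow> e (\<theta> 0 x) = \<zero>\<^bsub>X\<^esub>"
      "\<And>n x. x \<in> carrier (P (Suc n)) \<Longrightarrow> f n (\<theta> (Suc n) x) = \<theta> n (f n x)"
  shows "\<exists>s. (\<forall>n. s n \<in> lmod_hom R (P n) (P (Suc n))) \<and>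
    (\<forall>n. \<forall>x\<in>carrier (P (Suc n)). \<theta> (Suc n) x = f (Suc n) (s (Suc n) x) \<oplus>\<^bsub>P (Suc n)\<^esub> s n (f n x))"
proof -
  interpret P: projective_complex R P f by (rule projective_resolution_complex[OF r])
  note rD = projective_resolutionD[OF r]
  let ?ok = "\<lambda>n s. s \<in> lmod_hom R (P n) (P (Suc n)) \<and>
    (\<forall>x\<in>carrier (P (Suc n)). \<theta> (Suc n) x \<ominus>\<^bsub>P (Suc n)\<^esub> s (f n x) \<in> f (Suc n) ` carrier (P (Suc (Suc n))))"
  let ?Q = "\<lambda>n s s'. \<forall>x\<in>carrier (P (Suc n)). f (Suc n) (s' x) = \<theta> (Suc n) x \<ominus>\<^bsub>P (Suc n)\<^esub> s (f n x)"
  have diff_in: "\<theta> (Suc n) x \<ominus>\<^bsub>P (Suc n)\<^esub> s (f n x) \<in> f (Suc n) ` carrier (P (Suc (Suc n)))"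
    if s: "s \<in> lmod_hom R (P n) (P (Suc n))" and x: "x \<in> carrier (P (Suc n))"
      and eq: "f n (s (f n x)) = \<theta> n (f n x)" for n s x
  proof -
    interpret Q: left_module R "P (Suc n)" by (rule P.lm)
    have c: "\<theta> (Suc n) x \<in> carrier (P (Suc n))" "s (f n x) \<in> carrier (P (Suc n))" "\<theta> n (f n x) \<in> carrier (P n)"
      using lmod_homD(1)[OF \<theta>(1) x] lmod_homD(1)[OF s lmod_homD(1)[OF P.diff x]]
        lmod_homD(1)[OF \<theta>(1) lmod_homD(1)[OF P.diff x]] by simp_all
    have "f n (\<theta> (Suc n) x \<ominus>\<^bsub>P (Suc n)\<^esub> s (f n x)) = \<theta> n (f n x) \<ominus>\<^bsub>P n\<^esub> \<theta> n (f n x)"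
      using lmod_hom_minus[OF P.lm P.lm P.diff c(1,2)] eq \<theta>(3)[OF x] by simp
    also have "\<dots> = \<zero>\<^bsub>P n\<^esub>" using a_minus_eq_zero_iff[OF left_module_group[OF P.lm] c(3,3)] by simp
    finally show ?thesis unfolding rD(5) a_kernel_iff using c by simp
  qed
  have "\<exists>s. \<forall>n. ?ok n (s n) \<and> ?Q n (s n) (s (Suc n))"
  proof (rule dependent_nat_choice)
    have "\<exists>s\<in>lmod_hom R (P 0) (P (Suc 0)). \<forall>x\<in>carrier (P 0). f 0 (s x) = \<theta> 0 x"
    proof (rule fg_projective_lift[OF P.proj P.lm P.lm P.diff \<theta>(1)])
      fix x assume x: "x \<in> carrier (P 0)"
      show "\<theta> 0 x \<in> f 0 ` carrier (P (Suc 0))"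
        unfolding rD(4) a_kernel_iff using \<theta>(2)[OF x] lmod_homD(1)[OF \<theta>(1) x] by simp
    qed
    then obtain s where s: "s \<in> lmod_hom R (P 0) (P (Suc 0))" "\<forall>x\<in>carrier (P 0). f 0 (s x) = \<theta> 0 x" by (elim bexE)
    have "\<theta> (Suc 0) x \<ominus>\<^bsub>P (Suc 0)\<^esub> s (f 0 x) \<in> f (Suc 0) ` carrier (P (Suc (Suc 0)))"
      if x: "x \<in> carrier (P (Suc 0))" for x
      by (rule diff_in[OF s(1) x]) (use s(2) lmod_homD(1)[OF P.diff x] in simp)
    then show "\<exists>s. ?ok 0 s" using s(1) by (intro exI[of _ s]) simp
  next
    fix s n assume s: "?ok n s"
    then have sh: "s \<in> lmod_hom R (P n) (P (Suc n))" by simp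
    have "\<exists>s'\<in>lmod_hom R (P (Suc n)) (P (Suc (Suc n))). ?Q n s s'"
      by (rule fg_projective_lift[OF P.proj P.lm P.lm P.diff lmod_hom_diff[OF P.lm P.lm \<theta>(1) lmod_hom_comp[OF P.diff sh]]])
        (use s in simp)
    then obtain s' where s': "s' \<in> lmod_hom R (P (Suc n)) (P (Suc (Suc n)))" "?Q n s s'" by (elim bexE)
    have "\<theta> (Suc (Suc n)) x \<ominus>\<^bsub>P (Suc (Suc n))\<^esub> s' (f (Suc n) x) \<in> f (Suc (Suc n)) ` carrier (P (Suc (Suc (Suc n))))"
      if x: "x \<in> carrier (P (Suc (Suc n)))" for x
    proof (rule diff_in[OF s'(1) x])
      interpret Q: left_module R "P (Suc n)" by (rule P.lm)
      have fx: "f (Suc n) x \<in> carrier (P (Suc n))" by (rule lmod_homD(1)[OF P.diff x])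
      have "s (f n (f (Suc n) x)) = \<zero>\<^bsub>P (Suc n)\<^esub>"
        using P.diff_diff[OF x] lmod_hom_zero[OF P.lm P.lm sh] by simp
      then show "f (Suc n) (s' (f (Suc n) x)) = \<theta> (Suc n) (f (Suc n) x)"
        using s'(2) fx lmod_homD(1)[OF \<theta>(1) fx] by (simp add: a_minus_def)
    qed
    then show "\<exists>s'. ?ok (Suc n) s' \<and> ?Q n s s'" using s' by (intro exI[of _ s']) simp
  qed
  then obtain s where s: "\<forall>n. ?ok n (s n) \<and> ?Q n (s n) (s (Suc n))" by (elim exE)
  have "\<theta> (Suc n) x = f (Suc n) (s (Suc n) x) \<oplus>\<^bsub>P (Suc n)\<^esub> s n (f n x)" if x: "x \<in> carrier (P (Suc n))" for n x
  proof -
    have sn: "s n \<in> lmod_hom R (P n) (P (Suc n))" "?Q n (s n) (s (Suc n))" using s by simp_all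
    show ?thesis
      using sn(2) x a_minus_add_cancel(1)[OF left_module_group[OF P.lm] lmod_homD(1)[OF \<theta>(1) x]
          lmod_homD(1)[OF sn(1) lmod_homD(1)[OF P.diff x]]] by simp
  qed
  then show ?thesis using s by (intro exI[of _ s]) simp
qed

text \<open>Speaks of values on the carrier only, so that \<open>c\<close> may be any function and
  not just an extensional one, as the elements of dual modules are.\<close>

definition hom_coboundary where
  "hom_coboundary R P f N m c \<longleftrightarrow> (\<exists>t\<in>lmod_hom R (P m) N. \<forall>x\<in>carrier (P (Suc m)). c x = t (f m x))"

text \<open>Both \<open>\<theta>\<close> and the identity lie over the identity of \<open>X\<close>,
  so their difference has a homotopy \<open>s\<close>. After composing with the cocycle
  \<open>c\<close>, the summand that passes through \<open>f (Suc m)\<close> dies, and what remains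
  is the coboundary of \<open>c\<close> after \<open>s m\<close>.\<close>

lemma homotopic_to_id:
  assumes r: "projective_resolution R X P f e"
    and \<theta>: "\<And>n. \<theta> n \<in> lmod_hom R (P n) (P n)" "\<And>x. x \<in> carrier (P 0) \<Longrightarrow> e (\<theta> 0 x) = e x"
      "\<And>n x. x \<in> carrier (P (Suc n)) \<Longrightarrow> f n (\<theta> (Suc n) x) = \<theta> n (f n x)"
    and N: "left_module R N" and c: "c \<in> lmod_hom R (P (Suc m)) N"
      "\<forall>x\<in>carrier (P (Suc (Suc m))). c (f (Suc m) x) = \<zero>\<^bsub>N\<^esub>"
  shows "hom_coboundary R P f N m (\<lambda>x. c (\<theta> (Suc m) x) \<ominus>\<^bsub>N\<^esub> c x)"
proof -
  interpret P: projective_complex R P f by (rule projective_resolution_complex[OF r])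
  interpret N: left_module R N by (rule N)
  note rD = projective_resolutionD[OF r]
  let ?\<theta> = "\<lambda>n x. \<theta> n x \<ominus>\<^bsub>P n\<^esub> x"
  have \<theta>c: "\<theta> n x \<in> carrier (P n)" if "x \<in> carrier (P n)" for n x by (rule lmod_homD(1)[OF \<theta>(1) that])
  have "\<exists>s. (\<forall>n. s n \<in> lmod_hom R (P n) (P (Suc n))) \<and>
    (\<forall>n. \<forall>x\<in>carrier (P (Suc n)). ?\<theta> (Suc n) x = f (Suc n) (s (Suc n) x) \<oplus>\<^bsub>P (Suc n)\<^esub> s n (f n x))"
  proof (rule homotopy_exists[OF r])
    show "?\<theta> n \<in> lmod_hom R (P n) (P n)" for n by (intro lmod_hom_diff P.lm \<theta>(1) lmod_hom_id)
    show "e (?\<theta> 0 x) = \<zero>\<^bsub>X\<^esub>" if x: "x \<in> carrier (P 0)" for x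
      using lmod_hom_minus[OF P.lm rD(1,2) \<theta>c[OF x] x] \<theta>(2)[OF x]
        a_minus_eq_zero_iff[OF left_module_group[OF rD(1)]] lmod_homD(1)[OF rD(2) x] by simp
    show "f n (?\<theta> (Suc n) x) = ?\<theta> n (f n x)" if x: "x \<in> carrier (P (Suc n))" for n x
      using lmod_hom_minus[OF P.lm P.lm P.diff \<theta>c[OF x] x] \<theta>(3)[OF x] by simp
  qed
  then obtain s where s: "\<forall>n. s n \<in> lmod_hom R (P n) (P (Suc n))"
    "\<forall>n. \<forall>x\<in>carrier (P (Suc n)). ?\<theta> (Suc n) x = f (Suc n) (s (Suc n) x) \<oplus>\<^bsub>P (Suc n)\<^esub> s n (f n x)"
    by (elim exE conjE)
  note s = s(1)[rule_format] s(2)[rule_format]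
  have "c (\<theta> (Suc m) x) \<ominus>\<^bsub>N\<^esub> c x = c (s m (f m x))" if x: "x \<in> carrier (P (Suc m))" for x
  proof -
    have sx: "s (Suc m) x \<in> carrier (P (Suc (Suc m)))" "s m (f m x) \<in> carrier (P (Suc m))"
      "f (Suc m) (s (Suc m) x) \<in> carrier (P (Suc m))"
      using lmod_homD(1)[OF s(1) x] lmod_homD(1)[OF s(1) lmod_homD(1)[OF P.diff x]]
        lmod_homD(1)[OF P.diff lmod_homD(1)[OF s(1) x]] by simp_all
    have "c (\<theta> (Suc m) x) \<ominus>\<^bsub>N\<^esub> c x = c (?\<theta> (Suc m) x)"
      by (rule lmod_hom_minus[OF P.lm N c(1) \<theta>c[OF x] x, symmetric])
    also have "\<dots> = c (f (Suc m) (s (Suc m) x)) \<oplus>\<^bsub>N\<^esub> c (s m (f m x))"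
      unfolding s(2)[OF x] by (rule lmod_homD(2)[OF c(1) sx(3,2)])
    also have "\<dots> = c (s m (f m x))" using c(2) sx(1) lmod_homD(1)[OF c(1) sx(2)] by simp
    finally show ?thesis .
  qed
  then show ?thesis
    unfolding hom_coboundary_def by (intro bexI[of _ "\<lambda>y. c (s m y)"] lmod_hom_comp[OF s(1) c(1)]) simp
qed

section \<open>Ext\<close>

lemma dual_cocycles_iff:
  "c \<in> dual_cocycles R P f n \<longleftrightarrow> c \<in> carrier (dual_module R (P n)) \<and>
     (\<forall>x\<in>carrier (P (Suc n)). c (f n x) = \<zero>\<^bsub>R\<^esub>)"
  unfolding dual_cocycles_def a_kernel_iff
  by (auto simp: dual_map_def restrict_def fun_eq_iff)

lemma (in projective_complex) dual_coboundaries_iff: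
  "c \<in> dual_coboundaries R P f (Suc m) \<longleftrightarrow> c \<in> carrier (dual_module R (P (Suc m))) \<and>
     hom_coboundary R P f (regular_module R) m c"
proof
  assume "c \<in> dual_coboundaries R P f (Suc m)"
  then obtain t where t: "t \<in> carrier (dual_module R (P m))" "c = dual_map (P (Suc m)) (f m) t"
    unfolding dual_coboundaries_def by (simp, elim imageE)
  then show "c \<in> carrier (dual_module R (P (Suc m))) \<and> hom_coboundary R P f (regular_module R) m c"
    unfolding hom_coboundary_def using lmod_homD(1)[OF dual_map_hom[OF lm lm diff] t(1)] dualD(1)[OF t(1)]
    by (intro conjI bexI[of _ t]) simp_all
next
  assume *: "c \<in> carrier (dual_module R (P (Suc m))) \<and> hom_coboundary R P f (regular_module R) m c"
  then obtain t where t: "t \<in> lmod_hom R (P m) (regular_module R)" "\<forall>x\<in>carrier (P (Suc m)). c x = t (f m x)"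
    unfolding hom_coboundary_def by (elim conjE bexE)
  have "c = dual_map (P (Suc m)) (f m) (restrict t (carrier (P m)))"
    using t(2) lmod_homD(1)[OF diff] dualD(2)[OF conjunct1[OF *]] by (intro dual_eqI[of _ "P (Suc m)"]) simp_all
  then show "c \<in> dual_coboundaries R P f (Suc m)"
    unfolding dual_coboundaries_def using restrict_dual[OF lm t(1)] by simp
qed

lemma (in projective_complex) dual_cocycles_submodule:
  "submodule (dual_cocycles R P f n) (op_ring R) (dual_module R (P n))"
  unfolding dual_cocycles_def by (intro submodule_a_kernel left_module_dual lm dual_map_hom diff)

lemma (in projective_complex) dual_coboundaries_submodule:
  "submodule (dual_coboundaries R P f n) (op_ring R) ((dual_module R (P n))\<lparr>carrier := dual_cocycles R P f n\<rparr>)"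
  unfolding submodule_of_submodule_iff[OF left_module_dual[OF lm] dual_cocycles_submodule]
proof (cases n)
  case 0
  interpret D: left_module "op_ring R" "dual_module R (P 0)" by (rule left_module_dual[OF lm])
  have "submodule {\<zero>\<^bsub>dual_module R (P 0)\<^esub>} (op_ring R) (dual_module R (P 0))"
    by (rule D.submoduleI) (auto simp del: dual_module_simps simp: D.smult_r_null)
  moreover have "\<zero>\<^bsub>dual_module R (P 0)\<^esub> \<in> dual_cocycles R P f 0"
    by (rule left_module.submoduleD(2)[OF left_module_dual[OF lm] dual_cocycles_submodule])
  ultimately show "submodule (dual_coboundaries R P f n) (op_ring R) (dual_module R (P n)) \<and>
      dual_coboundaries R P f n \<subseteq> dual_cocycles R P f n"
    unfolding 0 dual_coboundaries_def by simp
next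
  case (Suc m)
  have "submodule (dual_coboundaries R P f (Suc m)) (op_ring R) (dual_module R (P (Suc m)))"
    unfolding dual_coboundaries_def by (simp, intro submodule_hom_image left_module_dual lm dual_map_hom diff)
  moreover have "dual_coboundaries R P f (Suc m) \<subseteq> dual_cocycles R P f (Suc m)"
  proof
    fix c assume "c \<in> dual_coboundaries R P f (Suc m)"
    then have c: "c \<in> carrier (dual_module R (P (Suc m)))" "hom_coboundary R P f (regular_module R) m c"
      unfolding dual_coboundaries_iff by simp_all
    obtain t where t: "t \<in> lmod_hom R (P m) (regular_module R)" "\<forall>x\<in>carrier (P (Suc m)). c x = t (f m x)"
      using c(2) unfolding hom_coboundary_def by (elim bexE)
    have "t \<zero>\<^bsub>P m\<^esub> = \<zero>\<^bsub>R\<^esub>" using lmod_hom_zero[OF lm left_module_regular[OF ring] t(1)] by simp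
    then show "c \<in> dual_cocycles R P f (Suc m)"
      unfolding dual_cocycles_iff using c(1) t(2) lmod_homD(1)[OF diff] diff_diff by simp
  qed
  ultimately show "submodule (dual_coboundaries R P f n) (op_ring R) (dual_module R (P n)) \<and>
      dual_coboundaries R P f n \<subseteq> dual_cocycles R P f n"
    unfolding Suc by (rule conjI)
qed

text \<open>If the quotient of cocycles by coboundaries is zero, the kernel of its projection
  contains all cocycles. What is left is the passage from arbitrary functions to extensional ones,
  by \<open>restrict\<close>.\<close>

lemma hom_exact_at_of_Ext_zero:
  assumes "projective_complex R P f"
    and ch: "chosen_resolution R X = (P, f)" and z: "zero_module (Ext R n X)"
  shows "hom_exact_at R P f (regular_module R) n"
proof -
  interpret projective_complex R P f by fact
  let ?Z = "dual_cocycles R P f n" and ?B = "dual_coboundaries R P f n"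
  let ?D = "(dual_module R (P n))\<lparr>carrier := ?Z\<rparr>"
  note D = submodule_left_module[OF left_module_dual[OF lm] dual_cocycles_submodule[of n]]
  obtain q where q: "q \<in> lmod_hom (op_ring R) ?D (quotient_module ?D ?B)"
    "q ` carrier ?D = carrier (quotient_module ?D ?B)" "a_kernel ?D (quotient_module ?D ?B) q = ?B"
    by (rule quotient_projection[OF D dual_coboundaries_submodule])
  have "carrier (quotient_module ?D ?B) = {\<zero>\<^bsub>quotient_module ?D ?B\<^esub>}"
    using z unfolding zero_module_def Ext_def ch by (simp del: quotient_module_simps)
  then have "q c = \<zero>\<^bsub>quotient_module ?D ?B\<^esub>" if "c \<in> ?Z" for c
    using lmod_homD(1)[OF q(1), of c] that by simp
  then have "c \<in> a_kernel ?D (quotient_module ?D ?B) q" if "c \<in> ?Z" for c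
    using that by (simp add: a_kernel_iff del: quotient_module_simps)
  then have ZB: "c \<in> ?B" if "c \<in> ?Z" for c
    using that unfolding q(3) .
  have ext: "\<exists>c\<in>?Z. \<forall>x\<in>carrier (P n). c x = h x"
    if h: "h \<in> lmod_hom R (P n) (regular_module R)" "\<forall>x\<in>carrier (P (Suc n)). h (f n x) = \<zero>\<^bsub>regular_module R\<^esub>" for h
    using restrict_dual[OF lm h(1)] h(2) lmod_homD(1)[OF diff]
    by (intro bexI[of _ "restrict h (carrier (P n))"]) (simp_all add: dual_cocycles_iff)
  show ?thesis
  proof (cases n)
    case 0
    show ?thesis
      unfolding 0
    proof (rule hom_exact_at_0I)
      fix h x assume h: "h \<in> lmod_hom R (P 0) (regular_module R)" "\<forall>x\<in>carrier (P (Suc 0)). h (f 0 x) = \<zero>\<^bsub>regular_module R\<^esub>"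
        and x: "x \<in> carrier (P 0)"
      obtain c where c: "c \<in> ?Z" "\<forall>x\<in>carrier (P n). c x = h x" using ext[unfolded 0, OF h] unfolding 0 by (elim bexE)
      have "c = \<zero>\<^bsub>dual_module R (P 0)\<^esub>" using ZB[OF c(1)] unfolding 0 dual_coboundaries_def by simp
      then show "h x = \<zero>\<^bsub>regular_module R\<^esub>" using c(2) x unfolding 0 by simp
    qed
  next
    case (Suc m)
    show ?thesis
      unfolding Suc
    proof (rule hom_exact_at_SucI)
      fix h assume h: "h \<in> lmod_hom R (P (Suc m)) (regular_module R)"
        "\<forall>x\<in>carrier (P (Suc (Suc m))). h (f (Suc m) x) = \<zero>\<^bsub>regular_module R\<^esub>"
      obtain c where c: "c \<in> ?Z" "\<forall>x\<in>carrier (P n). c x = h x" using ext[unfolded Suc, OF h] unfolding Suc by (elim bexE)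
      have "hom_coboundary R P f (regular_module R) m c"
        using ZB[OF c(1)] unfolding Suc dual_coboundaries_iff by simp
      then show "\<exists>t\<in>lmod_hom R (P m) (regular_module R). \<forall>x\<in>carrier (P (Suc m)). h x = t (f m x)"
        unfolding hom_coboundary_def using c(2) unfolding Suc by simp
    qed
  qed
qed

text \<open>Hilbert choice fixes the resolution inside \<open>Ext\<close>, whereas the main argument
  needs the one that starts with the dual presentation. Chain maps in both directions relate the
  two: cocycles are pulled back along \<open>\<psi>\<close>, and the homotopies yield surjectivity
  and the kernel.\<close>

lemma Ext_of_resolution:
  assumes ch: "chosen_resolution R X = (P', f')" and r': "projective_resolution R X P' f' e'"
    and r: "projective_resolution R X P f e"
  shows "\<exists>q\<in>lmod_hom (op_ring R) ((dual_module R (P (Suc m)))\<lparr>carrier := dual_cocycles R P f (Suc m)\<rparr>) (Ext R (Suc m) X).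
    q ` dual_cocycles R P f (Suc m) = carrier (Ext R (Suc m) X) \<and>
    a_kernel ((dual_module R (P (Suc m)))\<lparr>carrier := dual_cocycles R P f (Suc m)\<rparr>) (Ext R (Suc m) X) q =
      dual_coboundaries R P f (Suc m)"
proof -
  interpret P: projective_complex R P f by (rule projective_resolution_complex[OF r])
  interpret P': projective_complex R P' f' by (rule projective_resolution_complex[OF r'])
  let ?n = "Suc m"
  let ?Z = "dual_cocycles R P f ?n" and ?B = "dual_coboundaries R P f ?n"
  let ?Z' = "dual_cocycles R P' f' ?n" and ?B' = "dual_coboundaries R P' f' ?n"
  let ?D = "(dual_module R (P ?n))\<lparr>carrier := ?Z\<rparr>" and ?D' = "(dual_module R (P' ?n))\<lparr>carrier := ?Z'\<rparr>"
  let ?reg = "regular_module R"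
  note reg = left_module_regular[OF P.ring]
  interpret reg: left_module R ?reg by (rule reg)
  have E: "Ext R ?n X = quotient_module ?D' ?B'" unfolding Ext_def ch by simp
  note LD = submodule_left_module[OF left_module_dual[OF P.lm] P.dual_cocycles_submodule[of ?n]]
  note LD' = submodule_left_module[OF left_module_dual[OF P'.lm] P'.dual_cocycles_submodule[of ?n]]
  obtain q where q: "q \<in> lmod_hom (op_ring R) ?D' (quotient_module ?D' ?B')"
    "q ` carrier ?D' = carrier (quotient_module ?D' ?B')" "a_kernel ?D' (quotient_module ?D' ?B') q = ?B'"
    by (rule quotient_projection[OF LD' P'.dual_coboundaries_submodule])
  note LQ = left_module_quotient[OF LD' P'.dual_coboundaries_submodule]
  obtain \<phi> where \<phi>: "\<forall>n. \<phi> n \<in> lmod_hom R (P n) (P' n)" "\<forall>x\<in>carrier (P 0). e' (\<phi> 0 x) = e x"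
    "\<forall>n. \<forall>x\<in>carrier (P (Suc n)). f' n (\<phi> (Suc n) x) = \<phi> n (f n x)"
    using chain_map_exists[OF r r'] by (elim exE conjE)
  obtain \<psi> where \<psi>: "\<forall>n. \<psi> n \<in> lmod_hom R (P' n) (P n)" "\<forall>x\<in>carrier (P' 0). e (\<psi> 0 x) = e' x"
    "\<forall>n. \<forall>x\<in>carrier (P' (Suc n)). f n (\<psi> (Suc n) x) = \<psi> n (f' n x)"
    using chain_map_exists[OF r' r] by (elim exE conjE)
  note \<phi>h = \<phi>(1)[rule_format] and \<psi>h = \<psi>(1)[rule_format]
  note \<phi>c = lmod_homD(1)[OF \<phi>h] and \<psi>c = lmod_homD(1)[OF \<psi>h]
  have pull: "dual_map (A ?n) (\<alpha> ?n) c \<in> dual_cocycles R A a ?n"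
    "hom_coboundary R B b ?reg m c \<Longrightarrow> hom_coboundary R A a ?reg m (dual_map (A ?n) (\<alpha> ?n) c)"
    if "projective_complex R A a" and "projective_complex R B b" and \<alpha>: "\<forall>n. \<alpha> n \<in> lmod_hom R (A n) (B n)"
      "\<forall>n. \<forall>x\<in>carrier (A (Suc n)). b n (\<alpha> (Suc n) x) = \<alpha> n (a n x)"
      and c: "c \<in> dual_cocycles R B b ?n" for A a B b \<alpha> c
  proof -
    interpret A: projective_complex R A a by fact
    interpret B: projective_complex R B b by fact
    note \<alpha> = \<alpha>(1)[rule_format] \<alpha>(2)[rule_format]
    have cD: "c \<in> carrier (dual_module R (B ?n))" "\<And>x. x \<in> carrier (B (Suc ?n)) \<Longrightarrow> c (b ?n x) = \<zero>\<^bsub>R\<^esub>"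
      using c unfolding dual_cocycles_iff by simp_all
    show "dual_map (A ?n) (\<alpha> ?n) c \<in> dual_cocycles R A a ?n"
      unfolding dual_cocycles_iff
      using lmod_homD(1)[OF dual_map_hom[OF A.lm B.lm \<alpha>(1)] cD(1)] cD(2) lmod_homD(1)[OF A.diff]
        lmod_homD(1)[OF \<alpha>(1)] \<alpha>(2)[symmetric] by simp
    show "hom_coboundary R A a ?reg m (dual_map (A ?n) (\<alpha> ?n) c)" if cb: "hom_coboundary R B b ?reg m c"
    proof -
      obtain t where t: "t \<in> lmod_hom R (B m) ?reg" "\<forall>x\<in>carrier (B (Suc m)). c x = t (b m x)"
        using cb unfolding hom_coboundary_def by (elim bexE)
      show ?thesis
        unfolding hom_coboundary_def
        using t(2) lmod_homD(1)[OF \<alpha>(1)] \<alpha>(2)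
        by (intro bexI[of _ "\<lambda>x. t (\<alpha> m x)"] lmod_hom_comp[OF \<alpha>(1) t(1)]) simp
    qed
  qed
  note pull\<psi> = pull[OF P'.projective_complex_axioms P.projective_complex_axioms \<psi>(1,3)]
  note pull\<phi> = pull[OF P.projective_complex_axioms P'.projective_complex_axioms \<phi>(1,3)]
  let ?\<Psi> = "dual_map (P' ?n) (\<psi> ?n)" and ?\<Phi> = "dual_map (P ?n) (\<phi> ?n)"
  have cob_sub: "hom_coboundary R A a ?reg m c \<longleftrightarrow> hom_coboundary R A a ?reg m c'"
    if "projective_complex R A a" and d: "hom_coboundary R A a ?reg m (\<lambda>x. c x \<ominus>\<^bsub>?reg\<^esub> c' x)"
      and c: "\<And>x. x \<in> carrier (A ?n) \<Longrightarrow> c x \<in> carrier R" "\<And>x. x \<in> carrier (A ?n) \<Longrightarrow> c' x \<in> carrier R"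
    for A a c c'
  proof -
    interpret A: projective_complex R A a by fact
    obtain t where t: "t \<in> lmod_hom R (A m) ?reg" "\<forall>x\<in>carrier (A (Suc m)). c x \<ominus>\<^bsub>?reg\<^esub> c' x = t (a m x)"
      using d unfolding hom_coboundary_def by (elim bexE)
    note can = a_minus_add_cancel[OF reg.M.abelian_group_axioms]
    show ?thesis
    proof
      assume "hom_coboundary R A a ?reg m c"
      then obtain u where u: "u \<in> lmod_hom R (A m) ?reg" "\<forall>x\<in>carrier (A (Suc m)). c x = u (a m x)"
        unfolding hom_coboundary_def by (elim bexE)
      have "c' x = u (a m x) \<ominus>\<^bsub>?reg\<^esub> t (a m x)" if x: "x \<in> carrier (A (Suc m))" for x
        using u(2) t(2) can(2)[of "c' x" "c x"] c[OF x] x by simp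
      then show "hom_coboundary R A a ?reg m c'"
        unfolding hom_coboundary_def by (intro bexI[of _ "\<lambda>x. u x \<ominus>\<^bsub>?reg\<^esub> t x"] lmod_hom_diff A.lm reg u(1) t(1)) simp
    next
      assume "hom_coboundary R A a ?reg m c'"
      then obtain u where u: "u \<in> lmod_hom R (A m) ?reg" "\<forall>x\<in>carrier (A (Suc m)). c' x = u (a m x)"
        unfolding hom_coboundary_def by (elim bexE)
      have "c x = t (a m x) \<oplus>\<^bsub>?reg\<^esub> u (a m x)" if x: "x \<in> carrier (A (Suc m))" for x
        using u(2) t(2) can(1)[of "c x" "c' x"] c[OF x] x by simp
      then show "hom_coboundary R A a ?reg m c"
        unfolding hom_coboundary_def by (intro bexI[of _ "\<lambda>x. t x \<oplus>\<^bsub>?reg\<^esub> u x"] lmod_hom_plus A.lm reg u(1) t(1)) simp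
    qed
  qed
  have ZD: "c \<in> carrier (dual_module R (P ?n))" "\<forall>x\<in>carrier (P (Suc ?n)). c (f ?n x) = \<zero>\<^bsub>?reg\<^esub>"
    if "c \<in> ?Z" for c using that unfolding dual_cocycles_iff by simp_all
  have ZD': "c \<in> carrier (dual_module R (P' ?n))" "\<forall>x\<in>carrier (P' (Suc ?n)). c (f' ?n x) = \<zero>\<^bsub>?reg\<^esub>"
    if "c \<in> ?Z'" for c using that unfolding dual_cocycles_iff by simp_all
  \<comment> \<open>Both composites of the comparison maps are homotopic to the identity:
    \<open>hom1\<close> will determine the kernel of \<open>?r\<close>, \<open>hom2\<close> its
    surjectivity.\<close>
  have hom1: "hom_coboundary R P f ?reg m (\<lambda>x. c (\<psi> ?n (\<phi> ?n x)) \<ominus>\<^bsub>?reg\<^esub> c x)" if c: "c \<in> ?Z" for c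
    using homotopic_to_id[OF r, of "\<lambda>n x. \<psi> n (\<phi> n x)", OF lmod_hom_comp[OF \<phi>h \<psi>h] _ _ reg dualD(1)[OF ZD(1)[OF c]] ZD(2)[OF c]]
      \<phi>(2,3) \<psi>(2,3) \<phi>c by simp
  have hom2: "hom_coboundary R P' f' ?reg m (\<lambda>x. c (\<phi> ?n (\<psi> ?n x)) \<ominus>\<^bsub>?reg\<^esub> c x)" if c: "c \<in> ?Z'" for c
    using homotopic_to_id[OF r', of "\<lambda>n x. \<phi> n (\<psi> n x)", OF lmod_hom_comp[OF \<psi>h \<phi>h] _ _ reg dualD(1)[OF ZD'(1)[OF c]] ZD'(2)[OF c]]
      \<phi>(2,3) \<psi>(2,3) \<psi>c by simp
  have \<Psi>B: "?\<Psi> c \<in> ?B' \<longleftrightarrow> c \<in> ?B" if c: "c \<in> ?Z" for c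
  proof -
    have \<Psi>c: "?\<Psi> c \<in> ?Z'" by (rule pull\<psi>(1)[OF c])
    have "hom_coboundary R P f ?reg m c" if "hom_coboundary R P' f' ?reg m (?\<Psi> c)"
    proof -
      have "hom_coboundary R P f ?reg m (?\<Phi> (?\<Psi> c))" by (rule pull\<phi>(2)[OF \<Psi>c that])
      then have "hom_coboundary R P f ?reg m (\<lambda>x. c (\<psi> ?n (\<phi> ?n x)))"
        unfolding hom_coboundary_def using \<phi>c by simp
      then show ?thesis
        using cob_sub[OF P.projective_complex_axioms hom1[OF c]] dualD(3)[OF ZD(1)[OF c]] \<phi>c \<psi>c by simp
    qed
    then show ?thesis
      unfolding P.dual_coboundaries_iff P'.dual_coboundaries_iff using pull\<psi>(2)[OF c] ZD(1)[OF c] ZD'(1)[OF \<Psi>c] by blast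
  qed
  have \<Psi>hom: "?\<Psi> \<in> lmod_hom (op_ring R) ?D ?D'"
    using pull\<psi>(1) left_module.submoduleD(1)[OF left_module_dual[OF P.lm] P.dual_cocycles_submodule]
    by (intro lmod_hom_into_submodule lmod_hom_from_submodule[OF left_module_dual[OF P.lm] P.dual_cocycles_submodule]
        dual_map_hom P.lm P'.lm \<psi>h) simp
  let ?r = "\<lambda>c. q (?\<Psi> c)"
  have "?r \<in> lmod_hom (op_ring R) ?D (Ext R ?n X)" unfolding E by (rule lmod_hom_comp[OF \<Psi>hom q(1)])
  moreover have "?r ` ?Z = carrier (Ext R ?n X)"
  proof
    show "?r ` ?Z \<subseteq> carrier (Ext R ?n X)"
      unfolding E using lmod_homD(1)[OF lmod_hom_comp[OF \<Psi>hom q(1)]] by (intro image_subsetI) simp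
    show "carrier (Ext R ?n X) \<subseteq> ?r ` ?Z"
    proof
      fix y assume "y \<in> carrier (Ext R ?n X)"
      then have "y \<in> q ` ?Z'" unfolding E q(2)[symmetric] by simp
      then obtain c' where c': "y = q c'" "c' \<in> ?Z'" by (rule imageE)
      have \<Phi>: "?\<Phi> c' \<in> ?Z" by (rule pull\<phi>(1)[OF c'(2)])
      have \<Psi>\<Phi>: "?\<Psi> (?\<Phi> c') \<in> ?Z'" by (rule pull\<psi>(1)[OF \<Phi>])
      interpret D': left_module "op_ring R" ?D' by (rule LD')
      have d: "?\<Psi> (?\<Phi> c') \<ominus>\<^bsub>?D'\<^esub> c' \<in> ?Z'" using D'.M.minus_closed[of "?\<Psi> (?\<Phi> c')" c'] \<Psi>\<Phi> c'(2) by simp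
      have ev: "(\<lambda>\<xi>. \<xi> x) \<in> lmod_hom (op_ring R) ?D' (regular_module (op_ring R))" if "x \<in> carrier (P' ?n)" for x
        by (rule lmod_hom_from_submodule[OF left_module_dual[OF P'.lm] P'.dual_cocycles_submodule dual_eval_hom[OF that]])
      \<comment> \<open>Subtraction involves only the carrier, addition and zero, on which
        \<open>R\<close> and its opposite agree.\<close>
      have reg_op: "x \<ominus>\<^bsub>regular_module (op_ring R)\<^esub> y = x \<ominus>\<^bsub>?reg\<^esub> y" for x y
        by (simp add: a_minus_def a_inv_def)
      have "(?\<Psi> (?\<Phi> c') \<ominus>\<^bsub>?D'\<^esub> c') x = c' (\<phi> ?n (\<psi> ?n x)) \<ominus>\<^bsub>?reg\<^esub> c' x" if x: "x \<in> carrier (P' ?n)" for x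
        using lmod_hom_minus[OF LD' left_module_regular[OF ring_op_ring[OF P.ring]] ev[OF x], of "?\<Psi> (?\<Phi> c')" c'] \<Psi>\<Phi> c'(2) x \<psi>c[OF x]
        by (simp add: reg_op)
      then have "hom_coboundary R P' f' ?reg m (?\<Psi> (?\<Phi> c') \<ominus>\<^bsub>?D'\<^esub> c')"
        using hom2[OF c'(2)] unfolding hom_coboundary_def by simp
      then have "?\<Psi> (?\<Phi> c') \<ominus>\<^bsub>?D'\<^esub> c' \<in> ?B'" unfolding P'.dual_coboundaries_iff using ZD'(1)[OF d] by simp
      then have "?\<Psi> (?\<Phi> c') \<ominus>\<^bsub>?D'\<^esub> c' \<in> a_kernel ?D' (quotient_module ?D' ?B') q" unfolding q(3) .
      then have "q (?\<Psi> (?\<Phi> c') \<ominus>\<^bsub>?D'\<^esub> c') = \<zero>\<^bsub>quotient_module ?D' ?B'\<^esub>"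
        unfolding a_kernel_iff by (rule conjunct2)
      then have "q (?\<Psi> (?\<Phi> c')) \<ominus>\<^bsub>quotient_module ?D' ?B'\<^esub> q c' = \<zero>\<^bsub>quotient_module ?D' ?B'\<^esub>"
        using lmod_hom_minus[OF LD' LQ q(1), of "?\<Psi> (?\<Phi> c')" c'] \<Psi>\<Phi> c'(2) by (simp del: quotient_module_simps)
      then have "q (?\<Psi> (?\<Phi> c')) = q c'"
        using a_minus_eq_zero_iff[OF left_module_group[OF LQ], of "q (?\<Psi> (?\<Phi> c'))" "q c'"] lmod_homD(1)[OF q(1)] \<Psi>\<Phi> c'(2)
        by (simp del: quotient_module_simps)
      then show "y \<in> ?r ` ?Z" using \<Phi> c'(1) by (intro image_eqI[of _ _ "?\<Phi> c'"]) simp_all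
    qed
  qed
  moreover have "a_kernel ?D (Ext R ?n X) ?r = ?B"
  proof -
    have BZ: "c \<in> ?Z" if "c \<in> ?B" for c
      using left_module.submoduleD(1)[OF LD P.dual_coboundaries_submodule] that by auto
    have "c \<in> ?Z \<and> q (?\<Psi> c) = \<zero>\<^bsub>quotient_module ?D' ?B'\<^esub> \<longleftrightarrow> c \<in> ?B" for c
    proof -
      have "q (?\<Psi> c) = \<zero>\<^bsub>quotient_module ?D' ?B'\<^esub> \<longleftrightarrow> ?\<Psi> c \<in> ?B'" if c: "c \<in> ?Z"
        using pull\<psi>(1)[OF c] a_kernel_iff[of "?\<Psi> c" ?D' "quotient_module ?D' ?B'" q] unfolding q(3)
        by (simp del: quotient_module_simps)
      then show ?thesis using \<Psi>B BZ by blast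
    qed
    then show ?thesis unfolding E set_eq_iff a_kernel_iff by simp
  qed
  ultimately show ?thesis by (intro bexI[of _ ?r] conjI)
qed

section \<open>Syzygies and projective dimension\<close>

lemma fg_projective_iso:
  assumes "fg_projective R P" "left_module R Q" "lmod_iso R P Q"
  shows "fg_projective R Q"
proof -
  obtain h h' where h: "h \<in> lmod_hom R P Q" "h' \<in> lmod_hom R Q P" "inj_on h (carrier P)"
    "h ` carrier P = carrier Q" "inj_on h' (carrier Q)" "h' ` carrier Q = carrier P"
    "\<forall>x\<in>carrier P. h' (h x) = x" "\<forall>y\<in>carrier Q. h (h' y) = y"
    by (rule lmod_isoE[OF assms(3) fg_projective_left_module[OF assms(1)]])
  show ?thesis using fg_projective_transfer[OF assms(1,2) h(1,2)] h(8) by simp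
qed

lemma fg_module_iso:
  assumes "fg_module R M" "left_module R N" "lmod_iso R M N"
  shows "fg_module R N"
proof -
  obtain h where "h \<in> lmod_hom R M N" "bij_betw h (carrier M) (carrier N)"
    using assms(3) unfolding lmod_iso_def by (elim bexE)
  then show ?thesis using fg_module_image[OF assms(1,2)] by (simp add: bij_betw_def)
qed

lemma short_exact_iso:
  assumes e: "short_exact R L M N i \<pi>"
    and h: "left_module R L'" "h \<in> lmod_hom R L' L" "inj_on h (carrier L')" "h ` carrier L' = carrier L"
    and k: "left_module R M'" "k \<in> lmod_hom R M M'" "k' \<in> lmod_hom R M' M"
      "\<forall>x\<in>carrier M. k' (k x) = x" "\<forall>y\<in>carrier M'. k (k' y) = y"
  shows "short_exact R L' M' N (\<lambda>x. k (i (h x))) (\<lambda>y. \<pi> (k' y))"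
proof -
  note e' = short_exactD[OF e]
  note c = lmod_homD(1)[OF h(2)] lmod_homD(1)[OF e'(4)] lmod_homD(1)[OF k(2)] lmod_homD(1)[OF k(3)]
  show ?thesis
  proof (rule short_exactI[OF h(1) k(1) e'(3)])
    show "(\<lambda>x. k (i (h x))) \<in> lmod_hom R L' M'" by (intro lmod_hom_comp[OF h(2)] lmod_hom_comp[OF e'(4)] k(2))
    show "(\<lambda>y. \<pi> (k' y)) \<in> lmod_hom R M' N" by (rule lmod_hom_comp[OF k(3) e'(5)])
    show "x = \<zero>\<^bsub>L'\<^esub>" if x: "x \<in> carrier L'" "k (i (h x)) = \<zero>\<^bsub>M'\<^esub>" for x
    proof -
      have "i (h x) = k' \<zero>\<^bsub>M'\<^esub>" using k(4) c(2)[OF c(1)[OF x(1)]] x(2) by metis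
      then have "i (h x) = \<zero>\<^bsub>M\<^esub>" using lmod_hom_zero[OF k(1) e'(2) k(3)] by simp
      then have "h x = \<zero>\<^bsub>L\<^esub>" using e'(6) c(1)[OF x(1)] unfolding lmod_hom_inj_iff[OF e'(1,2,4)] by simp
      then show ?thesis using h(3) x(1) unfolding lmod_hom_inj_iff[OF h(1) e'(1) h(2)] by simp
    qed
    show "\<pi> (k' (k (i (h x)))) = \<zero>\<^bsub>N\<^esub>" if x: "x \<in> carrier L'" for x
      using e'(9)[OF c(1)[OF x]] k(4) c(2)[OF c(1)[OF x]] by simp
    show "\<exists>x\<in>carrier L'. k (i (h x)) = y" if y: "y \<in> carrier M'" "\<pi> (k' y) = \<zero>\<^bsub>N\<^esub>" for y
    proof -
      obtain z where z: "z \<in> carrier L" "i z = k' y" using e'(10)[OF c(4)[OF y(1)] y(2)] by (elim bexE)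
      have "z \<in> h ` carrier L'" using z(1) h(4) by simp
      then obtain x where x: "z = h x" "x \<in> carrier L'" by (rule imageE)
      show ?thesis using x z k(5) y(1) by (intro bexI[of _ x]) simp_all
    qed
    show "\<exists>y\<in>carrier M'. \<pi> (k' y) = z" if z: "z \<in> carrier N" for z
    proof -
      have "z \<in> \<pi> ` carrier M" using z e'(8) by simp
      then obtain x where x: "z = \<pi> x" "x \<in> carrier M" by (rule imageE)
      show ?thesis using x k(4) c(3) by (intro bexI[of _ "k x"]) simp_all
    qed
  qed
qed

text \<open>Splicing requires all terms in one type. \<open>N\<close> may keep its own, since at
  that place the splice composes with an isomorphism anyway.\<close>

lemma short_exact_univ:
  assumes e: "short_exact R (L :: ('a, 'l) module) (M :: ('a, 'm) module) N i \<pi>" and "fg_module R L" "fg_module R M"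
  obtains L' M' :: "('a, 'a univ) module" and i' \<pi>' where "short_exact R L' M' N i' \<pi>'"
    "lmod_iso R L' L" "lmod_iso R M M'"
proof -
  obtain L' :: "('a, 'a univ) module" and h h' where h: "fg_module R L'" "left_module R L'"
    "h \<in> lmod_hom R L L'" "h' \<in> lmod_hom R L' L" "inj_on h (carrier L)" "h ` carrier L = carrier L'"
    "inj_on h' (carrier L')" "h' ` carrier L' = carrier L"
    "\<forall>x\<in>carrier L. h' (h x) = x" "\<forall>y\<in>carrier L'. h (h' y) = y"
    by (rule fg_module_univ[OF assms(2)])
  obtain M' :: "('a, 'a univ) module" and k k' where k: "fg_module R M'" "left_module R M'"
    "k \<in> lmod_hom R M M'" "k' \<in> lmod_hom R M' M" "inj_on k (carrier M)" "k ` carrier M = carrier M'"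
    "inj_on k' (carrier M')" "k' ` carrier M' = carrier M"
    "\<forall>x\<in>carrier M. k' (k x) = x" "\<forall>y\<in>carrier M'. k (k' y) = y"
    by (rule fg_module_univ[OF assms(3)])
  show thesis
    by (rule that[OF short_exact_iso[OF e h(2,4,7,8) k(2,3,4,9,10)] lmod_isoI[OF h(4,7,8)] lmod_isoI[OF k(3,5,6)]])
qed

section \<open>Modules that are syzygies\<close>

lemma syzygy_module_0:
  assumes "fg_module R (M :: ('a, 'm) module)" shows "syzygy_module R 0 M"
proof -
  obtain L' :: "('a, 'a univ) module" and h h' where h: "fg_module R L'" "left_module R L'"
    "h \<in> lmod_hom R M L'" "h' \<in> lmod_hom R L' M" "inj_on h (carrier M)" "h ` carrier M = carrier L'"
    "inj_on h' (carrier L')" "h' ` carrier L' = carrier M"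
    "\<forall>x\<in>carrier M. h' (h x) = x" "\<forall>y\<in>carrier L'. h (h' y) = y"
    by (rule fg_module_univ[OF assms])
  show ?thesis
    unfolding syzygy_module_def using assms h(2) lmod_isoI[OF h(4,7,8)]
    by (intro conjI exI[of _ "\<lambda>_. L'"] exI[of _ "\<lambda>_ x. x"]) simp_all
qed

lemma syzygy_module_iso:
  assumes "syzygy_module R n M" "lmod_iso R M N" "left_module R N"
  shows "syzygy_module R n N"
  using assms lmod_iso_trans[OF _ assms(2)] fg_module_iso[OF _ assms(3,2)]
  unfolding syzygy_module_def by (elim conjE exE) (intro conjI exI, simp_all)

lemma a_kernel_comp_inj:
  assumes "left_module R N" "left_module R T" "w \<in> lmod_hom R M N" "v \<in> lmod_hom R N T" "inj_on v (carrier N)"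
  shows "a_kernel M T (\<lambda>x. v (w x)) = a_kernel M N w"
proof -
  have "v (w x) = \<zero>\<^bsub>T\<^esub> \<longleftrightarrow> w x = \<zero>\<^bsub>N\<^esub>" if "x \<in> carrier M" for x
    using assms(5) lmod_homD(1)[OF assms(3) that] lmod_hom_zero[OF assms(1,2,4)]
    unfolding lmod_hom_inj_iff[OF assms(1,2,4)] by metis
  then show ?thesis unfolding set_eq_iff a_kernel_iff by metis
qed

text \<open>Splicing: \<open>Q\<close> becomes the term of index \<open>n\<close> and
  \<open>M\<close> that of index \<open>n + 1\<close>. Terms are numbered from the far end, so the
  projective terms for \<open>N\<close> keep their positions, and only the map out of
  \<open>Q\<close> has to pass through the identification of \<open>N\<close> with
  \<open>S n\<close>.\<close>

lemma syzygy_module_Suc: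
  assumes e0: "short_exact R (M :: ('a, 'm) module) (Q :: ('a, 'q) module) N i0 \<pi>0" and Q: "fg_projective R Q" and M: "fg_module R M"
    and N: "syzygy_module R n N"
  shows "syzygy_module R (Suc n) M"
proof -
  obtain M' Q' :: "('a, 'a univ) module" and i \<pi> where e: "short_exact R M' Q' N i \<pi>"
    and iso: "lmod_iso R M' M" "lmod_iso R Q Q'"
    by (rule short_exact_univ[OF e0 M fg_projective_fg[OF Q]])
  note e' = short_exactD[OF e]
  have Q': "fg_projective R Q'" by (rule fg_projective_iso[OF Q e'(2) iso(2)])
  obtain S :: "nat \<Rightarrow> ('a, 'a univ) module" and f where S: "left_module R (S n)" "lmod_iso R (S n) N"
    "\<forall>i<n. fg_projective R (S i)" "\<forall>i<n. f i \<in> lmod_hom R (S (Suc i)) (S i)"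
    "0 < n \<longrightarrow> inj_on (f (n - 1)) (carrier (S n))"
    "\<forall>i. Suc i < n \<longrightarrow> f (Suc i) ` carrier (S (Suc (Suc i))) = a_kernel (S (Suc i)) (S i) (f i)"
    using N unfolding syzygy_module_def by (elim conjE exE)
  obtain a a' where a: "a \<in> lmod_hom R (S n) N" "a' \<in> lmod_hom R N (S n)" "inj_on a (carrier (S n))"
    "a ` carrier (S n) = carrier N" "inj_on a' (carrier N)" "a' ` carrier N = carrier (S n)"
    "\<forall>x\<in>carrier (S n). a' (a x) = x" "\<forall>y\<in>carrier N. a (a' y) = y"
    by (rule lmod_isoE[OF S(2,1)])
  define S' where "S' j = (if j < n then S j else if j = n then Q' else M')" for j
  define w where "w x = a' (\<pi> x)" for x
  define f' where "f' j = (if j = n then i else if Suc j = n then (\<lambda>x. f j (w x)) else f j)" for j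
  have w: "w \<in> lmod_hom R Q' (S n)" unfolding w_def[abs_def] by (rule lmod_hom_comp[OF e'(5) a(2)])
  have w_im: "w ` carrier Q' = carrier (S n)" unfolding w_def[abs_def] using e'(8) a(6) by (metis image_image)
  have w_ker: "a_kernel Q' (S n) w = i ` carrier M'"
    unfolding w_def[abs_def] a_kernel_comp_inj[OF e'(3) S(1) e'(5) a(2,5)] e'(7) ..
  show ?thesis
    unfolding syzygy_module_def
  proof (intro conjI exI[of _ S'] exI[of _ f'] allI impI)
    show "fg_module R M" by (rule M)
    show "left_module R (S' (Suc n))" "lmod_iso R (S' (Suc n)) M" using e'(1) iso(1) by (simp_all add: S'_def)
    show "fg_projective R (S' j)" if "j < Suc n" for j using that S(3) Q' by (simp add: S'_def)
    show "f' j \<in> lmod_hom R (S' (Suc j)) (S' j)" if j: "j < Suc n" for j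
    proof (cases "j = n")
      case True
      then show ?thesis using e'(4) by (simp add: S'_def f'_def)
    next
      case False
      then have jn: "j < n" using j by simp
      show ?thesis
      proof (cases "Suc j = n")
        case True
        then show ?thesis
          using lmod_hom_comp[OF w, of "f j" "S j"] S(4) jn by (auto simp: S'_def f'_def)
      next
        case False
        then show ?thesis using S(4) jn by (simp add: S'_def f'_def)
      qed
    qed
    show "inj_on (f' (Suc n - 1)) (carrier (S' (Suc n)))" using e'(6) by (simp add: S'_def f'_def)
    show "f' (Suc j) ` carrier (S' (Suc (Suc j))) = a_kernel (S' (Suc j)) (S' j) (f' j)" if j: "Suc j < Suc n" for j
    proof (cases "Suc j = n")
      case True
      have fj: "f j \<in> lmod_hom R (S n) (S j)" "inj_on (f j) (carrier (S n))" "left_module R (S j)"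
        using S(3,4,5) True[symmetric] fg_projective_left_module by auto
      show ?thesis
        using a_kernel_comp_inj[OF S(1) fj(3) w fj(1,2)] w_ker True by (auto simp: S'_def f'_def)
    next
      case False
      then have jn: "Suc j < n" using j by simp
      show ?thesis
      proof (cases "Suc (Suc j) = n")
        case True
        have fw: "(\<lambda>x. f (Suc j) (w x)) ` carrier Q' = f (Suc j) ` carrier (S (Suc (Suc j)))"
          unfolding True using w_im by (metis image_image)
        have "S' (Suc (Suc j)) = Q'" "S' (Suc j) = S (Suc j)" "S' j = S j"
          "f' (Suc j) = (\<lambda>x. f (Suc j) (w x))" "f' j = f j"
          using True by (simp_all add: S'_def f'_def)
        moreover have "f (Suc j) ` carrier (S (Suc (Suc j))) = a_kernel (S (Suc j)) (S j) (f j)"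
          using S(6) jn by simp
        ultimately show ?thesis using fw by simp
      next
        case False
        then show ?thesis using S(6) jn by (simp add: S'_def f'_def)
      qed
    qed
  qed
qed

text \<open>The cokernel \<open>N\<close> of the first embedding is again a syzygy: by exactness the
  next map factors injectively through \<open>N\<close>, and the factor takes its place.\<close>

lemma syzygy_module_SucD:
  assumes "syzygy_module R (Suc n) (M :: ('a, 'm) module)"
  shows "\<exists>(Q :: ('a, 'a univ) module) (N :: ('a, 'a univ) module) i \<pi>.
    fg_projective R Q \<and> short_exact R M Q N i \<pi> \<and> syzygy_module R n N"
proof -
  obtain S :: "nat \<Rightarrow> ('a, 'a univ) module" and f where M: "fg_module R M" and S: "left_module R (S (Suc n))" "lmod_iso R (S (Suc n)) M"
    "\<forall>i<Suc n. fg_projective R (S i)" "\<forall>i<Suc n. f i \<in> lmod_hom R (S (Suc i)) (S i)"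
    "0 < Suc n \<longrightarrow> inj_on (f (Suc n - 1)) (carrier (S (Suc n)))"
    "\<forall>i. Suc i < Suc n \<longrightarrow> f (Suc i) ` carrier (S (Suc (Suc i))) = a_kernel (S (Suc i)) (S i) (f i)"
    using assms unfolding syzygy_module_def by (elim conjE exE)
  note LM = fg_module_left_module[OF M]
  have Q: "fg_projective R (S n)" using S(3) by simp
  note LQ = fg_projective_left_module[OF Q]
  have fn: "f n \<in> lmod_hom R (S (Suc n)) (S n)" "inj_on (f n) (carrier (S (Suc n)))" using S(4,5) by simp_all
  obtain a a' where a: "a \<in> lmod_hom R (S (Suc n)) M" "a' \<in> lmod_hom R M (S (Suc n))" "inj_on a (carrier (S (Suc n)))"
    "a ` carrier (S (Suc n)) = carrier M" "inj_on a' (carrier M)" "a' ` carrier M = carrier (S (Suc n))"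
    "\<forall>x\<in>carrier (S (Suc n)). a' (a x) = x" "\<forall>y\<in>carrier M. a (a' y) = y"
    by (rule lmod_isoE[OF S(2,1)])
  let ?I = "f n ` carrier (S (Suc n))"
  note I = submodule_hom_image[OF S(1) LQ fn(1)]
  obtain q where q: "q \<in> lmod_hom R (S n) (quotient_module (S n) ?I)" "q ` carrier (S n) = carrier (quotient_module (S n) ?I)"
    "a_kernel (S n) (quotient_module (S n) ?I) q = ?I"
    by (rule quotient_projection[OF LQ I])
  note Lquot = left_module_quotient[OF LQ I]
  have fgq: "fg_module R (quotient_module (S n) ?I)"
    by (rule fg_module_image[OF fg_projective_fg[OF Q] Lquot q(1,2)])
  obtain N :: "('a, 'a univ) module" and h where h: "left_module R N" "h \<in> lmod_hom R (quotient_module (S n) ?I) N"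
    "inj_on h (carrier (quotient_module (S n) ?I))" "h ` carrier (quotient_module (S n) ?I) = carrier N"
    by (rule left_module_embed_univ[OF fgq])
  define \<pi> where "\<pi> x = h (q x)" for x
  have \<pi>: "\<pi> \<in> lmod_hom R (S n) N" unfolding \<pi>_def[abs_def] by (rule lmod_hom_comp[OF q(1) h(2)])
  have \<pi>im: "\<pi> ` carrier (S n) = carrier N" unfolding \<pi>_def[abs_def] using q(2) h(4) by (metis image_image)
  have \<pi>ker: "a_kernel (S n) N \<pi> = ?I"
    unfolding \<pi>_def[abs_def] a_kernel_comp_inj[OF Lquot h(1) q(1) h(2,3)] by (rule q(3))
  have fgN: "fg_module R N" by (rule fg_module_image[OF fg_projective_fg[OF Q] h(1) \<pi> \<pi>im])
  let ?i = "\<lambda>x. f n (a' x)"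
  have "short_exact R M (S n) N ?i \<pi>"
    unfolding short_exact_def
  proof (intro conjI LM LQ h(1) \<pi> \<pi>im)
    show "?i \<in> lmod_hom R M (S n)" by (rule lmod_hom_comp[OF a(2) fn(1)])
    show "inj_on ?i (carrier M)"
      using comp_inj_on[OF a(5), of "f n"] fn(2) a(6) by (simp add: comp_def)
    show "?i ` carrier M = a_kernel (S n) N \<pi>" unfolding \<pi>ker using a(6) by (metis image_image)
  qed
  moreover have "syzygy_module R n N"
  proof (cases n)
    case 0
    then show ?thesis using syzygy_module_0[OF fgN] by simp
  next
    case (Suc m)
    have fm: "f m \<in> lmod_hom R (S n) (S m)" and LSm: "left_module R (S m)"
      and km: "?I = a_kernel (S n) (S m) (f m)"
      using S(3,4,6) fg_projective_left_module[of R "S m"] unfolding Suc by simp_all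
    have "f m x = \<zero>\<^bsub>S m\<^esub> \<longleftrightarrow> \<pi> x = \<zero>\<^bsub>N\<^esub>" if x: "x \<in> carrier (S n)" for x
    proof -
      have "x \<in> a_kernel (S n) N \<pi> \<longleftrightarrow> x \<in> a_kernel (S n) (S m) (f m)" unfolding \<pi>ker km ..
      then show ?thesis using x unfolding a_kernel_iff by simp
    qed
    note keq = this
    have "\<exists>u\<in>lmod_hom R N (S m). \<forall>x\<in>carrier (S n). u (\<pi> x) = f m x"
      by (rule lmod_hom_factor[OF LQ h(1) LSm \<pi> \<pi>im fm]) (use keq in simp)
    then obtain u where u: "u \<in> lmod_hom R N (S m)" "\<forall>x\<in>carrier (S n). u (\<pi> x) = f m x"
      by (elim bexE)
    have u_inj: "inj_on u (carrier N)"
      unfolding lmod_hom_inj_iff[OF h(1) LSm u(1)]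
    proof (intro ballI impI)
      fix y assume y: "y \<in> carrier N" "u y = \<zero>\<^bsub>S m\<^esub>"
      then have "y \<in> \<pi> ` carrier (S n)" by (simp add: \<pi>im)
      then obtain x where "y = \<pi> x" "x \<in> carrier (S n)" by (rule imageE)
      then show "y = \<zero>\<^bsub>N\<^esub>" using keq u(2) y(2) by simp
    qed
    have u_im: "u ` carrier N = f m ` carrier (S n)"
      unfolding \<pi>im[symmetric] image_image using u(2) by (intro image_cong refl) simp
    define S' where "S' j = (if j < n then S j else N)" for j
    define f' where "f' j = (if j = m then u else f j)" for j
    show ?thesis
      unfolding syzygy_module_def
    proof (intro conjI exI[of _ S'] exI[of _ f'] allI impI)
      show "fg_module R N" by (rule fgN)
      show "left_module R (S' n)" "lmod_iso R (S' n) N" using h(1) lmod_iso_refl by (simp_all add: S'_def)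
      show "fg_projective R (S' j)" if "j < n" for j using that S(3) by (simp add: S'_def)
      show "f' j \<in> lmod_hom R (S' (Suc j)) (S' j)" if "j < n" for j
        using that S(4) u(1) Suc by (auto simp: S'_def f'_def)
      show "inj_on (f' (n - 1)) (carrier (S' n))" using u_inj Suc by (simp add: S'_def f'_def)
      show "f' (Suc j) ` carrier (S' (Suc (Suc j))) = a_kernel (S' (Suc j)) (S' j) (f' j)" if j: "Suc j < n" for j
      proof (cases "Suc j = m")
        case True
        then have "S' (Suc (Suc j)) = N" "S' (Suc j) = S (Suc j)" "S' j = S j" "f' (Suc j) = u" "f' j = f j"
          using Suc by (simp_all add: S'_def f'_def)
        moreover have "f m ` carrier (S n) = a_kernel (S (Suc j)) (S j) (f j)"
          using S(6)[rule_format, of j] True Suc j by simp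
        ultimately show ?thesis using u_im by simp
      next
        case False
        then have "S' (Suc (Suc j)) = S (Suc (Suc j))" "S' (Suc j) = S (Suc j)" "S' j = S j"
          "f' (Suc j) = f (Suc j)" "f' j = f j"
          using Suc j by (simp_all add: S'_def f'_def)
        then show ?thesis using S(6) j by simp
      qed
    qed
  qed
  ultimately show ?thesis using Q by (intro exI conjI)
qed

section \<open>Syzygies of a given module\<close>

lemma syzygy_of_0:
  assumes "fg_module R (X :: ('a, 'x) module)" "left_module R B" "lmod_iso R X B"
  shows "syzygy_of R 0 X B"
proof -
  obtain L' :: "('a, 'a univ) module" and h h' where h: "fg_module R L'" "left_module R L'"
    "h \<in> lmod_hom R X L'" "h' \<in> lmod_hom R L' X" "inj_on h (carrier X)" "h ` carrier X = carrier L'"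
    "inj_on h' (carrier L')" "h' ` carrier L' = carrier X"
    "\<forall>x\<in>carrier X. h' (h x) = x" "\<forall>y\<in>carrier L'. h (h' y) = y"
    by (rule fg_module_univ[OF assms(1)])
  have iso: "lmod_iso R L' X" by (rule lmod_isoI[OF h(4,7,8)])
  show ?thesis
    unfolding syzygy_of_def
    using assms(1) fg_module_iso[OF assms] h(2) iso lmod_iso_trans[OF iso assms(3)] lmod_hom_id[of R L']
    by (intro conjI exI[of _ "\<lambda>_. L'"] exI[of _ "\<lambda>_ x. x"]) simp_all
qed

lemma syzygy_of_iso:
  assumes "syzygy_of R d X B" "lmod_iso R X X'" "left_module R X'" "lmod_iso R B B'" "left_module R B'"
  shows "syzygy_of R d X' B'"
  using assms lmod_iso_trans[OF _ assms(2)] lmod_iso_trans[OF _ assms(4)]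
    fg_module_iso[OF _ assms(3,2)] fg_module_iso[OF _ assms(5,4)]
  unfolding syzygy_of_def by (elim conjE exE) (intro conjI exI, simp_all)

text \<open>Splicing at the left end. The numbering now starts at \<open>X\<close>: the old last map
  \<open>f d\<close> is composed with the surjection of \<open>G\<close> onto \<open>B\<close>, and
  the embedding of \<open>M\<close> receives index \<open>d + 1\<close>.\<close>

lemma syzygy_of_Suc:
  assumes B: "syzygy_of R d X B" and e0: "short_exact R (M :: ('a, 'm) module) (G :: ('a, 'g) module) B i0 \<pi>0"
    and G: "fg_projective R G" and M: "fg_module R M"
  shows "syzygy_of R (Suc d) X M"
proof -
  obtain M' Q' :: "('a, 'a univ) module" and i \<pi> where e: "short_exact R M' Q' B i \<pi>"
    and iso: "lmod_iso R M' M" "lmod_iso R G Q'"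
    by (rule short_exact_univ[OF e0 M fg_projective_fg[OF G]])
  note e' = short_exactD[OF e]
  have Q': "fg_projective R Q'" by (rule fg_projective_iso[OF G e'(2) iso(2)])
  obtain S :: "nat \<Rightarrow> ('a, 'a univ) module" and f where X: "fg_module R X" and S: "left_module R (S 0)" "lmod_iso R (S 0) X"
    "left_module R (S (Suc d))" "lmod_iso R (S (Suc d)) B"
    "\<forall>i. 1 \<le> i \<and> i \<le> d \<longrightarrow> fg_projective R (S i)" "\<forall>i\<le>d. f i \<in> lmod_hom R (S (Suc i)) (S i)"
    "f 0 ` carrier (S 1) = carrier (S 0)" "inj_on (f d) (carrier (S (Suc d)))"
    "\<forall>i<d. f (Suc i) ` carrier (S (Suc (Suc i))) = a_kernel (S (Suc i)) (S i) (f i)"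
    using B unfolding syzygy_of_def by (elim conjE exE)
  obtain a a' where a: "a \<in> lmod_hom R (S (Suc d)) B" "a' \<in> lmod_hom R B (S (Suc d))" "inj_on a (carrier (S (Suc d)))"
    "a ` carrier (S (Suc d)) = carrier B" "inj_on a' (carrier B)" "a' ` carrier B = carrier (S (Suc d))"
    "\<forall>x\<in>carrier (S (Suc d)). a' (a x) = x" "\<forall>y\<in>carrier B. a (a' y) = y"
    by (rule lmod_isoE[OF S(4,3)])
  define w where "w x = a' (\<pi> x)" for x
  have w: "w \<in> lmod_hom R Q' (S (Suc d))" unfolding w_def[abs_def] by (rule lmod_hom_comp[OF e'(5) a(2)])
  have w_im: "w ` carrier Q' = carrier (S (Suc d))" unfolding w_def[abs_def] using e'(8) a(6) by (metis image_image)
  have w_ker: "a_kernel Q' (S (Suc d)) w = i ` carrier M'"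
    unfolding w_def[abs_def] a_kernel_comp_inj[OF e'(3) S(3) e'(5) a(2,5)] e'(7) ..
  have LSd: "left_module R (S d)" using S(1,5) fg_projective_left_module[of R "S d"] by (cases d) simp_all
  have fd: "f d \<in> lmod_hom R (S (Suc d)) (S d)" using S(6) by simp
  have fw_im: "(\<lambda>x. f d (w x)) ` carrier Q' = f d ` carrier (S (Suc d))" using w_im by (metis image_image)
  define S' where "S' j = (if j \<le> d then S j else if j = Suc d then Q' else M')" for j
  define f' where "f' j = (if j < d then f j else if j = d then (\<lambda>x. f d (w x)) else i)" for j
  show ?thesis
    unfolding syzygy_of_def
  proof (intro conjI exI[of _ S'] exI[of _ f'] allI impI)
    show "fg_module R X" "fg_module R M" by (rule X, rule M)
    show "left_module R (S' 0)" "lmod_iso R (S' 0) X" using S(1,2) by (simp_all add: S'_def)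
    show "left_module R (S' (Suc (Suc d)))" "lmod_iso R (S' (Suc (Suc d))) M" using e'(1) iso(1) by (simp_all add: S'_def)
    show "fg_projective R (S' j)" if "1 \<le> j \<and> j \<le> Suc d" for j
      using that S(5) Q' by (auto simp: S'_def)
    show "f' j \<in> lmod_hom R (S' (Suc j)) (S' j)" if j: "j \<le> Suc d" for j
    proof -
      consider "j < d" | "j = d" | "j = Suc d" using j by linarith
      then show ?thesis
        using S(6) lmod_hom_comp[OF w fd] e'(4) by cases (simp_all add: S'_def f'_def)
    qed
    show "f' 0 ` carrier (S' 1) = carrier (S' 0)"
      using S(7) fw_im by (cases d) (simp_all add: S'_def f'_def)
    show "inj_on (f' (Suc d)) (carrier (S' (Suc (Suc d))))" using e'(6) by (simp add: S'_def f'_def)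
    show "f' (Suc j) ` carrier (S' (Suc (Suc j))) = a_kernel (S' (Suc j)) (S' j) (f' j)" if j: "j < Suc d" for j
    proof -
      consider "j = d" | "Suc j = d" | "Suc j < d" using j by linarith
      then show ?thesis
      proof cases
        case 1
        then show ?thesis using a_kernel_comp_inj[OF S(3) LSd w fd S(8)] w_ker by (simp add: S'_def f'_def)
      next
        case 2
        have "S' (Suc (Suc j)) = Q'" "S' (Suc j) = S (Suc j)" "S' j = S j"
          "f' (Suc j) = (\<lambda>x. f d (w x))" "f' j = f j"
          using 2 by (simp_all add: S'_def f'_def)
        moreover have "f d ` carrier (S (Suc d)) = a_kernel (S (Suc j)) (S j) (f j)"
          using S(9)[rule_format, of j] 2 by simp
        ultimately show ?thesis using fw_im by simp
      next
        case 3
        then show ?thesis using S(9) by (simp add: S'_def f'_def)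
      qed
    qed
  qed
qed

section \<open>Projective dimension\<close>

lemma zero_module_univ:
  assumes "ring R"
  shows "\<exists>Z :: ('a, 'a univ) module. fg_projective R Z \<and> carrier Z = {\<zero>\<^bsub>Z\<^esub>}"
proof -
  obtain Z :: "('a, 'a univ) module" and h h' where h: "fg_projective R Z"
    "h \<in> lmod_hom R (free_module R 0) Z" "h' \<in> lmod_hom R Z (free_module R 0)"
    "inj_on h (carrier (free_module R 0))" "h ` carrier (free_module R 0) = carrier Z"
    "inj_on h' (carrier Z)" "h' ` carrier Z = carrier (free_module R 0)"
    "\<forall>x\<in>carrier (free_module R 0). h' (h x) = x" "\<forall>y\<in>carrier Z. h (h' y) = y"
    by (rule fg_projective_univ[OF fg_projective_free[OF assms, of 0]])
  have "carrier (free_module R 0) = {\<zero>\<^bsub>free_module R 0\<^esub>}"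
    by (auto simp: free_module_def fun_eq_iff)
  then have "carrier Z = {h \<zero>\<^bsub>free_module R 0\<^esub>}" using h(5) by simp
  then show ?thesis
    using h(1) lmod_hom_zero[OF left_module_free[OF assms] fg_projective_left_module[OF h(1)] h(2)] by metis
qed

lemma proj_dim_le_zero:
  assumes "left_module S Y" "carrier Y = {\<zero>\<^bsub>Y\<^esub>}"
  shows "proj_dim_le S Y n"
proof -
  obtain Z :: "('a, 'a univ) module" where Z: "fg_projective S Z" "carrier Z = {\<zero>\<^bsub>Z\<^esub>}"
    using zero_module_univ[OF left_module_ring[OF assms(1)]] by (elim exE conjE)
  note LZ = fg_projective_left_module[OF Z(1)]
  have "projective_resolution S Y (\<lambda>_. Z) (\<lambda>_ _. \<zero>\<^bsub>Z\<^esub>) (\<lambda>_. \<zero>\<^bsub>Y\<^esub>)"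
    unfolding projective_resolution_def using assms Z lmod_hom_const_zero[OF LZ] lmod_hom_const_zero[OF assms(1)]
    by (auto simp: a_kernel_def')
  then show ?thesis unfolding proj_dim_le_def zero_module_def using Z(2) by (intro exI conjI allI impI)
qed

lemma proj_dim_le_iso:
  assumes "proj_dim_le S X n" "lmod_iso S X Y" "left_module S X" "left_module S Y"
  shows "proj_dim_le S Y n"
proof -
  obtain P f e where P: "projective_resolution S X P f e" "\<forall>i. int i > n \<longrightarrow> zero_module (P i)"
    using assms(1) unfolding proj_dim_le_def by (elim exE conjE)
  obtain e' where "projective_resolution S Y P f e'" using projective_resolution_iso[OF P(1) assms(2-4)] by (elim exE)
  then show ?thesis unfolding proj_dim_le_def using P(2) by (intro exI conjI)
qed

text \<open>Appending \<open>G\<close> on the right turns a resolution of \<open>A\<close> into one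
  of \<open>Y\<close> with all degrees raised by one. The bound \<open>0 \<le> n\<close> accounts
  for \<open>G\<close> itself, which sits in degree \<open>0\<close>.\<close>

lemma proj_dim_le_Suc:
  assumes e0: "short_exact S (A :: ('a, 'm) module) (G :: ('a, 'g) module) Y i0 \<pi>0" and G: "fg_projective S G"
    and A: "proj_dim_le S A (n - 1)" and n: "0 \<le> n"
  shows "proj_dim_le S Y n"
proof -
  note e0' = short_exactD[OF e0]
  obtain P :: "nat \<Rightarrow> ('a, 'a univ) module" and f \<epsilon>0 where P0: "projective_resolution S A P f \<epsilon>0"
    and Pz: "\<forall>i. int i > n - 1 \<longrightarrow> zero_module (P i)"
    using A unfolding proj_dim_le_def by (elim exE conjE)
  have fgA: "fg_module S A"
    using fg_module_image[OF fg_projective_fg e0'(1) projective_resolutionD(2,3)[OF P0]]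
      projective_complex.proj[OF projective_resolution_complex[OF P0]] by simp
  obtain A' Q' :: "('a, 'a univ) module" and i \<pi> where e: "short_exact S A' Q' Y i \<pi>"
    and iso: "lmod_iso S A' A" "lmod_iso S G Q'"
    by (rule short_exact_univ[OF e0 fgA fg_projective_fg[OF G]])
  note e' = short_exactD[OF e]
  have Q': "fg_projective S Q'" by (rule fg_projective_iso[OF G e'(2) iso(2)])
  obtain \<epsilon> where P: "projective_resolution S A' P f \<epsilon>"
    using projective_resolution_iso[OF P0 lmod_iso_sym[OF iso(1) e'(1)] e0'(1) e'(1)] by (elim exE)
  interpret P: projective_complex S P f by (rule projective_resolution_complex[OF P])
  note r = projective_resolutionD[OF P]
  define P' where "P' j = (case j of 0 \<Rightarrow> Q' | Suc m \<Rightarrow> P m)" for j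
  define f' where "f' j = (case j of 0 \<Rightarrow> (\<lambda>x. i (\<epsilon> x)) | Suc m \<Rightarrow> f m)" for j
  have "projective_resolution S Y P' f' \<pi>"
    unfolding projective_resolution_def
  proof (intro conjI allI e'(3))
    show "fg_projective S (P' j)" for j using Q' P.proj by (simp add: P'_def split: nat.split)
    show "f' j \<in> lmod_hom S (P' (Suc j)) (P' j)" for j
      using lmod_hom_comp[OF r(2) e'(4)] P.diff by (simp add: P'_def f'_def split: nat.split)
    show "\<pi> \<in> lmod_hom S (P' 0) Y" "\<pi> ` carrier (P' 0) = carrier Y" using e'(5,8) by (simp_all add: P'_def)
    have "(\<lambda>x. i (\<epsilon> x)) ` carrier (P 0) = i ` carrier A'" using r(3) by (metis image_image)
    then show "f' 0 ` carrier (P' 1) = a_kernel (P' 0) Y \<pi>" using e'(7) by (simp add: P'_def f'_def)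
    show "f' (Suc j) ` carrier (P' (Suc (Suc j))) = a_kernel (P' (Suc j)) (P' j) (f' j)" for j
      using r(4,5) a_kernel_comp_inj[OF e'(1,2) r(2) e'(4,6)] by (simp add: P'_def f'_def split: nat.split)
  qed
  moreover have "zero_module (P' j)" if "int j > n" for j
    using that n Pz by (cases j) (simp_all add: P'_def)
  ultimately show ?thesis unfolding proj_dim_le_def by (intro exI conjI allI impI)
qed

section \<open>Approximation by syzygies\<close>

text \<open>
  Here \<open>(P, f)\<close> is a resolution of \<open>X\<close>. The map \<open>b\<close> identifies \<open>B\<close> with \<open>Coker f\<^sub>d\<close>, that is, with the
  \<open>d\<close>th syzygy of \<open>X\<close> in this resolution, so that the construction can be continued along \<open>P\<close>.
\<close>

definition syzygy_approximation ::
  "'a ring \<Rightarrow> (nat \<Rightarrow> ('a, 'a univ) module) \<Rightarrow> (nat \<Rightarrow> 'a univ \<Rightarrow> 'a univ) \<Rightarrow> ('a, 'x) module \<Rightarrow> nat \<Rightarrow>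
    ('a, 'n) module \<Rightarrow> bool" where
  "syzygy_approximation R P f X d N \<longleftrightarrow>
     (\<exists>(Q :: ('a, 'a univ) module) (B :: ('a, 'a univ) module) (C :: ('a, 'a univ) module) i p b.
        fg_projective R Q \<and> short_exact R B (direct_sum N Q) C i p \<and> syzygy_module R (Suc d) C \<and>
        syzygy_of R d X B \<and> proj_dim_le (op_ring R) (dual_module R B) (int d - 1) \<and>
        extends_along R B (direct_sum N Q) i \<and> b \<in> lmod_hom R (P d) B \<and>
        b ` carrier (P d) = carrier B \<and> a_kernel (P d) B b = f d ` carrier (P (Suc d)))"

text \<open>The third terms of the approximations are produced as kernels in this way; the exact
  sequence returned with them at once exhibits them as syzygies.\<close>

lemma kernel_univ:
  assumes "left_noetherian R" "fg_module R (M :: ('a, 'm) module)" "left_module R N"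
    "\<rho> \<in> lmod_hom R M N" "\<rho> ` carrier M = carrier N"
  shows "\<exists>(C :: ('a, 'a univ) module) h. fg_module R C \<and> short_exact R C M N h \<rho>"
proof -
  note M = fg_module_left_module[OF assms(2)]
  note K = submodule_a_kernel[OF M assms(3,4)]
  let ?K = "M\<lparr>carrier := a_kernel M N \<rho>\<rparr>"
  obtain C :: "('a, 'a univ) module" and h h' where h: "fg_module R C" "left_module R C"
    "h \<in> lmod_hom R ?K C" "h' \<in> lmod_hom R C ?K" "inj_on h (carrier ?K)" "h ` carrier ?K = carrier C"
    "inj_on h' (carrier C)" "h' ` carrier C = carrier ?K"
    "\<forall>x\<in>carrier ?K. h' (h x) = x" "\<forall>y\<in>carrier C. h (h' y) = y"
    by (rule fg_module_univ[OF noetherian_fg_submodule[OF assms(1,2) K]])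
  have "h' \<in> lmod_hom R C M"
    using lmod_homD[OF h(4)] by (intro lmod_homI) (simp_all add: a_kernel_iff)
  then have "short_exact R C M N h' \<rho>"
    unfolding short_exact_def using h(2,7,8) M assms(3-5) by simp
  then show ?thesis using h(1) by (intro exI conjI)
qed

text \<open>The sequence is \<open>0 \<rightarrow> X \<rightarrow> N \<rightarrow> w(N)
  \<rightarrow> 0\<close> with \<open>X\<close> the kernel of \<open>w\<close>. Exactness in degree
  \<open>0\<close> says that \<open>X\<close> has zero dual, which gives the bound
  \<open>- 1\<close> on the projective dimension and leaves only the zero functional to
  extend.\<close>

lemma syzygy_approximation_0:
  fixes N :: "('a, 'a univ) module"
  assumes noeth: "left_noetherian R" and N: "fg_module R N" and E: "fg_projective R (E :: ('a, 'e) module)"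
    and w: "w \<in> lmod_hom R N E"
    and res: "projective_resolution R (N\<lparr>carrier := a_kernel N E w\<rparr>) P f e"
    and ex: "hom_exact_at R P f (regular_module R) 0"
  shows "syzygy_approximation R P f (N\<lparr>carrier := a_kernel N E w\<rparr>) 0 N"
proof -
  let ?X = "N\<lparr>carrier := a_kernel N E w\<rparr>"
  note LN = fg_module_left_module[OF N] and LE = fg_projective_left_module[OF E]
  interpret N: left_module R N by (rule LN)
  note reg = left_module_regular[OF N.R.ring_axioms]
  note K = submodule_a_kernel[OF LN LE w]
  note r = projective_resolutionD[OF res]
  note X = noetherian_fg_submodule[OF noeth N K]
  \<comment> \<open>The format of an approximation includes a projective summand; here it is
    zero.\<close>
  obtain Z :: "('a, 'a univ) module" where Z: "fg_projective R Z" "carrier Z = {\<zero>\<^bsub>Z\<^esub>}"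
    using zero_module_univ[OF N.R.ring_axioms] by (elim exE conjE)
  note LZ = fg_projective_left_module[OF Z(1)]
  note I = submodule_hom_image[OF LN LE w]
  obtain q where q: "q \<in> lmod_hom R E (quotient_module E (w ` carrier N))"
    "q ` carrier E = carrier (quotient_module E (w ` carrier N))"
    "a_kernel E (quotient_module E (w ` carrier N)) q = w ` carrier N"
    by (rule quotient_projection[OF LE I])
  note LQ = left_module_quotient[OF LE I]
  \<comment> \<open>\<open>C\<close> is the image of \<open>w\<close>, obtained as the kernel of the
    projection from \<open>E\<close> to its quotient by that image. In this form it is visibly a
    first syzygy.\<close>
  obtain C :: "('a, 'a univ) module" and h where C: "fg_module R C"
    "short_exact R C E (quotient_module E (w ` carrier N)) h q"
    using kernel_univ[OF noeth fg_projective_fg[OF E] LQ q(1,2)] by (elim exE conjE)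
  note eC = short_exactD[OF C(2)]
  have syz: "syzygy_module R (Suc 0) C"
    by (rule syzygy_module_Suc[OF C(2) E C(1) syzygy_module_0[OF fg_module_image[OF fg_projective_fg[OF E] LQ q(1,2)]]])
  have "\<forall>x\<in>carrier N. q (w x) = \<zero>\<^bsub>quotient_module E (w ` carrier N)\<^esub>"
  proof
    fix x assume "x \<in> carrier N"
    then have "w x \<in> a_kernel E (quotient_module E (w ` carrier N)) q" unfolding q(3) by (rule imageI)
    then show "q (w x) = \<zero>\<^bsub>quotient_module E (w ` carrier N)\<^esub>" unfolding a_kernel_iff by (rule conjunct2)
  qed
  then obtain u where u: "u \<in> lmod_hom R N C" "\<forall>x\<in>carrier N. h (u x) = w x"
    using short_exact_kernel_lift[OF C(2) LN w] by blast
  have u0: "u x = \<zero>\<^bsub>C\<^esub> \<longleftrightarrow> w x = \<zero>\<^bsub>E\<^esub>" if x: "x \<in> carrier N" for x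
    using eC(6) lmod_homD(1)[OF u(1) x] u(2) x lmod_hom_zero[OF eC(1,2,4)]
    unfolding lmod_hom_inj_iff[OF eC(1,2,4)] by metis
  let ?i = "\<lambda>x. (x, \<zero>\<^bsub>Z\<^esub>)"
  have se: "short_exact R ?X (direct_sum N Z) C ?i (\<lambda>z. u (fst z))"
  proof (rule short_exactI[OF r(1) left_module_direct_sum[OF LN LZ] eC(1)])
    show "?i \<in> lmod_hom R ?X (direct_sum N Z)"
      by (rule lmod_hom_from_submodule[OF LN K direct_sum_injections(1)[OF LN LZ]])
    show "(\<lambda>z. u (fst z)) \<in> lmod_hom R (direct_sum N Z) C" by (rule lmod_hom_comp[OF direct_sum_homs(1) u(1)])
    show "x = \<zero>\<^bsub>?X\<^esub>" if "?i x = \<zero>\<^bsub>direct_sum N Z\<^esub>" for x using that by simp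
    show "u (fst (?i x)) = \<zero>\<^bsub>C\<^esub>" if "x \<in> carrier ?X" for x using that u0 by (simp add: a_kernel_iff)
    show "\<exists>x\<in>carrier ?X. ?i x = z" if "z \<in> carrier (direct_sum N Z)" "u (fst z) = \<zero>\<^bsub>C\<^esub>" for z
      using that u0[of "fst z"] Z(2) by (intro bexI[of _ "fst z"]) (auto simp: a_kernel_iff)
    show "\<exists>z\<in>carrier (direct_sum N Z). u (fst z) = c" if c: "c \<in> carrier C" for c
    proof -
      have "h c \<in> a_kernel E (quotient_module E (w ` carrier N)) q" unfolding eC(7)[symmetric] using c by (rule imageI)
      then have "h c \<in> w ` carrier N" unfolding q(3) .
      then obtain x where x: "h c = w x" "x \<in> carrier N" by (rule imageE)
      have "u x = c" using inj_onD[OF eC(6) _ lmod_homD(1)[OF u(1) x(2)] c] u(2) x by simp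
      then show ?thesis using x(2) Z(2) by (intro bexI[of _ "(x, \<zero>\<^bsub>Z\<^esub>)"]) simp_all
    qed
  qed
  have zero: "\<phi> x = \<zero>\<^bsub>R\<^esub>" if \<phi>: "\<phi> \<in> lmod_hom R ?X (regular_module R)" and x: "x \<in> carrier ?X" for \<phi> x
  proof -
    have "x \<in> e ` carrier (P 0)" using r(3) x by simp
    then obtain y where y: "x = e y" "y \<in> carrier (P 0)" by (rule imageE)
    have "\<phi> (e (f 0 z)) = \<zero>\<^bsub>regular_module R\<^esub>" if "z \<in> carrier (P (Suc 0))" for z
      using r(6)[OF that] lmod_hom_zero[OF r(1) reg \<phi>] by simp
    from hom_exact_at_0D[OF ex lmod_hom_comp[OF r(2) \<phi>] this y(2)] show ?thesis using y(1) by simp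
  qed
  have "carrier (dual_module R ?X) = {\<zero>\<^bsub>dual_module R ?X\<^esub>}"
  proof -
    have "\<phi> = \<zero>\<^bsub>dual_module R ?X\<^esub>" if "\<phi> \<in> carrier (dual_module R ?X)" for \<phi>
      using zero[OF dualD(1)[OF that]] dualD(2)[OF that] by (intro dual_eqI[of _ ?X]) simp_all
    moreover have "\<zero>\<^bsub>dual_module R ?X\<^esub> \<in> carrier (dual_module R ?X)"
      by (rule abelian_groupE(2)[OF left_module_group[OF left_module_dual[OF r(1)]]])
    ultimately show ?thesis by blast
  qed
  then have pd: "proj_dim_le (op_ring R) (dual_module R ?X) (int 0 - 1)"
    by (rule proj_dim_le_zero[OF left_module_dual[OF r(1)]])
  have ext: "extends_along R ?X (direct_sum N Z) ?i"
    unfolding extends_along_def using zero lmod_hom_const_zero[OF reg]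
    by (intro ballI bexI[of _ "\<lambda>_. \<zero>\<^bsub>regular_module R\<^esub>"]) simp_all
  show ?thesis
    unfolding syzygy_approximation_def
    by (intro exI conjI) (rule Z(1) se syz syzygy_of_0[OF X r(1) lmod_iso_refl] pd ext r(2,3) r(4)[symmetric])+
qed

text \<open>Lifting \<open>P d \<rightarrow> B \<rightarrow> N' \<oplus> Q\<close> to
  \<open>E \<oplus> Q\<close> and adding the embedding of \<open>N\<close> gives a map
  \<open>N \<oplus> P d \<rightarrow> E \<oplus> Q\<close>. Its image is the kernel
  \<open>C'\<close> of \<open>E \<oplus> Q \<rightarrow> C\<close>, and its kernel is a copy of the
  kernel of \<open>b\<close>. The new projective summand is \<open>P d\<close>; the old one,
  \<open>Q\<close>, moves into the projective that contains \<open>C'\<close>.\<close>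

lemma syzygy_approximation_Suc:
  fixes N N' :: "('a, 'a univ) module"
  assumes noeth: "left_noetherian R" and N: "fg_module R N" and E: "fg_projective R (E :: ('a, 'e) module)"
    and e: "short_exact R N E N' \<iota> \<pi>"
    and res: "projective_resolution R X P f \<epsilon>"
    and ex: "hom_exact_at R P f (regular_module R) (Suc d)"
    and app: "syzygy_approximation R P f X d N'"
  shows "syzygy_approximation R P f X (Suc d) N"
proof -
  obtain Q B C :: "('a, 'a univ) module" and i p b where Q: "fg_projective R Q"
    and s: "short_exact R B (direct_sum N' Q) C i p" "syzygy_module R (Suc d) C"
      "syzygy_of R d X B" "proj_dim_le (op_ring R) (dual_module R B) (int d - 1)"
      "extends_along R B (direct_sum N' Q) i"
    and b: "b \<in> lmod_hom R (P d) B" "b ` carrier (P d) = carrier B" "a_kernel (P d) B b = f d ` carrier (P (Suc d))"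
    using app unfolding syzygy_approximation_def by (elim exE conjE)
  interpret P: projective_complex R P f by (rule projective_resolution_complex[OF res])
  note r = projective_resolutionD[OF res]
  note e' = short_exactD[OF e] and s' = short_exactD[OF s(1)]
  note LQ = fg_projective_left_module[OF Q]
  note reg = left_module_regular[OF P.ring]
  interpret E: left_module R E by (rule e'(2))
  interpret Qm: left_module R Q by (rule LQ)
  interpret N'm: left_module R N' by (rule e'(3))
  let ?B = "(P d)\<lparr>carrier := f d ` carrier (P (Suc d))\<rparr>"
  have subB: "submodule (f d ` carrier (P (Suc d))) R (P d)" by (rule submodule_hom_image[OF P.lm P.lm P.diff])
  note LB = submodule_left_module[OF P.lm subB]
  have B_in: "y \<in> carrier (P d)" "b y = \<zero>\<^bsub>B\<^esub>" if "y \<in> carrier ?B" for y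
  proof -
    have "y \<in> a_kernel (P d) B b" using that b(3) by simp
    then show "y \<in> carrier (P d)" "b y = \<zero>\<^bsub>B\<^esub>" unfolding a_kernel_iff by simp_all
  qed
  have fg_B: "fg_module R ?B"
    by (rule noetherian_fg_submodule[OF noeth fg_projective_fg[OF P.proj] subB])
  have seB: "short_exact R ?B (P d) B (\<lambda>x. x) b"
    unfolding short_exact_def
    using LB P.lm s'(1) lmod_hom_from_submodule[OF P.lm subB lmod_hom_id] b by simp
  \<comment> \<open>A functional on the image of \<open>f d\<close>, pulled back to
    \<open>P (Suc d)\<close>, is a cocycle. Exactness in degree \<open>d + 1\<close> writes it as
    \<open>t\<close> composed with \<open>f d\<close>, and \<open>t\<close> is the
    extension.\<close>
  have B_ext: "extends_along R ?B (P d) (\<lambda>x. x)"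
    unfolding extends_along_def
  proof
    fix \<phi> assume \<phi>: "\<phi> \<in> lmod_hom R ?B (regular_module R)"
    have fd: "f d \<in> lmod_hom R (P (Suc d)) ?B" by (rule lmod_hom_into_submodule[OF P.diff]) simp
    have "\<forall>x\<in>carrier (P (Suc (Suc d))). \<phi> (f d (f (Suc d) x)) = \<zero>\<^bsub>regular_module R\<^esub>"
      using P.diff_diff lmod_hom_zero[OF LB reg \<phi>] by simp
    from hom_exact_at_SucD[OF ex lmod_hom_comp[OF fd \<phi>] this]
    obtain t where t: "t \<in> lmod_hom R (P d) (regular_module R)" "\<forall>x\<in>carrier (P (Suc d)). \<phi> (f d x) = t (f d x)"
      by (elim bexE)
    show "\<exists>\<psi>\<in>lmod_hom R (P d) (regular_module R). \<forall>x\<in>carrier ?B. \<phi> x = \<psi> x"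
      using t by (intro bexI[of _ t]) auto
  qed
  \<comment> \<open>Of the two components of
    \<open>P d \<rightarrow> B \<rightarrow> N' \<oplus> Q\<close>, only \<open>\<alpha>\<close> has
    to be lifted along \<open>\<pi>\<close>; \<open>\<beta>\<close> lands in \<open>Q\<close>
    already.\<close>
  define \<alpha> where "\<alpha> g = fst (i (b g))" for g
  define \<beta> where "\<beta> g = snd (i (b g))" for g
  have \<alpha>: "\<alpha> \<in> lmod_hom R (P d) N'" unfolding \<alpha>_def[abs_def]
    by (rule lmod_hom_comp[OF b(1) lmod_hom_comp[OF s'(4) direct_sum_homs(1)]])
  have \<beta>: "\<beta> \<in> lmod_hom R (P d) Q" unfolding \<beta>_def[abs_def]
    by (rule lmod_hom_comp[OF b(1) lmod_hom_comp[OF s'(4) direct_sum_homs(2)]])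
  have \<alpha>\<beta>: "(\<alpha> g, \<beta> g) = i (b g)" for g by (simp add: \<alpha>_def \<beta>_def)
  obtain l where l: "l \<in> lmod_hom R (P d) E" "\<forall>g\<in>carrier (P d). \<pi> (l g) = \<alpha> g"
    using short_exact_lift[OF e P.proj \<alpha>] by (elim bexE)
  have i0: "i \<zero>\<^bsub>B\<^esub> = (\<zero>\<^bsub>N'\<^esub>, \<zero>\<^bsub>Q\<^esub>)" using lmod_hom_zero[OF s'(1,2,4)] by simp
  have B0: "\<alpha> y = \<zero>\<^bsub>N'\<^esub>" "\<beta> y = \<zero>\<^bsub>Q\<^esub>" if "y \<in> carrier ?B" for y
    using B_in(2)[OF that] i0 by (simp_all add: \<alpha>_def \<beta>_def)
  \<comment> \<open>On the kernel of \<open>b\<close> the lift \<open>l\<close> is killed by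
    \<open>\<pi>\<close>, so it comes from \<open>N\<close>. The sign is chosen so that
    \<open>(m y, y)\<close> vanishes under the map \<open>p0\<close> below.\<close>
  have ml: "(\<lambda>g. \<ominus>\<^bsub>E\<^esub> l g) \<in> lmod_hom R ?B E"
    by (rule lmod_hom_from_submodule[OF P.lm subB lmod_hom_uminus[OF P.lm e'(2) l(1)]])
  have lc: "l g \<in> carrier E" if "g \<in> carrier (P d)" for g by (rule lmod_homD(1)[OF l(1) that])
  have "\<forall>y\<in>carrier ?B. \<pi> (\<ominus>\<^bsub>E\<^esub> l y) = \<zero>\<^bsub>N'\<^esub>"
  proof
    fix y assume y: "y \<in> carrier ?B"
    show "\<pi> (\<ominus>\<^bsub>E\<^esub> l y) = \<zero>\<^bsub>N'\<^esub>"
      using lmod_hom_a_inv[OF e'(2,3,5) lc[OF B_in(1)[OF y]]] l(2) B_in(1)[OF y] B0(1)[OF y] by simp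
  qed
  from short_exact_kernel_lift[OF e LB ml this]
  obtain m where m: "m \<in> lmod_hom R ?B N" "\<forall>y\<in>carrier ?B. \<iota> (m y) = \<ominus>\<^bsub>E\<^esub> l y" by (elim bexE)
  let ?M = "direct_sum E Q"
  define \<rho> where "\<rho> z = p (\<pi> (fst z), snd z)" for z
  have M: "fg_projective R ?M" by (rule fg_projective_direct_sum[OF E Q])
  have \<rho>: "\<rho> \<in> lmod_hom R ?M C" unfolding \<rho>_def[abs_def]
    by (rule lmod_hom_comp[OF direct_sum_hom_pair[OF lmod_hom_comp[OF direct_sum_homs(1) e'(5)] direct_sum_homs(2)] s'(5)])
  have \<rho>im: "\<rho> ` carrier ?M = carrier C"
  proof
    show "\<rho> ` carrier ?M \<subseteq> carrier C" using lmod_homD(1)[OF \<rho>] by (rule image_subsetI)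
    show "carrier C \<subseteq> \<rho> ` carrier ?M"
    proof
      fix c assume "c \<in> carrier C"
      then have "c \<in> p ` carrier (direct_sum N' Q)" using s'(8) by simp
      then obtain z where z: "c = p z" "z \<in> carrier (direct_sum N' Q)" by (rule imageE)
      have "fst z \<in> \<pi> ` carrier E" using z(2) e'(8) by auto
      then obtain x where "fst z = \<pi> x" "x \<in> carrier E" by (rule imageE)
      then show "c \<in> \<rho> ` carrier ?M"
        using z by (intro image_eqI[of _ _ "(x, snd z)"]) (auto simp: \<rho>_def)
    qed
  qed
  obtain C' :: "('a, 'a univ) module" and h where C': "fg_module R C'" "short_exact R C' ?M C h \<rho>"
    using kernel_univ[OF noeth fg_projective_fg[OF M] s'(3) \<rho> \<rho>im] by (elim exE conjE)
  note eC = short_exactD[OF C'(2)]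
  have syz: "syzygy_module R (Suc (Suc d)) C'" by (rule syzygy_module_Suc[OF C'(2) M C'(1) s(2)])
  let ?NP = "direct_sum N (P d)"
  have LNP: "left_module R ?NP" by (rule left_module_direct_sum[OF e'(1) P.lm])
  define p0 where "p0 z = (\<iota> (fst z) \<oplus>\<^bsub>E\<^esub> l (snd z), \<beta> (snd z))" for z
  have p0: "p0 \<in> lmod_hom R ?NP ?M" unfolding p0_def[abs_def]
    by (intro direct_sum_hom_pair lmod_hom_plus LNP e'(2) lmod_hom_comp[OF direct_sum_homs(1) e'(4)]
        lmod_hom_comp[OF direct_sum_homs(2) l(1)] lmod_hom_comp[OF direct_sum_homs(2) \<beta>])
  have \<pi>p0: "\<pi> (\<iota> x \<oplus>\<^bsub>E\<^esub> l g) = \<alpha> g" if "x \<in> carrier N" "g \<in> carrier (P d)" for x g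
    using lmod_homD(2)[OF e'(5) lmod_homD(1)[OF e'(4) that(1)] lc[OF that(2)]] e'(9)[OF that(1)] l(2) that(2)
      lmod_homD(1)[OF \<alpha> that(2)] by simp
  have "\<forall>z\<in>carrier ?NP. \<rho> (p0 z) = \<zero>\<^bsub>C\<^esub>"
    using \<pi>p0 s'(9) lmod_homD(1)[OF b(1)] by (auto simp: \<rho>_def p0_def \<alpha>\<beta>)
  from short_exact_kernel_lift[OF C'(2) LNP p0 this]
  obtain p' where p': "p' \<in> lmod_hom R ?NP C'" "\<forall>z\<in>carrier ?NP. h (p' z) = p0 z" by (elim bexE)
  have p'0: "p' z = \<zero>\<^bsub>C'\<^esub> \<longleftrightarrow> p0 z = \<zero>\<^bsub>?M\<^esub>" if z: "z \<in> carrier ?NP" for z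
    using eC(6) lmod_homD(1)[OF p'(1) z] p'(2) z lmod_hom_zero[OF eC(1,2,4)]
    unfolding lmod_hom_inj_iff[OF eC(1,2,4)] by metis
  let ?i = "\<lambda>y. (m y, y)"
  have mc: "m y \<in> carrier N" if "y \<in> carrier ?B" for y by (rule lmod_homD(1)[OF m(1) that])
  have se: "short_exact R ?B ?NP C' ?i p'"
  proof (rule short_exactI[OF LB LNP eC(1) _ p'(1)])
    show "?i \<in> lmod_hom R ?B ?NP"
      by (rule direct_sum_hom_pair[OF m(1) lmod_hom_from_submodule[OF P.lm subB lmod_hom_id]])
    show "y = \<zero>\<^bsub>?B\<^esub>" if "?i y = \<zero>\<^bsub>?NP\<^esub>" for y using that by simp
    show "p' (?i y) = \<zero>\<^bsub>C'\<^esub>" if y: "y \<in> carrier ?B" for y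
      using p'0[of "?i y"] mc[OF y] B_in(1)[OF y] m(2)[rule_format, OF y] lc[OF B_in(1)[OF y]] B0(2)[OF y]
      by (simp add: p0_def E.M.l_neg)
    show "\<exists>y\<in>carrier ?B. ?i y = z" if z: "z \<in> carrier ?NP" "p' z = \<zero>\<^bsub>C'\<^esub>" for z
    proof -
      obtain x g where xg: "z = (x, g)" "x \<in> carrier N" "g \<in> carrier (P d)" using z(1) by auto
      have *: "\<iota> x \<oplus>\<^bsub>E\<^esub> l g = \<zero>\<^bsub>E\<^esub>" "\<beta> g = \<zero>\<^bsub>Q\<^esub>"
        using p'0[OF z(1)] z(2) xg(1) by (simp_all add: p0_def)
      have "\<alpha> g = \<zero>\<^bsub>N'\<^esub>" using \<pi>p0[OF xg(2,3)] *(1) lmod_hom_zero[OF e'(2,3,5)] by simp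
      then have "i (b g) = \<zero>\<^bsub>direct_sum N' Q\<^esub>" using *(2) \<alpha>\<beta>[of g] by simp
      then have "b g = \<zero>\<^bsub>B\<^esub>" using s'(6) lmod_homD(1)[OF b(1) xg(3)] unfolding lmod_hom_inj_iff[OF s'(1,2,4)] by blast
      then have "g \<in> a_kernel (P d) B b" using xg(3) by (simp add: a_kernel_iff)
      then have g: "g \<in> carrier ?B" using b(3) by simp
      have "\<iota> x = \<ominus>\<^bsub>E\<^esub> l g"
        using *(1) E.M.minus_equality[of "\<iota> x" "l g"] lmod_homD(1)[OF e'(4) xg(2)] lc[OF xg(3)] by simp
      then have "x = m g" using inj_onD[OF e'(6) _ xg(2) mc[OF g]] m(2)[rule_format, OF g] by simp
      then show ?thesis using g xg(1) by (intro bexI[of _ g]) simp_all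
    qed
    show "\<exists>z\<in>carrier ?NP. p' z = c" if c: "c \<in> carrier C'" for c
    proof -
      obtain u v where uv: "h c = (u, v)" "u \<in> carrier E" "v \<in> carrier Q" using lmod_homD(1)[OF eC(4) c] by auto
      have "p (\<pi> u, v) = \<zero>\<^bsub>C\<^esub>" using eC(9)[OF c] uv(1) by (simp add: \<rho>_def)
      then obtain y where y: "y \<in> carrier B" "i y = (\<pi> u, v)"
        using s'(10)[of "(\<pi> u, v)"] uv lmod_homD(1)[OF e'(5) uv(2)] by auto
      have "y \<in> b ` carrier (P d)" using y(1) b(2) by simp
      then obtain g where g: "y = b g" "g \<in> carrier (P d)" by (rule imageE)
      have \<alpha>g: "\<alpha> g = \<pi> u" "\<beta> g = v" using y(2) g(1) \<alpha>\<beta>[of g] by simp_all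
      have "\<pi> (u \<ominus>\<^bsub>E\<^esub> l g) = \<zero>\<^bsub>N'\<^esub>"
        using lmod_hom_minus[OF e'(2,3,5) uv(2) lc[OF g(2)]] l(2) g(2) \<alpha>g(1)
          a_minus_eq_zero_iff[OF N'm.M.abelian_group_axioms] lmod_homD(1)[OF e'(5) uv(2)] by simp
      then obtain x where x: "x \<in> carrier N" "\<iota> x = u \<ominus>\<^bsub>E\<^esub> l g"
        using e'(10)[of "u \<ominus>\<^bsub>E\<^esub> l g"] uv(2) lc[OF g(2)] by auto
      have "p0 (x, g) = (u, v)"
        using x(2) \<alpha>g(2) a_minus_add_cancel(1)[OF E.M.abelian_group_axioms uv(2) lc[OF g(2)]] by (simp add: p0_def)
      then have "p' (x, g) = c"
        using inj_onD[OF eC(6) _ lmod_homD(1)[OF p'(1)] c, of "(x, g)"] p'(2) uv(1) x(1) g(2) by simp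
      then show ?thesis using x(1) g(2) by (intro bexI[of _ "(x, g)"]) simp_all
    qed
  qed
  have sB: "syzygy_of R (Suc d) X ?B" by (rule syzygy_of_Suc[OF s(3) seB P.proj fg_B])
  \<comment> \<open>By \<open>B_ext\<close> the sequence of \<open>?B\<close>, \<open>P d\<close>
    and \<open>B\<close> stays exact after dualizing, and the dual of \<open>P d\<close> is
    projective, so the bound grows by one.\<close>
  have pd: "proj_dim_le (op_ring R) (dual_module R ?B) (int (Suc d) - 1)"
    using proj_dim_le_Suc[OF short_exact_dual[OF seB B_ext] fg_projective_dual[OF P.proj] s(4)] by simp
  \<comment> \<open>The second component of \<open>?i\<close> is the inclusion into
    \<open>P d\<close>, so extending functionals to \<open>P d\<close> is enough.\<close>
  have ext: "extends_along R ?B ?NP ?i"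
    unfolding extends_along_def
  proof
    fix \<phi> assume "\<phi> \<in> lmod_hom R ?B (regular_module R)"
    then obtain \<psi> where \<psi>: "\<psi> \<in> lmod_hom R (P d) (regular_module R)" "\<forall>x\<in>carrier ?B. \<phi> x = \<psi> x"
      using B_ext unfolding extends_along_def by blast
    then show "\<exists>\<psi>\<in>lmod_hom R ?NP (regular_module R). \<forall>x\<in>carrier ?B. \<phi> x = \<psi> (m x, x)"
      by (intro bexI[of _ "\<lambda>z. \<psi> (snd z)"] lmod_hom_comp[OF direct_sum_homs(2) \<psi>(1)]) simp
  qed
  have bn: "f d \<in> lmod_hom R (P (Suc d)) ?B" "f d ` carrier (P (Suc d)) = carrier ?B"
    "a_kernel (P (Suc d)) ?B (f d) = f (Suc d) ` carrier (P (Suc (Suc d)))"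
    using lmod_hom_into_submodule[OF P.diff[of d], of "f d ` carrier (P (Suc d))"] r(5)[of d] by (simp_all add: a_kernel_def')
  show ?thesis
    unfolding syzygy_approximation_def
    by (intro exI conjI) (rule P.proj se syz sB pd ext bn)+
qed

text \<open>Each syzygy sequence trades one degree for one order of syzygy. As \<open>m < n\<close>,
  the module reached in degree \<open>0\<close> is still at least a first syzygy, so it embeds into
  a projective, where left exactness of \<open>Hom\<close> finishes.\<close>

lemma syzygy_module_hom_exact:
  fixes M :: "('a, 'a univ) module"
  assumes "projective_complex R P f" "syzygy_module R n M" "m < n"
    "\<And>i. i \<le> m \<Longrightarrow> hom_exact_at R P f (regular_module R) i"
  shows "hom_exact_at R P f M m"
  using assms(2-4)
proof (induction n arbitrary: M m)
  case (Suc n)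
  interpret projective_complex R P f by fact
  obtain Q N :: "('a, 'a univ) module" and i \<pi> where QN: "fg_projective R Q" "short_exact R M Q N i \<pi>" "syzygy_module R n N"
    using syzygy_module_SucD[OF Suc.prems(1)] by (elim exE conjE)
  have Q: "hom_exact_at R P f Q j" if "j \<le> m" for j
    by (rule hom_exact_at_projective[OF Suc.prems(3)[OF that] QN(1)])
  show ?case
  proof (cases m)
    case 0
    then show ?thesis using hom_exact_at_kernel_0[OF QN(2)] Q by simp
  next
    case (Suc j)
    have "hom_exact_at R P f N j"
      using Suc.IH[OF QN(3)] Suc.prems(2,3) Suc by simp
    then show ?thesis using hom_exact_at_kernel_Suc[OF QN(2)] Q Suc by simp
  qed
qed simp

section \<open>The resolution of the transpose\<close>

text \<open>The resolution begins with copies of the duals of \<open>P1\<close> and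
  \<open>P0\<close>, in degrees \<open>0\<close> and \<open>1\<close>. Dualizing once more returns
  \<open>g\<close> by reflexivity, so \<open>M\<close> is the cokernel of the map from the dual of
  \<open>F 0\<close> to the dual of \<open>F 1\<close>. This places \<open>M\<close> at the start of
  the cochain complex that computes \<open>Ext\<close>.\<close>

lemma transpose_resolution:
  assumes noeth: "left_noetherian (op_ring R)" and pres: "projective_presentation R (P1 :: ('a, 'p) module) (P0 :: ('a, 'q) module) (M :: ('a, 'm) module) g e"
  shows "fg_module (op_ring R) (transpose_module R P1 P0 g) \<and>
    (\<exists>F \<phi> \<epsilon> q. projective_resolution (op_ring R) (transpose_module R P1 P0 g) F \<phi> \<epsilon> \<and>
      q \<in> lmod_hom R (dual_module (op_ring R) (F 1)) M \<and>
      q ` carrier (dual_module (op_ring R) (F 1)) = carrier M \<and>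
      a_kernel (dual_module (op_ring R) (F 1)) M q = dual_coboundaries (op_ring R) F \<phi> 1)"
proof -
  have p: "fg_projective R P1" "fg_projective R P0" "left_module R M" "g \<in> lmod_hom R P1 P0"
    "e \<in> lmod_hom R P0 M" "g ` carrier P1 = a_kernel P0 M e" "e ` carrier P0 = carrier M"
    using pres unfolding projective_presentation_def by simp_all
  note L1 = fg_projective_left_module[OF p(1)] and L0 = fg_projective_left_module[OF p(2)]
  let ?S = "op_ring R"
  let ?T = "transpose_module R P1 P0 g"
  let ?D1 = "dual_module R P1" and ?D0 = "dual_module R P0" and ?gs = "dual_map P1 g"
  note D1 = fg_projective_dual[OF p(1)] and D0 = fg_projective_dual[OF p(2)]
  note LD1 = left_module_dual[OF L1] and LD0 = left_module_dual[OF L0]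
  note gs = dual_map_hom[OF L1 L0 p(4)]
  note I = submodule_hom_image[OF LD0 LD1 gs]
  have T: "?T = quotient_module ?D1 (?gs ` carrier ?D0)" by (simp add: transpose_module_def)
  obtain \<tau> where \<tau>: "\<tau> \<in> lmod_hom ?S ?D1 ?T" "\<tau> ` carrier ?D1 = carrier ?T" "a_kernel ?D1 ?T \<tau> = ?gs ` carrier ?D0"
    unfolding T by (rule quotient_projection[OF LD1 I])
  have LT: "left_module ?S ?T" unfolding T by (rule left_module_quotient[OF LD1 I])
  have fgT: "fg_module ?S ?T" by (rule fg_module_image[OF fg_projective_fg[OF D1] LT \<tau>(1,2)])
  obtain F0 :: "('a, 'a univ) module" and k1 k1' where k1: "fg_projective ?S F0"
    "k1 \<in> lmod_hom ?S ?D1 F0" "k1' \<in> lmod_hom ?S F0 ?D1" "inj_on k1 (carrier ?D1)" "k1 ` carrier ?D1 = carrier F0"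
    "inj_on k1' (carrier F0)" "k1' ` carrier F0 = carrier ?D1"
    "\<forall>x\<in>carrier ?D1. k1' (k1 x) = x" "\<forall>y\<in>carrier F0. k1 (k1' y) = y"
    by (rule fg_projective_univ[OF D1])
  obtain F1 :: "('a, 'a univ) module" and k0 k0' where k0: "fg_projective ?S F1"
    "k0 \<in> lmod_hom ?S ?D0 F1" "k0' \<in> lmod_hom ?S F1 ?D0" "inj_on k0 (carrier ?D0)" "k0 ` carrier ?D0 = carrier F1"
    "inj_on k0' (carrier F1)" "k0' ` carrier F1 = carrier ?D0"
    "\<forall>x\<in>carrier ?D0. k0' (k0 x) = x" "\<forall>y\<in>carrier F1. k0 (k0' y) = y"
    by (rule fg_projective_univ[OF D0])
  note LF0 = fg_projective_left_module[OF k1(1)] and LF1 = fg_projective_left_module[OF k0(1)]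
  define \<eta> where "\<eta> y = k1 (?gs (k0' y))" for y
  have \<eta>: "\<eta> \<in> lmod_hom ?S F1 F0" unfolding \<eta>_def[abs_def] by (intro lmod_hom_comp[OF k0(3)] lmod_hom_comp[OF gs] k1(2))
  obtain F :: "nat \<Rightarrow> ('a, 'a univ) module" and \<phi> where F: "F 0 = F0" "F 1 = F1" "\<phi> 0 = \<eta>" "\<forall>i. fg_projective ?S (F i)"
    "\<forall>i. \<phi> i \<in> lmod_hom ?S (F (Suc i)) (F i)"
    "\<forall>i. \<phi> (Suc i) ` carrier (F (Suc (Suc i))) = a_kernel (F (Suc i)) (F i) (\<phi> i)"
    using resolution_continue[OF noeth k0(1) k1(1) \<eta>] by (elim exE conjE)
  have res: "projective_resolution ?S ?T F \<phi> (\<lambda>x. \<tau> (k1' x))"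
    unfolding projective_resolution_def
  proof (intro conjI LT F(4-6))
    show "(\<lambda>x. \<tau> (k1' x)) \<in> lmod_hom ?S (F 0) ?T" unfolding F(1) by (rule lmod_hom_comp[OF k1(3) \<tau>(1)])
    show "(\<lambda>x. \<tau> (k1' x)) ` carrier (F 0) = carrier ?T" unfolding F(1) using k1(7) \<tau>(2) by (metis image_image)
    show "\<phi> 0 ` carrier (F 1) = a_kernel (F 0) ?T (\<lambda>x. \<tau> (k1' x))"
    proof
      show "\<phi> 0 ` carrier (F 1) \<subseteq> a_kernel (F 0) ?T (\<lambda>x. \<tau> (k1' x))"
      proof (rule image_subsetI)
        fix y assume "y \<in> carrier (F 1)"
        then have y: "k0' y \<in> carrier ?D0" using lmod_homD(1)[OF k0(3)] F(2) by simp
        then have "?gs (k0' y) \<in> a_kernel ?D1 ?T \<tau>" unfolding \<tau>(3) by (rule imageI)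
        then have "?gs (k0' y) \<in> carrier ?D1" "\<tau> (?gs (k0' y)) = \<zero>\<^bsub>?T\<^esub>" unfolding a_kernel_iff by blast+
        then show "\<phi> 0 y \<in> a_kernel (F 0) ?T (\<lambda>x. \<tau> (k1' x))"
          unfolding a_kernel_iff F(1,3) \<eta>_def using lmod_homD(1)[OF k1(2)] k1(8) by simp
      qed
      show "a_kernel (F 0) ?T (\<lambda>x. \<tau> (k1' x)) \<subseteq> \<phi> 0 ` carrier (F 1)"
      proof
        fix x assume "x \<in> a_kernel (F 0) ?T (\<lambda>x. \<tau> (k1' x))"
        then have x: "x \<in> carrier F0" "\<tau> (k1' x) = \<zero>\<^bsub>?T\<^esub>" unfolding a_kernel_iff F(1) by blast+
        then have "k1' x \<in> a_kernel ?D1 ?T \<tau>" unfolding a_kernel_iff using lmod_homD(1)[OF k1(3)] by blast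
        then have "k1' x \<in> ?gs ` carrier ?D0" unfolding \<tau>(3) .
        then obtain \<psi> where \<psi>: "k1' x = ?gs \<psi>" "\<psi> \<in> carrier ?D0" by (rule imageE)
        have "x = \<phi> 0 (k0 \<psi>)" unfolding F(3) \<eta>_def using \<psi> k0(8) k1(9) x(1) by simp metis
        then show "x \<in> \<phi> 0 ` carrier (F 1)"
          using lmod_homD(1)[OF k0(2) \<psi>(2)] by (intro image_eqI[of _ _ "k0 \<psi>"]) (simp_all only: F(2))
      qed
    qed
  qed
  let ?E = "dual_module ?S F1"
  have LE: "left_module R ?E" using left_module_dual[OF LF1] by simp
  \<comment> \<open>Evaluation, transported along \<open>k0'\<close>: it will be the isomorphism
    from \<open>P0\<close> to the dual of \<open>F1\<close>.\<close>
  define \<theta> where "\<theta> x = (\<lambda>y\<in>carrier F1. k0' y x)" for x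
  have \<theta>c: "\<theta> x \<in> carrier ?E" if "x \<in> carrier P0" for x
    unfolding \<theta>_def by (rule restrict_dual[OF LF1 lmod_hom_comp[OF k0(3) dual_eval_hom[OF that]]])
  have k0D: "k0' y \<in> lmod_hom R P0 (regular_module R)" if "y \<in> carrier F1" for y
    by (rule dualD(1)[OF lmod_homD(1)[OF k0(3) that]])
  have \<theta>: "\<theta> \<in> lmod_hom R P0 ?E"
  proof (rule lmod_homI[OF \<theta>c])
    show "\<theta> (x \<oplus>\<^bsub>P0\<^esub> x') = \<theta> x \<oplus>\<^bsub>?E\<^esub> \<theta> x'" if "x \<in> carrier P0" "x' \<in> carrier P0" for x x'
      using lmod_homD(2)[OF k0D that] by (intro dual_eqI[of _ F1]) (simp_all add: \<theta>_def)
    show "\<theta> (a \<odot>\<^bsub>P0\<^esub> x) = a \<odot>\<^bsub>?E\<^esub> \<theta> x" if "a \<in> carrier R" "x \<in> carrier P0" for a x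
      using lmod_homD(3)[OF k0D that] by (intro dual_eqI[of _ F1]) (simp_all add: \<theta>_def)
  qed
  have \<theta>inj: "inj_on \<theta> (carrier P0)"
    unfolding lmod_hom_inj_iff[OF L0 LE \<theta>]
  proof (intro ballI impI)
    fix x assume x: "x \<in> carrier P0" "\<theta> x = \<zero>\<^bsub>?E\<^esub>"
    show "x = \<zero>\<^bsub>P0\<^esub>"
    proof (rule fg_projective_separated[OF p(2) x(1)])
      fix \<psi> assume \<psi>: "\<psi> \<in> carrier ?D0"
      have "\<theta> x (k0 \<psi>) = \<zero>\<^bsub>R\<^esub>" using x(2) lmod_homD(1)[OF k0(2) \<psi>] by simp
      then show "\<psi> x = \<zero>\<^bsub>R\<^esub>" using lmod_homD(1)[OF k0(2) \<psi>] k0(8) \<psi> by (simp add: \<theta>_def)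
    qed
  qed
  have \<theta>im: "\<theta> ` carrier P0 = carrier ?E"
  proof
    show "\<theta> ` carrier P0 \<subseteq> carrier ?E" using \<theta>c by (rule image_subsetI)
    show "carrier ?E \<subseteq> \<theta> ` carrier P0"
    proof
      fix \<Xi> assume \<Xi>: "\<Xi> \<in> carrier ?E"
      obtain x where x: "x \<in> carrier P0" "\<forall>\<psi>\<in>carrier ?D0. \<Xi> (k0 \<psi>) = \<psi> x"
        using fg_projective_reflexive[OF p(2) lmod_hom_comp[OF k0(2) dualD(1)[OF \<Xi>]]] by (elim bexE)
      have "\<Xi> = \<theta> x"
        using x(2) lmod_homD(1)[OF k0(3)] k0(9) dualD(2)[OF \<Xi>]
        by (intro dual_eqI[of _ F1]) (auto simp: \<theta>_def, metis)
      then show "\<Xi> \<in> \<theta> ` carrier P0" using x(1) by (rule image_eqI)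
    qed
  qed
  define \<theta>' where "\<theta>' = inv_into (carrier P0) \<theta>"
  have \<theta>': "\<theta>' \<in> lmod_hom R ?E P0" unfolding \<theta>'_def by (rule lmod_hom_inv_into[OF L0 \<theta> \<theta>inj \<theta>im])
  have \<theta>'\<theta>: "\<theta>' (\<theta> x) = x" if "x \<in> carrier P0" for x unfolding \<theta>'_def using inv_into_f_f[OF \<theta>inj that] .
  have \<theta>\<theta>': "\<theta> (\<theta>' \<Xi>) = \<Xi>" if "\<Xi> \<in> carrier ?E" for \<Xi> unfolding \<theta>'_def using f_inv_into_f[of \<Xi> \<theta>] that \<theta>im by simp
  have \<theta>'im: "\<theta>' ` carrier ?E = carrier P0"
    using \<theta>'\<theta> \<theta>c lmod_homD(1)[OF \<theta>'] by (intro subset_antisym image_subsetI subsetI) (auto intro!: image_eqI)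
  let ?q = "\<lambda>\<Xi>. e (\<theta>' \<Xi>)"
  have "?q \<in> lmod_hom R (dual_module ?S (F 1)) M" unfolding F(2) by (rule lmod_hom_comp[OF \<theta>' p(5)])
  moreover have "?q ` carrier (dual_module ?S (F 1)) = carrier M" unfolding F(2) using \<theta>'im p(7) by (metis image_image)
  moreover have "a_kernel (dual_module ?S (F 1)) M ?q = dual_coboundaries ?S F \<phi> 1"
  proof -
    have cob: "dual_coboundaries ?S F \<phi> 1 = dual_map F1 \<eta> ` carrier (dual_module ?S F0)"
      unfolding dual_coboundaries_def using F(1-3) by simp
    \<comment> \<open>Under the evaluation isomorphisms for \<open>P1\<close> and \<open>P0\<close>
      the dual of \<open>\<eta>\<close> is \<open>g\<close>. The premise on
      \<open>\<Upsilon>\<close> says that it is evaluation at \<open>z\<close>, which reflexivity of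
      \<open>P1\<close> provides for every element of the dual of \<open>F0\<close>.\<close>
    have gz: "dual_map F1 \<eta> \<Upsilon> = \<theta> (g z)"
      if \<Upsilon>: "\<forall>\<psi>\<in>carrier ?D1. \<Upsilon> (k1 \<psi>) = \<psi> z" and z: "z \<in> carrier P1" for \<Upsilon> z
    proof (rule dual_eqI[of _ F1])
      fix y assume y: "y \<in> carrier F1"
      note k = lmod_homD(1)[OF k0(3) y]
      show "dual_map F1 \<eta> \<Upsilon> y = \<theta> (g z) y"
        using y z \<Upsilon> lmod_homD(1)[OF gs k] by (simp add: \<eta>_def \<theta>_def)
    qed (simp_all add: \<theta>_def)
    show ?thesis
      unfolding F(2) cob
    proof
      show "a_kernel ?E M ?q \<subseteq> dual_map F1 \<eta> ` carrier (dual_module ?S F0)"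
      proof
        fix \<Xi> assume "\<Xi> \<in> a_kernel ?E M ?q"
        then have \<Xi>: "\<Xi> \<in> carrier ?E" "e (\<theta>' \<Xi>) = \<zero>\<^bsub>M\<^esub>" unfolding a_kernel_iff by blast+
        then have "\<theta>' \<Xi> \<in> g ` carrier P1" unfolding p(6) a_kernel_iff using lmod_homD(1)[OF \<theta>'] by blast
        then obtain z where z: "\<theta>' \<Xi> = g z" "z \<in> carrier P1" by (rule imageE)
        let ?\<Upsilon> = "\<lambda>x\<in>carrier F0. k1' x z"
        have \<Upsilon>: "?\<Upsilon> \<in> carrier (dual_module ?S F0)"
          by (rule restrict_dual[OF LF0 lmod_hom_comp[OF k1(3) dual_eval_hom[OF z(2)]]])
        have "\<forall>\<psi>\<in>carrier ?D1. ?\<Upsilon> (k1 \<psi>) = \<psi> z" using lmod_homD(1)[OF k1(2)] k1(8) by simp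
        note eq = gz[OF this z(2)]
        have "\<theta> (g z) = \<Xi>" using \<theta>\<theta>'[OF \<Xi>(1)] z(1) by simp
        with eq have "dual_map F1 \<eta> ?\<Upsilon> = \<Xi>" by (rule trans)
        from this[symmetric]
        show "\<Xi> \<in> dual_map F1 \<eta> ` carrier (dual_module ?S F0)" using \<Upsilon> by (rule image_eqI)
      qed
      show "dual_map F1 \<eta> ` carrier (dual_module ?S F0) \<subseteq> a_kernel ?E M ?q"
      proof (rule image_subsetI)
        fix \<Upsilon> assume \<Upsilon>: "\<Upsilon> \<in> carrier (dual_module ?S F0)"
        obtain z where z: "z \<in> carrier P1" "\<forall>\<psi>\<in>carrier ?D1. \<Upsilon> (k1 \<psi>) = \<psi> z"
          using fg_projective_reflexive[OF p(1) lmod_hom_comp[OF k1(2) dualD(1)[OF \<Upsilon>]]] by (elim bexE)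
        have "g z \<in> a_kernel P0 M e" unfolding p(6)[symmetric] using z(1) by (rule imageI)
        then have "g z \<in> carrier P0" "e (g z) = \<zero>\<^bsub>M\<^esub>" unfolding a_kernel_iff by blast+
        then show "dual_map F1 \<eta> \<Upsilon> \<in> a_kernel ?E M ?q"
          unfolding a_kernel_iff gz[OF z(2,1)] using \<theta>c \<theta>'\<theta> by simp
      qed
    qed
  qed
  ultimately show ?thesis using fgT res by (intro conjI exI)
qed

lemma dual_iso:
  assumes "lmod_iso R M N" "left_module R M" "left_module R N"
  shows "lmod_iso (op_ring R) (dual_module R N) (dual_module R M)"
proof -
  obtain h h' where h: "h \<in> lmod_hom R M N" "h' \<in> lmod_hom R N M" "inj_on h (carrier M)"
    "h ` carrier M = carrier N" "inj_on h' (carrier N)" "h' ` carrier N = carrier M"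
    "\<forall>x\<in>carrier M. h' (h x) = x" "\<forall>y\<in>carrier N. h (h' y) = y"
    by (rule lmod_isoE[OF assms(1,2)])
  note H = dual_map_hom[OF assms(2,3) h(1)] and H' = dual_map_hom[OF assms(3,2) h(2)]
  have 1: "dual_map N h' (dual_map M h \<phi>) = \<phi>" if "\<phi> \<in> carrier (dual_module R N)" for \<phi>
    using h(8) lmod_homD(1)[OF h(2)] dualD(2)[OF that] by (intro dual_eqI[of _ N]) simp_all
  have 2: "dual_map M h (dual_map N h' \<phi>) = \<phi>" if "\<phi> \<in> carrier (dual_module R M)" for \<phi>
    using h(7) lmod_homD(1)[OF h(1)] dualD(2)[OF that] by (intro dual_eqI[of _ M]) simp_all
  show ?thesis
  proof (rule lmod_isoI[OF H])
    show "inj_on (dual_map M h) (carrier (dual_module R N))"      by (rule inj_on_inverseI[where g = "dual_map N h'"]) (rule 1)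
    show "dual_map M h ` carrier (dual_module R N) = carrier (dual_module R M)"
    proof
      show "dual_map M h ` carrier (dual_module R N) \<subseteq> carrier (dual_module R M)"
        using lmod_homD(1)[OF H] by (rule image_subsetI)
      show "carrier (dual_module R M) \<subseteq> dual_map M h ` carrier (dual_module R N)"
      proof
        fix \<psi> assume \<psi>: "\<psi> \<in> carrier (dual_module R M)"
        show "\<psi> \<in> dual_map M h ` carrier (dual_module R N)"
          using 2[OF \<psi>] lmod_homD(1)[OF H' \<psi>] by (intro image_eqI[of _ _ "dual_map N h' \<psi>"]) simp_all
      qed
    qed
  qed
qed

text \<open>The approximation lemmas take modules in the universe, so the cokernels of the dual
  complex are copied there, each with the surjection that defines it.\<close>

lemma fg_dual_quotient_univ:
  assumes "projective_complex S F \<phi>"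
  shows "\<exists>(W :: ('a, 'a univ) module) q. fg_module (op_ring S) W \<and> q \<in> lmod_hom (op_ring S) (dual_module S (F n)) W \<and>
    q ` carrier (dual_module S (F n)) = carrier W \<and>
    a_kernel (dual_module S (F n)) W q = dual_coboundaries S (F :: nat \<Rightarrow> ('a, 'm) module) \<phi> n"
proof -
  interpret projective_complex S F \<phi> by fact
  let ?E = "dual_module S (F n)" and ?B = "dual_coboundaries S F \<phi> n"
  note LE = left_module_dual[OF lm]
  have B: "submodule ?B (op_ring S) ?E"
    using dual_coboundaries_submodule[of n]
    unfolding submodule_of_submodule_iff[OF left_module_dual[OF lm] dual_cocycles_submodule] by simp
  obtain q where q: "q \<in> lmod_hom (op_ring S) ?E (quotient_module ?E ?B)"
    "q ` carrier ?E = carrier (quotient_module ?E ?B)" "a_kernel ?E (quotient_module ?E ?B) q = ?B"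
    by (rule quotient_projection[OF LE B])
  note LQ = left_module_quotient[OF LE B]
  have fgQ: "fg_module (op_ring S) (quotient_module ?E ?B)"
    by (rule fg_module_image[OF fg_projective_fg[OF fg_projective_dual[OF proj]] LQ q(1,2)])
  obtain W :: "('a, 'a univ) module" and h h' where h: "fg_module (op_ring S) W" "left_module (op_ring S) W"
    "h \<in> lmod_hom (op_ring S) (quotient_module ?E ?B) W" "h' \<in> lmod_hom (op_ring S) W (quotient_module ?E ?B)"
    "inj_on h (carrier (quotient_module ?E ?B))" "h ` carrier (quotient_module ?E ?B) = carrier W"
    "inj_on h' (carrier W)" "h' ` carrier W = carrier (quotient_module ?E ?B)"
    "\<forall>x\<in>carrier (quotient_module ?E ?B). h' (h x) = x" "\<forall>y\<in>carrier W. h (h' y) = y"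
    by (rule fg_module_univ[OF fgQ])
  have "(\<lambda>x. h (q x)) \<in> lmod_hom (op_ring S) ?E W" by (rule lmod_hom_comp[OF q(1) h(3)])
  moreover have "(\<lambda>x. h (q x)) ` carrier ?E = carrier W" using q(2) h(6) by (metis image_image)
  moreover have "a_kernel ?E W (\<lambda>x. h (q x)) = ?B"
    unfolding a_kernel_comp_inj[OF LQ h(2) q(1) h(3,5)] by (rule q(3))
  ultimately show ?thesis using h(1) by (intro exI conjI)
qed

text \<open>Joins the vanishing of \<open>X j\<close> for \<open>j < d\<close> to the descent from
  \<open>W d\<close> to \<open>W 0\<close>. The hypothesis \<open>Suc d \<le> k\<close> lets the
  Gorenstein condition reach \<open>Ext\<close> in degree \<open>d + 1\<close>.\<close>

lemma syzygy_approximation_exists: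
  fixes M :: "('a, 'm) module" and P1 :: "('a, 'p) module" and P0 :: "('a, 'q) module"
  assumes noeth: "left_noetherian R" "left_noetherian (op_ring R)" and gor: "quasi_gorenstein k R"
    and d: "Suc d \<le> k" and M: "syzygy_module R d M" and pres: "projective_presentation R P1 P0 M g e"
  shows "\<exists>(W :: ('a, 'a univ) module) X G f. lmod_iso R M W \<and> left_module R W \<and> left_module R X \<and>
    lmod_iso R X (Ext (op_ring R) (Suc d) (transpose_module R P1 P0 g)) \<and>
    left_module R (Ext (op_ring R) (Suc d) (transpose_module R P1 P0 g)) \<and>
    syzygy_approximation R G f (X :: ('a, 'a univ) module) d W"
proof -
  let ?S = "op_ring R"
  let ?T = "transpose_module R P1 P0 g"
  have LM: "left_module R M" using M unfolding syzygy_module_def by (intro fg_module_left_module) (elim conjE)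
  obtain F \<phi> \<epsilon> qM where fgT: "fg_module ?S ?T" and res: "projective_resolution ?S ?T F \<phi> \<epsilon>"
    and qM: "qM \<in> lmod_hom R (dual_module ?S (F 1)) M" "qM ` carrier (dual_module ?S (F 1)) = carrier M"
      "a_kernel (dual_module ?S (F 1)) M qM = dual_coboundaries ?S F \<phi> 1"
    using transpose_resolution[OF noeth(2) pres] by (elim conjE exE)
  interpret F: projective_complex ?S F \<phi> by (rule projective_resolution_complex[OF res])
  \<comment> \<open>The shift by one makes \<open>E 0\<close> isomorphic to \<open>P0\<close>, and
    \<open>Ext\<close> in degree \<open>j + 1\<close> is read off at \<open>E j\<close>.\<close>
  define E where "E j = dual_module ?S (F (Suc j))" for j
  define \<delta> where "\<delta> j = dual_map (F (Suc (Suc j))) (\<phi> (Suc j))" for j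
  let ?Z = "\<lambda>j. dual_cocycles ?S F \<phi> (Suc j)" and ?C = "\<lambda>j. dual_coboundaries ?S F \<phi> (Suc j)"
  have E: "fg_projective R (E j)" for j using fg_projective_dual[OF F.proj] by (simp add: E_def)
  note LE = fg_projective_left_module[OF E]
  have \<delta>: "\<delta> j \<in> lmod_hom R (E j) (E (Suc j))" for j
    using dual_map_hom[OF F.lm F.lm F.diff] by (simp add: E_def \<delta>_def)
  have Z: "?Z j = a_kernel (E j) (E (Suc j)) (\<delta> j)" for j by (simp add: dual_cocycles_def E_def \<delta>_def)
  have C: "?C (Suc j) = \<delta> j ` carrier (E j)" for j by (simp add: dual_coboundaries_def E_def \<delta>_def)
  have CZ: "?C j \<subseteq> ?Z j" for j
    using F.dual_coboundaries_submodule[of "Suc j"]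
    unfolding submodule_of_submodule_iff[OF left_module_dual[OF F.lm] F.dual_cocycles_submodule] by simp
  have "\<forall>j. \<exists>W q. fg_module R (W :: ('a, 'a univ) module) \<and> q \<in> lmod_hom R (E j) W \<and> q ` carrier (E j) = carrier W \<and>
      a_kernel (E j) W q = ?C j"
    using fg_dual_quotient_univ[OF F.projective_complex_axioms] by (simp add: E_def)
  from choice[OF this] obtain W :: "nat \<Rightarrow> ('a, 'a univ) module" where
    "\<forall>j. \<exists>q. fg_module R (W j) \<and> q \<in> lmod_hom R (E j) (W j) \<and> q ` carrier (E j) = carrier (W j) \<and>
      a_kernel (E j) (W j) q = ?C j" by (elim exE)
  from choice[OF this] obtain q where Wq:
    "\<forall>j. fg_module R (W j) \<and> q j \<in> lmod_hom R (E j) (W j) \<and> q j ` carrier (E j) = carrier (W j) \<and>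
      a_kernel (E j) (W j) (q j) = ?C j" by (elim exE)
  have W: "fg_module R (W j)" and q: "q j \<in> lmod_hom R (E j) (W j)" "q j ` carrier (E j) = carrier (W j)"
    "a_kernel (E j) (W j) (q j) = ?C j" for j using Wq by simp_all
  note LW = fg_module_left_module[OF W]
  \<comment> \<open>Both modules are quotients of \<open>E 0\<close>, through \<open>qM\<close> and
    \<open>q 0\<close>, with the coboundaries in degree \<open>1\<close> as kernel.\<close>
  have MW: "lmod_iso R M (W 0)"
    using lmod_iso_of_same_kernel[OF LE[of 0] LM LW[of 0] _ _ q(1,2)[of 0], of qM] qM q(3)[of 0]
    unfolding lmod_iso_def E_def by auto
  have "\<forall>j. \<exists>w. w \<in> lmod_hom R (W j) (E (Suc j)) \<and> (\<forall>x\<in>carrier (E j). w (q j x) = \<delta> j x)"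
    unfolding Bex_def[symmetric]
  proof (intro allI lmod_hom_factor[OF LE LW LE q(1,2) \<delta>])
    fix j x assume "x \<in> carrier (E j)" "q j x = \<zero>\<^bsub>W j\<^esub>"
    then have "x \<in> ?C j" unfolding q(3)[of j, symmetric] by (simp add: a_kernel_iff)
    then have "x \<in> a_kernel (E j) (E (Suc j)) (\<delta> j)" using CZ Z by blast
    then show "\<delta> j x = \<zero>\<^bsub>E (Suc j)\<^esub>" by (simp add: a_kernel_iff)
  qed
  from choice[OF this] obtain w where w: "\<And>j. w j \<in> lmod_hom R (W j) (E (Suc j))"
    "\<And>j x. x \<in> carrier (E j) \<Longrightarrow> w j (q j x) = \<delta> j x" by auto
  define X where "X j = (W j)\<lparr>carrier := a_kernel (W j) (E (Suc j)) (w j)\<rparr>" for j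
  have subX: "submodule (a_kernel (W j) (E (Suc j)) (w j)) R (W j)" for j by (rule submodule_a_kernel[OF LW LE w(1)])
  have fgX: "fg_module R (X j)" for j unfolding X_def by (rule noetherian_fg_submodule[OF noeth(1) W subX])
  note LX = fg_module_left_module[OF fgX]
  obtain F' \<phi>' \<epsilon>' where ch: "chosen_resolution ?S ?T = (F', \<phi>')" "projective_resolution ?S ?T F' \<phi>' \<epsilon>'"
    by (rule chosen_resolution[OF noeth(2) fgT])
  have XExt: "lmod_iso R (X j) (Ext ?S (Suc j) ?T)" "left_module R (Ext ?S (Suc j) ?T)" for j
  proof -
    let ?D = "(E j)\<lparr>carrier := ?Z j\<rparr>"
    have subZ: "submodule (?Z j) R (E j)" using F.dual_cocycles_submodule[of "Suc j"] by (simp add: E_def)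
    note LD = submodule_left_module[OF LE subZ]
    interpret F': projective_complex ?S F' \<phi>' by (rule projective_resolution_complex[OF ch(2)])
    show LExt: "left_module R (Ext ?S (Suc j) ?T)"
      unfolding Ext_def ch(1) prod.case
      using left_module_quotient[OF submodule_left_module[OF left_module_dual[OF F'.lm] F'.dual_cocycles_submodule]
          F'.dual_coboundaries_submodule, of "Suc j"] unfolding op_ring_op_ring .
    obtain r where r: "r \<in> lmod_hom R ?D (Ext ?S (Suc j) ?T)" "r ` ?Z j = carrier (Ext ?S (Suc j) ?T)"
      "a_kernel ?D (Ext ?S (Suc j) ?T) r = ?C j"
      using Ext_of_resolution[OF ch res, of j] unfolding op_ring_op_ring E_def[symmetric] by (elim bexE conjE)
    have qZ: "x \<in> ?Z j \<longleftrightarrow> q j x \<in> carrier (X j)" if x: "x \<in> carrier (E j)" for x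
      unfolding Z X_def using x w(2)[OF x] lmod_homD(1)[OF q(1) x] by (simp add: a_kernel_iff)
    have ZE: "?Z j \<subseteq> carrier (E j)" by (rule left_module.submoduleD(1)[OF LE subZ])
    have q': "q j \<in> lmod_hom R ?D (X j)"
      unfolding X_def
    proof (rule lmod_hom_into_submodule[OF lmod_hom_from_submodule[OF LE subZ q(1)]])
      fix x assume "x \<in> carrier ?D"
      then show "q j x \<in> a_kernel (W j) (E (Suc j)) (w j)" using qZ[of x] ZE by (auto simp: X_def)
    qed
    have q'im: "q j ` carrier ?D = carrier (X j)"
    proof
      show "q j ` carrier ?D \<subseteq> carrier (X j)" using lmod_homD(1)[OF q'] by (rule image_subsetI)
      show "carrier (X j) \<subseteq> q j ` carrier ?D"
      proof
        fix y assume y: "y \<in> carrier (X j)"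
        then have "y \<in> q j ` carrier (E j)" unfolding q(2) X_def by (simp add: a_kernel_iff)
        then obtain x where "y = q j x" "x \<in> carrier (E j)" by (rule imageE)
        then show "y \<in> q j ` carrier ?D" using y qZ by (intro image_eqI[of _ _ x]) simp_all
      qed
    qed
    have "a_kernel ?D (X j) (q j) = ?C j"
      using CZ[of j] ZE unfolding q(3)[of j, symmetric] by (auto simp: a_kernel_iff X_def)
    then obtain v where "v \<in> lmod_hom R (X j) (Ext ?S (Suc j) ?T)" "bij_betw v (carrier (X j)) (carrier (Ext ?S (Suc j) ?T))"
      using lmod_iso_of_same_kernel[OF LD LX LExt q' q'im r(1)] r(2,3) by auto
    then show "lmod_iso R (X j) (Ext ?S (Suc j) ?T)" unfolding lmod_iso_def by (intro bexI)
  qed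
  \<comment> \<open>The Gorenstein condition is used in degree \<open>j + 1\<close>, which is at
    most \<open>d + 1\<close> and hence at most \<open>k\<close>. It speaks of modules in the
    universe, so the transpose is replaced by a copy, whose \<open>Ext\<close> is equal to that of
    the original.\<close>
  have grade: "zero_module (Ext R n (X j))" if "j \<le> d" "n \<le> j" for j n
  proof -
    obtain N :: "('a, 'a univ) module" and h h' where N: "fg_module ?S N" "left_module ?S N"
      "h \<in> lmod_hom ?S ?T N" "h' \<in> lmod_hom ?S N ?T" "inj_on h (carrier ?T)" "h ` carrier ?T = carrier N"
      "inj_on h' (carrier N)" "h' ` carrier N = carrier ?T"
      "\<forall>x\<in>carrier ?T. h' (h x) = x" "\<forall>y\<in>carrier N. h (h' y) = y"
      by (rule fg_module_univ[OF fgT])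
    have "grade_ge R (Ext ?S (Suc j) N) (Suc j)"
      using gor N(1) that(1) d unfolding quasi_gorenstein_def by simp
    moreover have "Ext ?S (Suc j) N = Ext ?S (Suc j) ?T"
      by (rule Ext_iso[OF lmod_isoI[OF N(4,7,8)] N(2) fg_module_left_module[OF fgT]])
    ultimately have "zero_module (Ext R n (Ext ?S (Suc j) ?T))"
      using that(2) unfolding grade_ge_def by simp
    then show ?thesis using Ext_iso[OF XExt(1) LX XExt(2), of n j] by simp
  qed
  have X_res: "\<exists>G f e. projective_resolution R (X j) G f e \<and> (\<forall>n\<le>j. hom_exact_at R G f (regular_module R) n)"
    if j: "j \<le> d" for j
  proof -
    obtain G f e where G: "chosen_resolution R (X j) = (G, f)" "projective_resolution R (X j) G f e"
      by (rule chosen_resolution[OF noeth(1) fgX])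
    have "\<forall>n\<le>j. hom_exact_at R G f (regular_module R) n"
      using hom_exact_at_of_Ext_zero[OF projective_resolution_complex[OF G(2)] G(1)] grade[OF j] by simp
    then show ?thesis using G(2) by (intro exI conjI)
  qed
  \<comment> \<open>Vanishing of \<open>X j\<close> is injectivity of \<open>w j\<close>. Exactness
    in the middle holds because \<open>w j\<close> and \<open>\<delta> j\<close> have the same
    image, namely the kernel of \<open>q (Suc j)\<close>.\<close>
  have Wseq: "short_exact R (W j) (E (Suc j)) (W (Suc j)) (w j) (q (Suc j))" if z: "carrier (X j) = {\<zero>\<^bsub>W j\<^esub>}" for j
  proof -
    have "inj_on (w j) (carrier (W j))"
      unfolding lmod_hom_inj_iff[OF LW LE w(1)]
    proof (intro ballI impI)
      fix x assume "x \<in> carrier (W j)" "w j x = \<zero>\<^bsub>E (Suc j)\<^esub>"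
      then have "x \<in> carrier (X j)" by (simp add: X_def a_kernel_iff)
      then show "x = \<zero>\<^bsub>W j\<^esub>" using z by simp
    qed
    moreover have "w j ` carrier (W j) = \<delta> j ` carrier (E j)"
      unfolding q(2)[symmetric] image_image using w(2) by (intro image_cong refl)
    ultimately show ?thesis unfolding short_exact_def using LW LE w(1) q[of "Suc j"] C[of j] by simp
  qed
  have W0: "syzygy_module R d (W 0)" by (rule syzygy_module_iso[OF M MW LW])
  have X0: "carrier (X j) = {\<zero>\<^bsub>W j\<^esub>}" if "j < d" for j
    using that
  proof (induction j rule: less_induct)
    case (less j)
    obtain G f e where G: "projective_resolution R (X j) G f e" "\<forall>n\<le>j. hom_exact_at R G f (regular_module R) n"
      using X_res[of j] less.prems by auto
    interpret G: projective_complex R G f by (rule projective_resolution_complex[OF G(1)])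
    note r = projective_resolutionD[OF G(1)]
    \<comment> \<open>\<open>Ext\<close> in degree \<open>j - i\<close> of \<open>X j\<close> with
      values in \<open>W i\<close>: raising \<open>i\<close> lowers the degree, until at
      \<open>i = j\<close> only homomorphisms are left. The sequences used have index below
      \<open>j\<close>, where the induction hypothesis gives exactness.\<close>
    have "hom_exact_at R G f (W i) (j - i)" if "i \<le> j" for i
      using that
    proof (induction i)
      case 0
      show ?case using syzygy_module_hom_exact[OF G.projective_complex_axioms W0 less.prems] G(2) by simp
    next
      case (Suc i)
      have "hom_exact_at R G f (W i) (Suc (j - Suc i))" using Suc by (simp add: Suc_diff_Suc)
      moreover have "hom_exact_at R G f (E (Suc i)) (j - Suc i)"
        by (rule G.hom_exact_at_projective[OF _ E]) (use G(2) in simp)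
      ultimately show ?case using G.hom_exact_at_cokernel[OF Wseq[OF less.IH]] Suc.prems less.prems by simp
    qed
    from this[of j] have ex: "hom_exact_at R G f (W j) 0" by simp
    \<comment> \<open>Viewed as a map into \<open>W j\<close>, the augmentation \<open>e\<close>
      must vanish by exactness in degree \<open>0\<close>, but its image is
      \<open>X j\<close>.\<close>
    have e: "e \<in> lmod_hom R (G 0) (W j)"
      using lmod_homD[OF r(2)] by (intro lmod_homI) (simp_all add: X_def a_kernel_iff)
    have "e x = \<zero>\<^bsub>W j\<^esub>" if x: "x \<in> carrier (G 0)" for x
      by (rule hom_exact_at_0D[OF ex e _ x]) (use r(6) in \<open>simp add: X_def\<close>)
    then have "carrier (X j) \<subseteq> {\<zero>\<^bsub>W j\<^esub>}" unfolding r(3)[symmetric] by (intro image_subsetI) simp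
    moreover have "\<zero>\<^bsub>W j\<^esub> \<in> carrier (X j)" using left_module.submoduleD(2)[OF LW subX] by (simp add: X_def)
    ultimately show ?case by (intro subset_antisym) simp_all
  qed
  obtain G f e where G: "projective_resolution R (X d) G f e" "\<forall>n\<le>d. hom_exact_at R G f (regular_module R) n"
    using X_res[of d] by auto
  \<comment> \<open>The count of steps runs against the index: after \<open>i\<close> steps the
    module approximated is \<open>W (d - i)\<close>, so \<open>i = d\<close> reaches
    \<open>W 0\<close>.\<close>
  have "syzygy_approximation R G f (X d) i (W (d - i))" if "i \<le> d" for i
    using that
  proof (induction i)
    case 0
    show ?case
      using syzygy_approximation_0[OF noeth(1) W E w(1), of d G f e] G unfolding X_def by simp
  next
    case (Suc i)
    have *: "Suc (d - Suc i) = d - i" using Suc.prems by simp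
    have "d - Suc i < d" using Suc.prems by simp
    from Wseq[OF X0[OF this]] have s: "short_exact R (W (d - Suc i)) (E (Suc (d - Suc i))) (W (d - i)) (w (d - Suc i)) (q (d - i))"
      unfolding * .
    show ?case
      by (rule syzygy_approximation_Suc[OF noeth(1) W E s G(1)]) (use G(2) Suc in simp_all)
  qed
  from this[of d] have "syzygy_approximation R G f (X d) d (W 0)" by simp
  then show ?thesis using MW LW LX XExt by blast
qed

theorem mainTheorem1:
  fixes R :: "'a ring" and k d :: nat
    and M :: "('a, 'm) module" and P1 :: "('a, 'p) module" and P0 :: "('a, 'q) module"
    and g :: "'p \<Rightarrow> 'q" and e :: "'q \<Rightarrow> 'm"
  assumes "k \<ge> 1"
    and "ring R" and "left_noetherian R" and "right_noetherian R"
    and "quasi_gorenstein k R"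
    and "d \<le> k - 1"
    and "syzygy_module R d M"
    and "projective_presentation R P1 P0 M g e"
  shows "\<exists>(P :: ('a, 'a univ) module) (B :: ('m \<times> 'a univ) set) (C :: ('a, 'a univ) module) p.
     fg_projective R P \<and>
     submodule B R (direct_sum M P) \<and>
     syzygy_of R d (Ext (op_ring R) (d + 1) (transpose_module R P1 P0 g))
       ((direct_sum M P)\<lparr>carrier := B\<rparr>) \<and>
     short_exact R ((direct_sum M P)\<lparr>carrier := B\<rparr>) (direct_sum M P) C (\<lambda>x. x) p \<and>
     syzygy_module R (d + 1) C \<and>
     proj_dim_le (op_ring R) (dual_module R ((direct_sum M P)\<lparr>carrier := B\<rparr>)) (int d - 1) \<and>
     short_exact (op_ring R)
       (dual_module R C) (dual_module R (direct_sum M P))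
       (dual_module R ((direct_sum M P)\<lparr>carrier := B\<rparr>))
       (dual_map (direct_sum M P) p)
       (dual_map ((direct_sum M P)\<lparr>carrier := B\<rparr>) (\<lambda>x. x))"
proof -
  let ?T = "transpose_module R P1 P0 g"
  have noeth: "left_noetherian (op_ring R)" using assms(4) by (simp add: right_noetherian_def)
  \<comment> \<open>Subtraction on naturals is truncated; \<open>k \<ge> 1\<close> rules out the
    case in which \<open>d \<le> k - 1\<close> would hold with \<open>k = 0\<close>.\<close>
  have d: "Suc d \<le> k" using assms(1,6) by simp
  have LM: "left_module R M"
    using assms(7) unfolding syzygy_module_def by (intro fg_module_left_module) (elim conjE)
  obtain W X :: "('a, 'a univ) module" and G f where iso: "lmod_iso R M W" and LW: "left_module R W" and LX: "left_module R X"
    and XExt: "lmod_iso R X (Ext (op_ring R) (Suc d) ?T)" "left_module R (Ext (op_ring R) (Suc d) ?T)"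
    and app: "syzygy_approximation R G f X d W"
    using syzygy_approximation_exists[OF assms(3) noeth assms(5) d assms(7,8)] by (elim exE conjE)
  obtain P B C :: "('a, 'a univ) module" and i p b where P: "fg_projective R P"
    and s: "short_exact R B (direct_sum W P) C i p" "syzygy_module R (Suc d) C"
      "syzygy_of R d X B" "proj_dim_le (op_ring R) (dual_module R B) (int d - 1)"
      "extends_along R B (direct_sum W P) i"
    using app unfolding syzygy_approximation_def by (elim exE conjE)
  note s' = short_exactD[OF s(1)]
  note LP = fg_projective_left_module[OF P]
  obtain h h' where h: "h \<in> lmod_hom R M W" "h' \<in> lmod_hom R W M" "inj_on h (carrier M)"
    "h ` carrier M = carrier W" "inj_on h' (carrier W)" "h' ` carrier W = carrier M"
    "\<forall>x\<in>carrier M. h' (h x) = x" "\<forall>y\<in>carrier W. h (h' y) = y"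
    by (rule lmod_isoE[OF iso LM])
  let ?MP = "direct_sum M P"
  note LMP = left_module_direct_sum[OF LM LP]
  let ?k = "\<lambda>z. (h' (fst z), snd z)" and ?k' = "\<lambda>z. (h (fst z), snd z)"
  have k: "?k \<in> lmod_hom R (direct_sum W P) ?MP" "?k' \<in> lmod_hom R ?MP (direct_sum W P)"
    by (intro direct_sum_hom_pair lmod_hom_comp[OF direct_sum_homs(1) h(2)] direct_sum_homs(2),
        intro direct_sum_hom_pair lmod_hom_comp[OF direct_sum_homs(1) h(1)] direct_sum_homs(2))
  let ?i = "\<lambda>x. ?k (i x)" and ?p = "\<lambda>z. p (?k' z)"
  have kk: "\<forall>x\<in>carrier (direct_sum W P). ?k' (?k x) = x" "\<forall>y\<in>carrier ?MP. ?k (?k' y) = y"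
    using h(7,8) by auto
  have se: "short_exact R B ?MP C ?i ?p"
    using short_exact_iso[OF s(1) s'(1) lmod_hom_id inj_on_id2 image_ident LMP k kk] .
  note e = short_exactD[OF se]
  \<comment> \<open>The submodule has to be a subset of the direct sum with the inclusion as map, so
    the abstract module \<open>B\<close> is replaced by its image.\<close>
  let ?B = "?i ` carrier B"
  let ?Bm = "?MP\<lparr>carrier := ?B\<rparr>"
  note sub = submodule_hom_image[OF e(1,2,4)]
  note LB = submodule_left_module[OF LMP sub]
  have iB: "?i \<in> lmod_hom R B ?Bm" by (rule lmod_hom_into_submodule[OF e(4)]) simp
  have isoB: "lmod_iso R B ?Bm" by (rule lmod_isoI[OF iB e(6)]) simp
  have seB: "short_exact R ?Bm ?MP C (\<lambda>x. x) ?p"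
    unfolding short_exact_def
    using LB LMP e(3,5,7,8) lmod_hom_from_submodule[OF LMP sub lmod_hom_id] by simp
  have ext: "extends_along R ?Bm ?MP (\<lambda>x. x)"
    unfolding extends_along_def
  proof
    fix \<phi> assume \<phi>: "\<phi> \<in> lmod_hom R ?Bm (regular_module R)"
    obtain \<psi> where \<psi>: "\<psi> \<in> lmod_hom R (direct_sum W P) (regular_module R)" "\<forall>x\<in>carrier B. \<phi> (?i x) = \<psi> (i x)"
      using bspec[OF s(5)[unfolded extends_along_def] lmod_hom_comp[OF iB \<phi>]] by (elim bexE)
    \<comment> \<open>An extension found on the direct sum with \<open>W\<close> is carried to the
      one with \<open>M\<close> by \<open>?k'\<close>, which undoes \<open>?k\<close> on the image
      of \<open>i\<close>.\<close>
    have "\<phi> x = \<psi> (?k' x)" if x: "x \<in> carrier ?Bm" for x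
    proof -
      have "x \<in> ?i ` carrier B" using x by simp
      then obtain y where y: "x = ?i y" "y \<in> carrier B" by (rule imageE)
      have "?k' x = i y" using kk(1)[rule_format, OF lmod_homD(1)[OF s'(4) y(2)]] unfolding y(1) .
      then show ?thesis using \<psi>(2)[rule_format, OF y(2)] unfolding y(1) by simp
    qed
    then show "\<exists>\<psi>\<in>lmod_hom R ?MP (regular_module R). \<forall>x\<in>carrier ?Bm. \<phi> x = \<psi> x"
      by (intro bexI[of _ "\<lambda>x. \<psi> (?k' x)"] ballI lmod_hom_comp[OF k(2) \<psi>(1)])
  qed
  have "syzygy_of R d (Ext (op_ring R) (d + 1) ?T) ?Bm"
    using syzygy_of_iso[OF s(3) XExt isoB LB] by simp
  moreover have "proj_dim_le (op_ring R) (dual_module R ?Bm) (int d - 1)"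
    by (rule proj_dim_le_iso[OF s(4) dual_iso[OF lmod_iso_sym[OF isoB s'(1)] LB s'(1)] left_module_dual[OF s'(1)] left_module_dual[OF LB]])
  moreover have "syzygy_module R (d + 1) C" using s(2) by simp
  ultimately show ?thesis
    using P sub seB short_exact_dual[OF seB ext]
    by (intro exI[of _ P] exI[of _ ?B] exI[of _ C] exI[of _ ?p] conjI)
qed

end
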